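(* Let $d\in\mathbb N$ and $2\le p<\infty$. There is a constant $C=C(p,d)>0$ such that for all $n\in\mathbb N$ and all $m=0,1,2,\dots$, with $\bar m:=\max(m,1)$, $$ d_m(\mathcal T(\Delta Q_n)_p,L_\infty)\le C\,(2^n/\bar m)^{1/p}\,n^{(d-1)(1-1/p)+1/p} $$ and $$ d_m(\mathcal T(Q_n)_p,L_\infty)\le C\,(2^n/\bar m)^{1/p}\,n^{(d-1)(1-1/p)+1/p}. $$
   Context: All functions are $2\pi$-periodic in each of $d$ variables, i.e. defined on the torus $\mathbb T^d$; $L_p=L_p(\mathbb T^d)$ with norm $\|\cdot\|_p$ (with respect to normalized Lebesgue measure). Kolmogorov widths: for a compact subset $\mathbf F$ of a Banach space $X$, $$d_m(\mathbf F,X):=\inf_{\{u_i\}_{i=1}^m\subset X}\ \sup_{f\in\mathbf F}\ \inf_{c_1,\dots,c_m}\Big\|f-\sum_{i=1}^m c_iu_i\Big\|_X\quad (m=1,2,\dots),\qquad d_0(\mathbf F,X):=\sup_{f\in\mathbf F}\|f\|_X ,$$ where the $c_i$ are scalars. For $\mathbf s=(s_1,\dots,s_d)$ with nonnegative integer entries, $\|\mathbf s\|_1=s_1+\dots+s_d$ and $$\rho(\mathbf s):=\{\mathbf k\in\mathbb Z^d:\ [2^{s_j-1}]\le |k_j|<2^{s_j},\ j=1,\dots,d\},$$ where $[\cdot]$ is the integer part. The stepped hyperbolic cross is $Q_n:=\bigcup_{\|\mathbf s\|_1\le n}\rho(\mathbf s)$, and $\Delta Q_n:=Q_n\setminus Q_{n-1}$.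 For a finite set $Q\subset\mathbb Z^d$, $\mathcal T(Q):=\{f: f=\sum_{\mathbf k\in Q}c_{\mathbf k}e^{i(\mathbf k,\mathbf x)}\}$ is the space of trigonometric polynomials with frequencies in $Q$, and $\mathcal T(Q)_p:=\{f\in\mathcal T(Q): \|f\|_p\le 1\}$. *)

theory Defs
  imports "HOL-Probability.Probability"
begin

text \<open>Functions on the \<open>d\<close>-dimensional torus are functions on \<open>real ^ 'd\<close>, \<open>d = CARD('d)\<close>, that are
  \<open>2 * pi\<close>-periodic in each variable; norms are taken over one period box.\<close>

definition torus_measure :: "(real ^ 'd) measure" where
  "torus_measure = uniform_measure lebesgue (cbox 0 (\<chi> j. 2 * pi))"

definition torus_periodic :: "(real ^ 'd \<Rightarrow> complex) \<Rightarrow> bool" where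
  "torus_periodic f \<longleftrightarrow> (\<forall>x j. f (x + axis j (2 * pi)) = f x)"

text \<open>The Bochner integral is \<open>0\<close> for non-integrable functions, so this is the \<open>L\<^sub>p\<close> norm only on
  \<open>L\<^sub>p\<close>. It is applied to trigonometric polynomials only, which are bounded and continuous.\<close>

definition Lp_norm :: "real \<Rightarrow> (real ^ 'd \<Rightarrow> complex) \<Rightarrow> real" where
  "Lp_norm p f = (\<integral>x. norm (f x) powr p \<partial>torus_measure) powr (1 / p)"

definition Linf_norm :: "(real ^ 'd \<Rightarrow> complex) \<Rightarrow> ennreal" where
  "Linf_norm f = esssup torus_measure (\<lambda>x. ennreal (norm (f x)))"

text \<open>Functions are not identified when they agree almost everywhere: \<open>Linf_norm\<close> is a seminorm on
  \<open>Linf\<close>. Passing to the quotient does not change Kolmogorov widths.\<close>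

definition Linf :: "(real ^ 'd \<Rightarrow> complex) set" where
  "Linf = {f \<in> borel_measurable torus_measure. torus_periodic f \<and> Linf_norm f < \<infinity>}"

text \<open>The width of \<open>F\<close> in the space \<open>X\<close> of complex-valued functions with (semi)norm \<open>N\<close>. The values
  are in \<open>ennreal\<close>, where all infima and suprema exist.\<close>

definition kolmogorov_width ::
  "nat \<Rightarrow> ('a \<Rightarrow> complex) set \<Rightarrow> ('a \<Rightarrow> complex) set \<Rightarrow> (('a \<Rightarrow> complex) \<Rightarrow> ennreal) \<Rightarrow> ennreal" where
  "kolmogorov_width m F X N =
    (if m = 0 then (SUP f\<in>F. N f)
     else (INF u \<in> {u :: nat \<Rightarrow> 'a \<Rightarrow> complex. \<forall>i\<in>{1..m}. u i \<in> X}.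
             SUP f\<in>F. INF c :: nat \<Rightarrow> complex. N (\<lambda>x. f x - (\<Sum>i=1..m. c i * u i x))))"

definition dyadic_block :: "nat ^ 'd \<Rightarrow> (int ^ 'd) set" where
  "dyadic_block s =
    {k. \<forall>j. \<lfloor>(2::real) powi (int (s $ j) - 1)\<rfloor> \<le> \<bar>k $ j\<bar> \<and> \<bar>k $ j\<bar> < 2 ^ (s $ j)}"

definition hyperbolic_cross :: "nat \<Rightarrow> (int ^ 'd) set" where
  "hyperbolic_cross n = (\<Union>s \<in> {s. (\<Sum>j\<in>UNIV. s $ j) \<le> n}. dyadic_block s)"

text \<open>Meant for \<open>n \<ge> 1\<close> only, because of the truncated subtraction.\<close>

definition hyperbolic_layer :: "nat \<Rightarrow> (int ^ 'd) set" where
  "hyperbolic_layer n = hyperbolic_cross n - hyperbolic_cross (n - 1)"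

definition trig_poly :: "(int ^ 'd) set \<Rightarrow> (real ^ 'd \<Rightarrow> complex) set" where
  "trig_poly Q =
    {f. \<exists>c :: int ^ 'd \<Rightarrow> complex.
          f = (\<lambda>x. \<Sum>k\<in>Q. c k * exp (\<i> * complex_of_real (\<Sum>j\<in>UNIV. of_int (k $ j) * x $ j)))}"

definition trig_poly_ball :: "(int ^ 'd) set \<Rightarrow> real \<Rightarrow> (real ^ 'd \<Rightarrow> complex) set" where
  "trig_poly_ball Q p = {f \<in> trig_poly Q. Lp_norm p f \<le> 1}"

end

theory Submission imports Defs
begin

text \<open>The layer is contained in the cross \<open>Q\<^sub>n\<close>, so only the cross matters.

  For \<open>p = 2\<close> the width is dual to a Gelfand width: some sign matrix \<open>G\<close> with \<open>m\<close> rows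
  is almost isometric on all averages of \<open>r\<close> of the vectors \<open>a\<^sub>j\<close> that represent
  point evaluations on a fine grid, where \<open>r\<close> is about \<open>m / n\<close>. By Maurey's argument, applied
  simultaneously to \<open>x\<close> and \<open>G x\<close>, a convex combination \<open>x\<close> of the \<open>a\<^sub>j\<close> with \<open>G x = 0\<close> has
  Euclidean norm of order \<open>|a\<^sub>j| / sqrt r\<close>. Dually, the rows of \<open>G\<close> span a subspace approximating
  the \<open>L\<^sub>2\<close> ball uniformly on the grid up to this error.

  For general \<open>p\<close>, write \<open>f = V f\<close> for a de la Vallee Poussin type operator \<open>V\<close> of the hyperbolic
  cross, whose norm on \<open>L\<^sub>\<infinity>\<close> is of order \<open>n ^ (d - 1)\<close>, and truncate \<open>f = g + h\<close> at height \<open>A\<close>. Then \<open>V g\<close>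
  is small in \<open>L\<^sub>\<infinity>\<close>, while \<open>V h\<close> lies in an \<open>L\<^sub>2\<close> ball of radius \<open>A powr (1 - p / 2)\<close>, to which the case \<open>p = 2\<close>
  applies. Optimising \<open>A\<close> gives the bound.\<close>

section \<open>Random sign matrices\<close>

text \<open>The union bound for \<open>G\<close> runs over all sums of \<open>r\<close> of the
  vectors \<open>a\<^sub>j\<close>, at most \<open>card J ^ r\<close> of them, against failure
  probabilities \<open>exp (- (m / 8))\<close>. The logarithm of the grid size is of order
  \<open>n\<close>, and this dictates \<open>r\<close> of order \<open>m / n\<close>. A general
  convex combination \<open>x\<close> lies outside this finite family, and nothing bounds
  \<open>G\<close> on the difference of \<open>x\<close> and an average close to it; hence the
  simultaneous approximation of \<open>G x\<close>. The constraint \<open>G x = 0\<close> is relaxed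
  to a penalty: the inequality passed on to the duality argument is
  \<open>|x| \<le> 8 * R / sqrt r + 2 / sqrt m * |G x|\<close>.

  For \<open>p = 2\<close> the factor \<open>n ^ d\<close> under the square root is
  \<open>n ^ (d - 1)\<close> from the number of frequencies times \<open>n\<close> from the
  logarithm of the grid size.

  For larger \<open>p\<close> the obstacle is that truncation destroys the spectrum:
  \<open>g\<close> and \<open>h\<close> are not polynomials. \<open>V\<close> restores a finite
  spectrum while fixing \<open>f\<close>, and since its symbol lies between 0 and 1 it does not
  increase the Euclidean norm of the coefficients of \<open>h\<close>. The price is a spectrum
  larger than the cross, but still of size at most a constant times
  \<open>2 ^ n * n ^ (d - 1)\<close>.\<close>

text \<open>The left side is the exponential moment of a random sign, the right side that of a
  standard Gaussian. Their quotient decreases on the half-line because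
  \<open>sinh t \<le> t * cosh t\<close> there.\<close>

lemma cosh_le_exp_half_square: "cosh (x::real) \<le> exp (x\<^sup>2 / 2)"
proof -
  have nonneg: "cosh (y::real) \<le> exp (y\<^sup>2 / 2)" if "y \<ge> 0" for y
  proof -
    have sinh: "sinh t \<le> t * cosh t" if "t \<ge> 0" for t :: real
    proof -
      have "0 * cosh 0 - sinh 0 \<le> t * cosh t - sinh t"
      proof (rule DERIV_nonneg_imp_nondecreasing[OF that])
        fix u :: real assume "0 \<le> u"
        then show "\<exists>z. ((\<lambda>t. t * cosh t - sinh t) has_real_derivative z) (at u) \<and> 0 \<le> z"
          by (intro exI[of _ "u * sinh u"]) (auto intro!: derivative_eq_intros)
      qed
      then show ?thesis by simp
    qed
    have "exp (-(y\<^sup>2 / 2)) * cosh y \<le> exp (-(0\<^sup>2 / 2)) * cosh 0"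
    proof (rule DERIV_nonpos_imp_nonincreasing[OF that])
      fix u :: real assume u: "0 \<le> u"
      have "exp (-(u\<^sup>2 / 2)) * (sinh u - u * cosh u) \<le> 0"
        using sinh[OF u] by (simp add: mult_nonneg_nonpos)
      then show "\<exists>z. ((\<lambda>t. exp (-(t\<^sup>2 / 2)) * cosh t) has_real_derivative z) (at u) \<and> z \<le> 0"
        by (intro exI[of _ "exp (-(u\<^sup>2 / 2)) * (sinh u - u * cosh u)"])
           (auto intro!: derivative_eq_intros simp: algebra_simps)
    qed
    then show ?thesis by (simp add: exp_minus field_simps)
  qed
  show ?thesis
  proof (cases "x \<ge> 0")
    case True then show ?thesis using nonneg by blast
  next
    case False then show ?thesis using nonneg[of "-x"] by simp
  qed
qed

abbreviation signs :: "'i set \<Rightarrow> ('i \<Rightarrow> real) set"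
  where "signs I \<equiv> PiE I (\<lambda>_. {-1, 1})"

lemma sum_signs_insert:
  fixes f :: "('i \<Rightarrow> real) \<Rightarrow> real"
  assumes "finite I" "i \<notin> I"
  shows "(\<Sum>\<sigma>\<in>signs (insert i I). f \<sigma>) = (\<Sum>\<sigma>\<in>signs I. f (\<sigma>(i := -1)) + f (\<sigma>(i := 1)))"
proof -
  have "(\<Sum>\<sigma>\<in>signs (insert i I). f \<sigma>) = (\<Sum>z\<in>{-1,1} \<times> signs I. f ((snd z)(i := fst z)))"
    unfolding PiE_insert_eq
    by (subst sum.reindex[OF inj_combinator[OF assms(2)]]) (simp add: case_prod_beta)
  also have "\<dots> = (\<Sum>b\<in>{-1,1}. \<Sum>\<sigma>\<in>signs I. f (\<sigma>(i := b)))"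
    by (subst sum.cartesian_product) (simp add: case_prod_beta)
  finally show ?thesis by (simp add: sum.distrib)
qed

lemma card_signs: "finite I \<Longrightarrow> card (signs I) = 2 ^ card I"
  by (simp add: card_PiE numeral_2_eq_2)

text \<open>Averaging out one sign reproduces the same kind of exponential in \<open>z\<close>, only
  with \<open>t\<close> replaced by \<open>t * (1 + 2 * t * y\<^sup>2)\<close>: the mixed term
  becomes a \<open>cosh\<close>, whose Gaussian bound is again quadratic in \<open>z\<close>. The
  sign of \<open>t\<close> is free, so the step serves both tails.\<close>

lemma exp_square_two_signs:
  fixes t y z :: real
  shows "exp (t * (z - y)\<^sup>2) + exp (t * (z + y)\<^sup>2)
    \<le> 2 * (exp (t * y\<^sup>2) * exp (t * (1 + 2 * t * y\<^sup>2) * z\<^sup>2))"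
proof -
  have "exp (t * (z - y)\<^sup>2) + exp (t * (z + y)\<^sup>2) = 2 * (exp (t * (z\<^sup>2 + y\<^sup>2)) * cosh (2 * t * z * y))"
    by (simp add: cosh_field_def power2_eq_square algebra_simps flip: exp_add)
  also have "\<dots> \<le> 2 * (exp (t * (z\<^sup>2 + y\<^sup>2)) * exp ((2 * t * z * y)\<^sup>2 / 2))"
    by (intro mult_left_mono cosh_le_exp_half_square) auto
  also have "\<dots> = 2 * (exp (t * y\<^sup>2) * exp (t * (1 + 2 * t * y\<^sup>2) * z\<^sup>2))"
    by (simp add: power2_eq_square algebra_simps flip: exp_add)
  finally show ?thesis .
qed

lemma sum_signs_exp_step:
  fixes t :: real
  assumes "finite I" "i \<notin> I"
  shows "(\<Sum>\<sigma>\<in>signs (insert i I). exp (t * (\<Sum>j\<in>insert i I. \<sigma> j * y j)\<^sup>2))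
    \<le> 2 * (exp (t * (y i)\<^sup>2) * (\<Sum>\<sigma>\<in>signs I. exp (t * (1 + 2 * t * (y i)\<^sup>2) * (\<Sum>j\<in>I. \<sigma> j * y j)\<^sup>2)))"
proof -
  have upd: "(\<Sum>j\<in>I. (\<sigma>(i := b)) j * y j) = (\<Sum>j\<in>I. \<sigma> j * y j)" for \<sigma> :: "'a \<Rightarrow> real" and b
    using assms(2) by (intro sum.cong) auto
  have "(\<Sum>\<sigma>\<in>signs (insert i I). exp (t * (\<Sum>j\<in>insert i I. \<sigma> j * y j)\<^sup>2))
     = (\<Sum>\<sigma>\<in>signs I. exp (t * ((\<Sum>j\<in>I. \<sigma> j * y j) - y i)\<^sup>2) + exp (t * ((\<Sum>j\<in>I. \<sigma> j * y j) + y i)\<^sup>2))"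
    using assms by (simp add: sum_signs_insert upd del: fun_upd_apply) (simp add: algebra_simps)
  also have "\<dots> \<le> (\<Sum>\<sigma>\<in>signs I. 2 * (exp (t * (y i)\<^sup>2) * exp (t * (1 + 2 * t * (y i)\<^sup>2) * (\<Sum>j\<in>I. \<sigma> j * y j)\<^sup>2)))"
    by (intro sum_mono exp_square_two_signs)
  finally show ?thesis by (simp add: sum_distrib_left)
qed

text \<open>Peeling off one sign changes the parameter to \<open>s' = s * (1 + 2 * s * a)\<close>,
  so the induction is over all \<open>s\<close>. The threshold 1/4 makes the product term
  \<open>4 * (s * a) * (s * v)\<close> at most \<open>s * a\<close>; this closes the exponent and
  also keeps \<open>s' * v\<close> below the threshold.\<close>

lemma sum_signs_exp_upper:
  fixes s :: real
  assumes "finite I" "0 \<le> s" "s * (\<Sum>i\<in>I. (y i)\<^sup>2) \<le> 1/4"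
  shows "(\<Sum>\<sigma>\<in>signs I. exp (s * (\<Sum>i\<in>I. \<sigma> i * y i)\<^sup>2)) \<le> 2 ^ card I * exp (2 * s * (\<Sum>i\<in>I. (y i)\<^sup>2))"
  using assms
proof (induction I arbitrary: s rule: finite_induct)
  case empty
  then show ?case by simp
next
  case (insert i I)
  define a where "a = (y i)\<^sup>2"
  define v where "v = (\<Sum>i\<in>I. (y i)\<^sup>2)"
  have pos: "a \<ge> 0" "v \<ge> 0" by (auto simp: a_def v_def sum_nonneg)
  have small: "s * (a + v) \<le> 1/4" using insert by (simp add: a_def v_def)
  define s' where "s' = s * (1 + 2 * s * a)"
  have s': "s' \<ge> 0" unfolding s'_def using pos insert.prems by auto
  have sav: "s * a \<ge> 0" "s * v \<ge> 0" using pos insert.prems by auto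
  then have "s * v \<le> 1/4" using small by (simp add: algebra_simps)
  with sav have "(s * a) * (s * v) \<le> (s * a) * (1/4)"
    by (intro mult_left_mono) auto
  moreover have "2 * s' * v = 2 * (s * v) + 4 * ((s * a) * (s * v))"
    by (simp add: s'_def algebra_simps)
  moreover have "2 * s * (a + v) = 2 * (s * a) + 2 * (s * v)"
    by (simp add: algebra_simps)
  ultimately have key: "s * a + 2 * s' * v \<le> 2 * s * (a + v)"
    by linarith
  have "s' * v \<le> s * (a + v)"
  proof -
    have "s * a \<ge> 0" using pos insert.prems by simp
    with key show ?thesis by (simp add: algebra_simps)
  qed
  then have "s' * v \<le> 1/4" using small by simp
  with insert.IH[OF s'] have IH: "(\<Sum>\<sigma>\<in>signs I. exp (s' * (\<Sum>i\<in>I. \<sigma> i * y i)\<^sup>2)) \<le> 2 ^ card I * exp (2 * s' * v)"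
    by (simp add: v_def)
  have "(\<Sum>\<sigma>\<in>signs (insert i I). exp (s * (\<Sum>j\<in>insert i I. \<sigma> j * y j)\<^sup>2))
      \<le> 2 * (exp (s * a) * (\<Sum>\<sigma>\<in>signs I. exp (s' * (\<Sum>i\<in>I. \<sigma> i * y i)\<^sup>2)))"
    using sum_signs_exp_step[OF insert.hyps, of s y] by (simp add: a_def s'_def)
  also have "\<dots> \<le> 2 * (exp (s * a) * (2 ^ card I * exp (2 * s' * v)))"
    using IH by (intro mult_left_mono) auto
  also have "\<dots> = 2 ^ card (insert i I) * exp (s * a + 2 * s' * v)"
    using insert.hyps by (simp add: exp_add)
  also have "\<dots> \<le> 2 ^ card (insert i I) * exp (2 * s * (a + v))"
    using key by (intro mult_left_mono) auto
  finally show ?case using insert.hyps by (simp add: a_def v_def)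
qed

text \<open>For the negative parameter \<open>- s\<close> the recursion lowers \<open>s\<close> to
  \<open>s * (1 - 2 * s * a)\<close>, and the threshold 1/2 keeps this nonnegative. Half of the
  variance is given up in the exponent to absorb the product of \<open>s * a\<close> and
  \<open>s * v\<close>.\<close>

lemma sum_signs_exp_lower:
  fixes s :: real
  assumes "finite I" "0 \<le> s" "s * (\<Sum>i\<in>I. (y i)\<^sup>2) \<le> 1/2"
  shows "(\<Sum>\<sigma>\<in>signs I. exp (- s * (\<Sum>i\<in>I. \<sigma> i * y i)\<^sup>2)) \<le> 2 ^ card I * exp (- s * (\<Sum>i\<in>I. (y i)\<^sup>2) / 2)"
  using assms
proof (induction I arbitrary: s rule: finite_induct)
  case empty
  then show ?case by simp
next
  case (insert i I)
  define a where "a = (y i)\<^sup>2"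
  define v where "v = (\<Sum>i\<in>I. (y i)\<^sup>2)"
  have pos: "a \<ge> 0" "v \<ge> 0" by (auto simp: a_def v_def sum_nonneg)
  have small: "s * (a + v) \<le> 1/2" using insert by (simp add: a_def v_def)
  have sav: "s * a \<ge> 0" "s * v \<ge> 0" using pos insert.prems by auto
  then have small': "s * a \<le> 1/2" "s * v \<le> 1/2" using small by (simp_all add: algebra_simps)
  define s' where "s' = s * (1 - 2 * s * a)"
  have s': "s' \<ge> 0" unfolding s'_def using small' insert.prems by auto
  have "s * (s * a) \<ge> 0" using insert.prems sav by simp
  then have "s' \<le> s" by (simp add: s'_def algebra_simps)
  then have "s' * v \<le> s * v" using pos by (intro mult_right_mono)
  then have s'v: "s' * v \<le> 1/2" using small' by simp
  have "(s * a) * (s * v) \<le> (s * a) * (1/2)"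
    using sav small' by (intro mult_left_mono) auto
  moreover have "s' * v = s * v - 2 * ((s * a) * (s * v))"
    by (simp add: s'_def algebra_simps)
  moreover have "- s * (a + v) / 2 = - (s * a) / 2 - s * v / 2"
    by (simp add: field_simps)
  ultimately have key: "- s * a - s' * v / 2 \<le> - s * (a + v) / 2"
    by linarith
  from insert.IH[OF s'] s'v have IH: "(\<Sum>\<sigma>\<in>signs I. exp (- s' * (\<Sum>i\<in>I. \<sigma> i * y i)\<^sup>2)) \<le> 2 ^ card I * exp (- s' * v / 2)"
    by (simp add: v_def)
  have "(\<Sum>\<sigma>\<in>signs (insert i I). exp (- s * (\<Sum>j\<in>insert i I. \<sigma> j * y j)\<^sup>2))
      \<le> 2 * (exp (- s * a) * (\<Sum>\<sigma>\<in>signs I. exp (- s' * (\<Sum>i\<in>I. \<sigma> i * y i)\<^sup>2)))"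
    using sum_signs_exp_step[OF insert.hyps, of "- s" y] by (simp add: a_def s'_def)
  also have "\<dots> \<le> 2 * (exp (- s * a) * (2 ^ card I * exp (- s' * v / 2)))"
    using IH by (intro mult_left_mono) auto
  also have "\<dots> = 2 ^ card (insert i I) * exp (- s * a - s' * v / 2)"
    using insert.hyps by (simp add: mult_exp_exp)
  also have "\<dots> \<le> 2 ^ card (insert i I) * exp (- s * (a + v) / 2)"
    using key by (intro mult_left_mono) auto
  finally show ?case using insert.hyps by (simp add: a_def v_def)
qed

section \<open>Concentration and the union bound for sign matrices\<close>

text \<open>Chernoff's bound by counting: each matrix in the set contributes at least 1 to the sum
  of \<open>exp (t * q - T)\<close>, with \<open>q\<close> its quadratic form, and over all matrices
  that sum factorises into \<open>m\<close> equal row sums. A negative \<open>t\<close> gives the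
  lower tail.\<close>

lemma card_sign_matrices_tail:
  fixes t T :: real
  assumes "finite I"
  shows "real (card {G \<in> PiE {..<m} (\<lambda>_. signs I). T \<le> t * (\<Sum>l<m. (\<Sum>i\<in>I. G l i * y i)\<^sup>2)})
    \<le> exp (- T) * (\<Sum>\<sigma>\<in>signs I. exp (t * (\<Sum>i\<in>I. \<sigma> i * y i)\<^sup>2)) ^ m"
    (is "real (card ?B) \<le> _")
proof -
  let ?\<Omega> = "PiE {..<m} (\<lambda>_. signs I)"
  have fin: "finite ?\<Omega>" using assms by (intro finite_PiE) auto
  have "real (card ?B) = (\<Sum>G\<in>?B. 1)" by simp
  also have "\<dots> \<le> (\<Sum>G\<in>?B. exp (t * (\<Sum>l<m. (\<Sum>i\<in>I. G l i * y i)\<^sup>2) - T))"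
    by (intro sum_mono) auto
  also have "\<dots> \<le> (\<Sum>G\<in>?\<Omega>. exp (t * (\<Sum>l<m. (\<Sum>i\<in>I. G l i * y i)\<^sup>2) - T))"
    using fin by (intro sum_mono2) auto
  also have "\<dots> = (\<Sum>G\<in>?\<Omega>. exp (- T) * (\<Prod>l<m. exp (t * (\<Sum>i\<in>I. G l i * y i)\<^sup>2)))"
    by (intro sum.cong) (simp_all add: sum_distrib_left mult_exp_exp flip: exp_sum)
  also have "\<dots> = exp (- T) * (\<Prod>l<m. \<Sum>\<sigma>\<in>signs I. exp (t * (\<Sum>i\<in>I. \<sigma> i * y i)\<^sup>2))"
    using assms by (subst prod_sum_PiE) (auto simp: sum_distrib_left intro: finite_PiE)
  finally show ?thesis by simp
qed

text \<open>Union bound: the matrices violating one of the finitely many requirements are fewer than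
  all matrices. The lower estimate is meant for the large family of sums, the upper one only for the
  single vectors, so the two families are kept apart.\<close>

lemma sign_matrix_exists:
  fixes Y A :: "('i \<Rightarrow> real) set"
  assumes fin: "finite I" "finite Y" "finite A"
    and count: "real (card Y) * exp (- (m / 8)) + real (card A) * exp (- (m / 2)) < 1"
  obtains G :: "nat \<Rightarrow> 'i \<Rightarrow> real"
  where "\<And>y. y \<in> Y \<Longrightarrow> m / 4 * (\<Sum>i\<in>I. (y i)\<^sup>2) \<le> (\<Sum>l<m. (\<Sum>i\<in>I. G l i * y i)\<^sup>2)"
    and "\<And>a. a \<in> A \<Longrightarrow> (\<Sum>l<m. (\<Sum>i\<in>I. G l i * a i)\<^sup>2) \<le> 4 * m * (\<Sum>i\<in>I. (a i)\<^sup>2)"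
proof -
  define \<Omega> where "\<Omega> = PiE {..<m} (\<lambda>_. signs I)"
  define W :: real where "W = (2 ^ card I) ^ m"
  define q where "q = (\<lambda>(G::nat \<Rightarrow> 'i \<Rightarrow> real) y. \<Sum>l<m. (\<Sum>i\<in>I. G l i * y i)\<^sup>2)"
  define nn where "nn = (\<lambda>y::'i \<Rightarrow> real. \<Sum>i\<in>I. (y i)\<^sup>2)"
  have fin\<Omega>: "finite \<Omega>" unfolding \<Omega>_def using fin by (intro finite_PiE) auto
  have card\<Omega>: "real (card \<Omega>) = W"
    using fin by (simp add: \<Omega>_def W_def card_PiE card_signs)
  have W: "W > 0" by (simp add: W_def)
  have q: "q G y \<ge> 0" for G y by (simp add: q_def sum_nonneg)
  have nn: "nn y \<ge> 0" for y by (simp add: nn_def sum_nonneg)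
  define bad1 where "bad1 = (\<lambda>y. {G \<in> \<Omega>. q G y < m / 4 * nn y})"
  define bad2 where "bad2 = (\<lambda>a. {G \<in> \<Omega>. 4 * m * nn a < q G a})"
  have bad1: "real (card (bad1 y)) \<le> W * exp (- (m / 8))" for y
  proof (cases "nn y = 0")
    case True
    then have "bad1 y = {}" using q by (auto simp: bad1_def not_less)
    then show ?thesis using W by simp
  next
    case False
    then have pos: "nn y > 0" using nn[of y] by linarith
    \<comment> \<open>This is the largest parameter that \<open>sum_signs_exp_lower\<close> admits.
      It yields \<open>exp (- 1/4)\<close> per row against the loss \<open>exp (m / 8)\<close> from
      the threshold \<open>m / 4\<close>.\<close>
    let ?s = "1 / (2 * nn y)"
    have "bad1 y \<subseteq> {G \<in> \<Omega>. - (m / 8) \<le> - ?s * q G y}"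
      using pos by (auto simp: bad1_def field_simps)
    then have "real (card (bad1 y)) \<le> real (card {G \<in> \<Omega>. - (m / 8) \<le> - ?s * q G y})"
      using fin\<Omega> by (auto intro!: card_mono)
    also have "\<dots> \<le> exp (m / 8) * (\<Sum>\<sigma>\<in>signs I. exp (- ?s * (\<Sum>i\<in>I. \<sigma> i * y i)\<^sup>2)) ^ m"
      using card_sign_matrices_tail[OF fin(1), of m "- (m / 8)" "- ?s" y] by (simp add: \<Omega>_def q_def)
    also have "\<dots> \<le> exp (m / 8) * (2 ^ card I * exp (- ?s * nn y / 2)) ^ m"
      using sum_signs_exp_lower[OF fin(1), of ?s y] pos
      by (intro mult_left_mono power_mono) (auto simp: nn_def sum_nonneg)
    also have "\<dots> = exp (m / 8) * (2 ^ card I * exp (- (1/4))) ^ m"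
      using pos by simp
    also have "\<dots> = W * (exp (m / 8) * exp (- (m / 4)))"
      by (simp add: W_def power_mult_distrib flip: exp_of_nat_mult)
    also have "exp (m / 8) * exp (- (m / 4)) = exp (- (m / 8))"
      by (simp add: mult_exp_exp)
    finally show ?thesis .
  qed
  have bad2: "real (card (bad2 a)) \<le> W * exp (- (m / 2))" for a
  proof (cases "nn a = 0")
    case True
    then have "\<forall>i\<in>I. a i = 0" using fin by (simp add: nn_def sum_nonneg_eq_0_iff)
    then have "bad2 a = {}" using True by (auto simp: bad2_def q_def)
    then show ?thesis using W by simp
  next
    case False
    then have pos: "nn a > 0" using nn[of a] by linarith
    \<comment> \<open>Again the extreme admissible parameter, now for
      \<open>sum_signs_exp_upper\<close>: each row costs \<open>exp (1/2)\<close>, and the threshold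
      \<open>4 * m\<close> gains \<open>exp (- m)\<close>.\<close>
    let ?s = "1 / (4 * nn a)"
    have "bad2 a \<subseteq> {G \<in> \<Omega>. m \<le> ?s * q G a}"
      using pos by (auto simp: bad2_def field_simps)
    then have "real (card (bad2 a)) \<le> real (card {G \<in> \<Omega>. m \<le> ?s * q G a})"
      using fin\<Omega> by (auto intro!: card_mono)
    also have "\<dots> \<le> exp (- real m) * (\<Sum>\<sigma>\<in>signs I. exp (?s * (\<Sum>i\<in>I. \<sigma> i * a i)\<^sup>2)) ^ m"
      using card_sign_matrices_tail[OF fin(1), of m m ?s a] by (simp add: \<Omega>_def q_def)
    also have "\<dots> \<le> exp (- real m) * (2 ^ card I * exp (2 * ?s * nn a)) ^ m"
      using sum_signs_exp_upper[OF fin(1), of ?s a] pos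
      by (intro mult_left_mono power_mono) (auto simp: nn_def sum_nonneg)
    also have "\<dots> = exp (- real m) * (2 ^ card I * exp (1/2)) ^ m"
      using pos by simp
    also have "\<dots> = W * (exp (- real m) * exp (m / 2))"
      by (simp add: W_def power_mult_distrib flip: exp_of_nat_mult)
    also have "exp (- real m) * exp (m / 2) = exp (- (m / 2))"
      by (simp add: mult_exp_exp)
    finally show ?thesis .
  qed
  have "real (card ((\<Union>y\<in>Y. bad1 y) \<union> (\<Union>a\<in>A. bad2 a)))
      \<le> real (card (\<Union>y\<in>Y. bad1 y)) + real (card (\<Union>a\<in>A. bad2 a))"
    using card_Un_le by (metis of_nat_add of_nat_le_iff)
  also have "\<dots> \<le> real (\<Sum>y\<in>Y. card (bad1 y)) + real (\<Sum>a\<in>A. card (bad2 a))"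
    using fin by (intro add_mono of_nat_mono card_UN_le)
  also have "\<dots> \<le> (\<Sum>y\<in>Y. W * exp (- (m / 8))) + (\<Sum>a\<in>A. W * exp (- (m / 2)))"
    unfolding of_nat_sum by (intro add_mono sum_mono bad1 bad2)
  also have "\<dots> = W * (real (card Y) * exp (- (m / 8)) + real (card A) * exp (- (m / 2)))"
    by (simp add: algebra_simps)
  also have "\<dots> < W * 1"
    using count W by (intro mult_strict_left_mono)
  finally have lt: "real (card ((\<Union>y\<in>Y. bad1 y) \<union> (\<Union>a\<in>A. bad2 a))) < real (card \<Omega>)"
    by (simp add: card\<Omega>)
  have "\<not> \<Omega> \<subseteq> (\<Union>y\<in>Y. bad1 y) \<union> (\<Union>a\<in>A. bad2 a)"
  proof
    assume "\<Omega> \<subseteq> (\<Union>y\<in>Y. bad1 y) \<union> (\<Union>a\<in>A. bad2 a)"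
    moreover have "(\<Union>y\<in>Y. bad1 y) \<union> (\<Union>a\<in>A. bad2 a) \<subseteq> \<Omega>" by (auto simp: bad1_def bad2_def)
    ultimately have "(\<Union>y\<in>Y. bad1 y) \<union> (\<Union>a\<in>A. bad2 a) = \<Omega>" by (rule subset_antisym[rotated])
    then show False using lt by simp
  qed
  then obtain G where "G \<in> \<Omega>" "\<forall>y\<in>Y. G \<notin> bad1 y" "\<forall>a\<in>A. G \<notin> bad2 a" by blast
  then show thesis
    by (intro that[of G]) (auto simp: bad1_def bad2_def q_def nn_def not_less)
qed

section \<open>Maurey's empirical method\<close>

text \<open>Some choice of the next term does not increase the squared error by more than the average
  over the weights \<open>p\<close>, because the cross term averages to zero.\<close>

lemma maurey_greedy:
  fixes p :: "'j \<Rightarrow> real" and b :: "'j \<Rightarrow> 'l \<Rightarrow> real"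
  assumes fin: "finite J" "finite L" and p: "\<And>j. j \<in> J \<Longrightarrow> 0 \<le> p j" "sum p J = 1"
  defines "x \<equiv> \<lambda>l. \<Sum>j\<in>J. p j * b j l"
  shows "\<exists>z :: nat \<Rightarrow> 'j. (\<forall>t. z t \<in> J) \<and>
    (\<Sum>l\<in>L. (\<Sum>t<r. b (z t) l - x l)\<^sup>2) \<le> r * (\<Sum>j\<in>J. p j * (\<Sum>l\<in>L. (b j l)\<^sup>2))"
proof (induction r)
  case 0
  have "J \<noteq> {}" using p(2) by auto
  then show ?case by (auto intro!: exI[of _ "\<lambda>_. SOME j. j \<in> J"] some_in_eq[THEN iffD2])
next
  case (Suc r)
  then obtain z where z: "\<And>t. z t \<in> J"
    and IH: "(\<Sum>l\<in>L. (\<Sum>t<r. b (z t) l - x l)\<^sup>2) \<le> r * (\<Sum>j\<in>J. p j * (\<Sum>l\<in>L. (b j l)\<^sup>2))"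
    by blast
  define S where "S = (\<lambda>l. \<Sum>t<r. b (z t) l - x l)"
  define V where "V = (\<Sum>j\<in>J. p j * (\<Sum>l\<in>L. (b j l)\<^sup>2))"
  define f where "f = (\<lambda>j. \<Sum>l\<in>L. (S l + (b j l - x l))\<^sup>2)"
  have pw: "(\<Sum>j\<in>J. p j * (S l + (b j l - x l))\<^sup>2) \<le> (S l)\<^sup>2 + (\<Sum>j\<in>J. p j * (b j l)\<^sup>2)" for l
  proof -
    have "(\<Sum>j\<in>J. p j * (S l + (b j l - x l))\<^sup>2)
       = (\<Sum>j\<in>J. p j * (b j l)\<^sup>2 + (2 * (S l - x l)) * (p j * b j l) + (S l - x l)\<^sup>2 * p j)"
      by (intro sum.cong) (auto simp: power2_eq_square algebra_simps)
    also have "\<dots> = (\<Sum>j\<in>J. p j * (b j l)\<^sup>2) + 2 * (S l - x l) * x l + (S l - x l)\<^sup>2"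
      by (simp add: sum.distrib p(2) x_def flip: sum_distrib_left)
    also have "\<dots> = (\<Sum>j\<in>J. p j * (b j l)\<^sup>2) + (S l)\<^sup>2 - (x l)\<^sup>2"
      by (simp add: power2_eq_square algebra_simps)
    finally show ?thesis by simp
  qed
  have "(\<Sum>j\<in>J. p j * f j) = (\<Sum>l\<in>L. \<Sum>j\<in>J. p j * (S l + (b j l - x l))\<^sup>2)"
    by (simp add: f_def sum_distrib_left sum.swap[of _ J])
  also have "\<dots> \<le> (\<Sum>l\<in>L. (S l)\<^sup>2 + (\<Sum>j\<in>J. p j * (b j l)\<^sup>2))" by (intro sum_mono pw)
  also have "\<dots> = (\<Sum>l\<in>L. (S l)\<^sup>2) + V"
    by (simp add: V_def sum.distrib sum_distrib_left sum.swap[of _ J])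
  also have "\<dots> \<le> r * V + V" using IH by (simp add: S_def V_def)
  finally have avg: "(\<Sum>j\<in>J. p j * f j) \<le> Suc r * V" by (simp add: algebra_simps)
  have "\<exists>j\<in>J. f j \<le> Suc r * V"
  proof (rule ccontr)
    assume "\<not> ?thesis"
    then have less: "Suc r * V < f j" if "j \<in> J" for j using that by auto
    have "(\<Sum>j\<in>J. p j * (f j - Suc r * V)) \<le> 0"
      using avg by (simp add: right_diff_distrib sum_subtractf p(2) flip: sum_distrib_right)
    moreover have nonneg: "p j * (f j - Suc r * V) \<ge> 0" if "j \<in> J" for j
      using that p less by (simp add: less_imp_le)
    ultimately have "(\<Sum>j\<in>J. p j * (f j - Suc r * V)) = 0"
      by (meson antisym sum_nonneg)
    then have "\<forall>j\<in>J. p j * (f j - Suc r * V) = 0"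
      using nonneg fin by (simp add: sum_nonneg_eq_0_iff)
    then have "\<forall>j\<in>J. p j = 0" using less by fastforce
    then show False using p(2) by simp
  qed
  then obtain j where j: "j \<in> J" "f j \<le> Suc r * V" by blast
  have "(\<Sum>t<Suc r. b ((z(r := j)) t) l - x l) = S l + (b j l - x l)" for l
    by (simp add: S_def)
  then show ?case using j z
    by (intro exI[of _ "z(r := j)"]) (simp add: f_def V_def del: sum.lessThan_Suc)
qed

text \<open>Maurey's method yields a sum \<open>S\<close> of \<open>r\<close> vectors with both
  \<open>S - r * x\<close> and \<open>G S - r * G x\<close> small. The lower estimate is available
  for \<open>S\<close>, so \<open>|S|\<close> is bounded by \<open>|G S|\<close>, and two triangle
  inequalities transfer this to \<open>x\<close>. The term with \<open>G x\<close> is kept as a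
  penalty for the duality argument.\<close>

lemma convex_combination_norm_le:
  fixes a :: "'j \<Rightarrow> 'i \<Rightarrow> real" and G :: "nat \<Rightarrow> 'i \<Rightarrow> real" and r m :: nat
  assumes fin: "finite I" "finite J" and r: "0 < r" and m: "0 < m" and R: "0 \<le> R"
    and a: "\<And>j. j \<in> J \<Longrightarrow> (\<Sum>i\<in>I. (a j i)\<^sup>2) \<le> R\<^sup>2"
    and lower: "\<And>z. (\<And>t. z t \<in> J) \<Longrightarrow>
      m / 4 * (\<Sum>i\<in>I. (\<Sum>t<r. a (z t) i)\<^sup>2) \<le> (\<Sum>l<m. (\<Sum>i\<in>I. G l i * (\<Sum>t<r. a (z t) i))\<^sup>2)"
    and upper: "\<And>j. j \<in> J \<Longrightarrow> (\<Sum>l<m. (\<Sum>i\<in>I. G l i * a j i)\<^sup>2) \<le> 4 * m * (\<Sum>i\<in>I. (a j i)\<^sup>2)"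
    and p: "\<And>j. j \<in> J \<Longrightarrow> 0 \<le> p j" "sum p J = 1"
  defines "x \<equiv> \<lambda>i. \<Sum>j\<in>J. p j * a j i"
  shows "L2_set x I \<le> 8 * R / sqrt r + 2 / sqrt m * L2_set (\<lambda>l. \<Sum>i\<in>I. G l i * x i) {..<m}"
proof -
  define g where "g = (\<lambda>j l. \<Sum>i\<in>I. G l i * a j i)"
  \<comment> \<open>Vector and image are stacked, so that a single run of
    \<open>maurey_greedy\<close> handles both. The factor \<open>1 / (2 * sqrt m)\<close> matches
    the constant in \<open>upper\<close> and gives both halves norm at most
    \<open>R\<close>.\<close>
  define b where "b = (\<lambda>j. case_sum (a j) (\<lambda>l. g j l / (2 * sqrt m)))"
  define gx where "gx = (\<lambda>l. \<Sum>i\<in>I. G l i * x i)"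
  have gx: "gx l = (\<Sum>j\<in>J. p j * g j l)" for l
    by (simp add: gx_def x_def g_def sum_distrib_left mult_ac sum.swap[of _ J])
  have sum_b: "(\<Sum>l\<in>I <+> {..<m}. f l) = (\<Sum>i\<in>I. f (Inl i)) + (\<Sum>l<m. f (Inr l))" for f :: "_ \<Rightarrow> real"
    using fin by (simp add: sum.Plus)
  have bx: "(\<Sum>j\<in>J. p j * b j (Inl i)) = x i" "(\<Sum>j\<in>J. p j * b j (Inr l)) = gx l / (2 * sqrt m)" for i l
    by (simp_all add: b_def x_def gx sum_divide_distrib)
  obtain z where z: "\<And>t. z t \<in> J" and
    "(\<Sum>l\<in>I <+> {..<m}. (\<Sum>t<r. b (z t) l - (\<Sum>j\<in>J. p j * b j l))\<^sup>2)
      \<le> r * (\<Sum>j\<in>J. p j * (\<Sum>l\<in>I <+> {..<m}. (b j l)\<^sup>2))"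
    using maurey_greedy[of J "I <+> {..<m}" p b r] fin p by auto
  moreover have "(\<Sum>j\<in>J. p j * (\<Sum>l\<in>I <+> {..<m}. (b j l)\<^sup>2)) \<le> (\<Sum>j\<in>J. p j * (2 * R\<^sup>2))"
  proof (intro sum_mono mult_left_mono p)
    fix j assume j: "j \<in> J"
    have "(\<Sum>l<m. (g j l / (2 * sqrt m))\<^sup>2) = (\<Sum>l<m. (g j l)\<^sup>2) / (4 * m)"
      by (simp add: power_divide power_mult_distrib sum_divide_distrib)
    also have "\<dots> \<le> R\<^sup>2"
      using upper[OF j] a[OF j] m by (simp add: g_def field_simps) (smt (verit) mult_left_mono of_nat_0_le_iff)
    finally show "(\<Sum>l\<in>I <+> {..<m}. (b j l)\<^sup>2) \<le> 2 * R\<^sup>2"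
      using a[OF j] by (simp add: sum_b b_def)
  qed auto
  then have "r * (\<Sum>j\<in>J. p j * (\<Sum>l\<in>I <+> {..<m}. (b j l)\<^sup>2)) \<le> r * (2 * R\<^sup>2)"
    by (intro mult_left_mono) (auto simp: p simp flip: sum_distrib_right)
  ultimately have joint: "(\<Sum>i\<in>I. (\<Sum>t<r. a (z t) i - x i)\<^sup>2)
      + (\<Sum>l<m. (\<Sum>t<r. (g (z t) l - gx l) / (2 * sqrt m))\<^sup>2) \<le> 2 * r * R\<^sup>2"
    by (simp add: sum_b bx) (simp add: b_def diff_divide_distrib)
  define S where "S = (\<lambda>i. \<Sum>t<r. a (z t) i)"
  define GS where "GS = (\<lambda>l. \<Sum>i\<in>I. G l i * S i)"
  have GS: "GS l = (\<Sum>t<r. g (z t) l)" for l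
    by (simp add: GS_def S_def g_def sum_distrib_left sum.swap[of _ I])
  have nn: "(\<Sum>i\<in>I. (S i - r * x i)\<^sup>2) \<ge> 0" "(\<Sum>l<m. (GS l - r * gx l)\<^sup>2) \<ge> 0" by (auto intro: sum_nonneg)
  have "(\<Sum>l<m. (\<Sum>t<r. (g (z t) l - gx l) / (2 * sqrt m))\<^sup>2) = (\<Sum>l<m. (GS l - r * gx l)\<^sup>2) / (4 * m)"
    by (simp add: GS sum_subtractf power_divide power_mult_distrib flip: sum_divide_distrib)
  with joint have joint': "(\<Sum>i\<in>I. (S i - r * x i)\<^sup>2) + (\<Sum>l<m. (GS l - r * gx l)\<^sup>2) / (4 * m) \<le> 2 * r * R\<^sup>2"
    by (simp add: S_def sum_subtractf)
  have "(\<Sum>l<m. (GS l - r * gx l)\<^sup>2) / (4 * m) \<ge> 0" using nn by simp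
  then have "(\<Sum>i\<in>I. (S i - r * x i)\<^sup>2) \<le> (sqrt 2 * sqrt r * R)\<^sup>2"
    using joint' by (simp add: power_mult_distrib)
  then have dS: "L2_set (\<lambda>i. S i - r * x i) I \<le> sqrt 2 * sqrt r * R"
    unfolding L2_set_def using R by (simp add: real_le_lsqrt sum_nonneg)
  have "(\<Sum>l<m. (GS l - r * gx l)\<^sup>2) / (4 * m) \<le> 2 * r * R\<^sup>2" using joint' nn by linarith
  then have "(\<Sum>l<m. (GS l - r * gx l)\<^sup>2) \<le> (2 * r * R\<^sup>2) * (4 * m)"
    using m by (simp add: divide_le_eq)
  also have "\<dots> = (sqrt 2 * sqrt r * R * (2 * sqrt m))\<^sup>2"
    by (simp add: power_mult_distrib)
  finally have dGS: "L2_set (\<lambda>l. GS l - r * gx l) {..<m} \<le> sqrt 2 * sqrt r * R * (2 * sqrt m)"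
    unfolding L2_set_def using R by (simp add: real_le_lsqrt sum_nonneg)
  have "(\<Sum>i\<in>I. (S i)\<^sup>2) * (m / 4) \<le> (\<Sum>l<m. (GS l)\<^sup>2)"
    using lower[OF z] by (simp add: S_def GS_def mult_ac)
  then have "sqrt ((\<Sum>i\<in>I. (S i)\<^sup>2) * (m / 4)) \<le> L2_set GS {..<m}"
    unfolding L2_set_def using real_sqrt_le_iff by blast
  then have "L2_set S I * (sqrt m / 2) \<le> L2_set GS {..<m}"
    by (simp add: L2_set_def real_sqrt_mult real_sqrt_divide)
  then have S: "L2_set S I \<le> 2 / sqrt m * L2_set GS {..<m}" using m by (simp add: field_simps)
  have "L2_set GS {..<m} = L2_set (\<lambda>l. (GS l - r * gx l) + r * gx l) {..<m}" by simp
  also have "\<dots> \<le> L2_set (\<lambda>l. GS l - r * gx l) {..<m} + L2_set (\<lambda>l. r * gx l) {..<m}"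
    by (rule L2_set_triangle_ineq)
  also have "L2_set (\<lambda>l. r * gx l) {..<m} = r * L2_set gx {..<m}" by (simp add: L2_set_right_distrib)
  finally have GSle: "L2_set GS {..<m} \<le> sqrt 2 * sqrt r * R * (2 * sqrt m) + r * L2_set gx {..<m}"
    using dGS by simp
  have "r * L2_set x I = L2_set (\<lambda>i. S i + - (S i - r * x i)) I" by (simp add: L2_set_right_distrib)
  also have "\<dots> \<le> L2_set S I + L2_set (\<lambda>i. - (S i - r * x i)) I" by (rule L2_set_triangle_ineq)
  also have "L2_set (\<lambda>i. - (S i - r * x i)) I = L2_set (\<lambda>i. S i - r * x i) I"
    by (simp only: L2_set_def power2_minus)
  also have "L2_set S I + L2_set (\<lambda>i. S i - r * x i) I
      \<le> 2 / sqrt m * (sqrt 2 * sqrt r * R * (2 * sqrt m) + r * L2_set gx {..<m}) + sqrt 2 * sqrt r * R"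
    using GSle by (intro add_mono order_trans[OF S] dS mult_left_mono) auto
  \<comment> \<open>The share 4 of the 5 comes from the image part, the share 1 from the vector
    part; \<open>5 * sqrt 2\<close> is then rounded up to 8.\<close>
  also have "\<dots> = 5 * sqrt 2 * sqrt r * R + r * (2 / sqrt m * L2_set gx {..<m})"
    using m by (simp add: field_simps)
  also have "5 * sqrt 2 * sqrt r * R \<le> 8 * sqrt r * R"
  proof -
    have "sqrt 2 \<le> 8 / 5" by (rule real_le_lsqrt) (auto simp: power2_eq_square)
    then show ?thesis using R r by (intro mult_right_mono) auto
  qed
  also have "8 * sqrt r * R = r * (8 * R / sqrt r)" using r by (simp add: field_simps flip: real_sqrt_mult)
  finally have "r * L2_set x I \<le> r * (8 * R / sqrt r + 2 / sqrt m * L2_set gx {..<m})"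
    by (simp add: distrib_left)
  then show ?thesis using r by (simp add: gx_def)
qed

section \<open>Duality and widths of Euclidean balls\<close>

text \<open>Minimax without a separation theorem: at a near-minimiser \<open>p\<close> of \<open>K |\<beta>\<^sub>p|\<^sup>2 - \<alpha>\<^sub>p\<close> over the
  simplex, the variational inequality in the direction of each vertex reads off the witness
  \<open>w = 2 K \<beta>\<^sub>p\<close>.\<close>

lemma quadratic_duality:
  fixes \<alpha> :: "'j \<Rightarrow> real" and \<beta> :: "'j \<Rightarrow> 'l \<Rightarrow> real"
  assumes fin: "finite J" "J \<noteq> {}" "finite L" and \<delta>: "0 < \<delta>"
    and bound: "\<And>p. (\<And>j. j \<in> J \<Longrightarrow> 0 \<le> p j) \<Longrightarrow> sum p J = 1 \<Longrightarrow>
      (\<Sum>j\<in>J. p j * \<alpha> j) \<le> E + D * L2_set (\<lambda>l. \<Sum>j\<in>J. p j * \<beta> j l) L"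
  shows "\<exists>w. \<forall>j\<in>J. \<alpha> j - (\<Sum>l\<in>L. w l * \<beta> j l) \<le> E + \<delta>"
proof -
  define P where "P = {p. (\<forall>j\<in>J. 0 \<le> p j) \<and> sum p J = (1::real)}"
  \<comment> \<open>Chosen for Young's inequality: \<open>D * b \<le> \<delta> / 2 + D\<^sup>2 *
    b\<^sup>2 / (2 * \<delta>) \<le> \<delta> / 2 + 2 * K * b\<^sup>2\<close> with \<open>b\<close>
    the norm of \<open>B p\<close>. The summand 1 keeps \<open>K\<close> positive when
    \<open>D = 0\<close>.\<close>
  define K where "K = D\<^sup>2 / (4 * \<delta>) + 1"
  have K: "K > 0" using \<delta> by (simp add: K_def add_nonneg_pos)
  define A where "A = (\<lambda>p. \<Sum>j\<in>J. p j * \<alpha> j)"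
  define B where "B = (\<lambda>p l. \<Sum>j\<in>J. p j * \<beta> j l)"
  define F where "F = (\<lambda>p. K * (\<Sum>l\<in>L. (B p l)\<^sup>2) - A p)"
  define T where "T = (\<lambda>l. \<Sum>j\<in>J. \<bar>\<beta> j l\<bar>)"
  define H where "H = K * (\<Sum>l\<in>L. (2 * T l)\<^sup>2) + 1"
  have H: "H \<ge> 1" using K by (simp add: H_def sum_nonneg)
  have p1: "p j \<le> 1" if "p \<in> P" "j \<in> J" for p j
    using that fin member_le_sum[of j J p] by (auto simp: P_def)
  have F_ge: "- (\<Sum>j\<in>J. \<bar>\<alpha> j\<bar>) \<le> F p" if "p \<in> P" for p
  proof -
    have "A p \<le> (\<Sum>j\<in>J. \<bar>\<alpha> j\<bar>)"
      unfolding A_def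
    proof (intro sum_mono)
      fix j assume j: "j \<in> J"
      have "p j * \<alpha> j \<le> p j * \<bar>\<alpha> j\<bar>" using that j by (intro mult_left_mono) (auto simp: P_def)
      also have "\<dots> \<le> 1 * \<bar>\<alpha> j\<bar>" using p1[OF that j] by (intro mult_right_mono) auto
      finally show "p j * \<alpha> j \<le> \<bar>\<alpha> j\<bar>" by simp
    qed
    moreover have "0 \<le> K * (\<Sum>l\<in>L. (B p l)\<^sup>2)" using K by (simp add: sum_nonneg)
    ultimately show ?thesis by (simp add: F_def)
  qed
  have bdd: "bdd_below (F ` P)" using F_ge by (auto intro!: bdd_belowI2)
  obtain j0 where j0: "j0 \<in> J" using fin by blast
  have "(\<lambda>j. if j = j0 then 1 else 0) \<in> P" using fin j0 by (auto simp: P_def)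
  then have ne: "F ` P \<noteq> {}" by blast
  \<comment> \<open>The step towards a vertex is short enough that the second-order term, at most
    \<open>t * H\<close> after division by \<open>t\<close>, costs only \<open>\<delta> / 4\<close>.
    The near-minimality slack below carries the factor \<open>t\<close> because it is also divided
    by \<open>t\<close>.\<close>
  define t where "t = min 1 (\<delta> / (4 * H))"
  have t: "0 < t" "t \<le> 1" "t * H \<le> \<delta> / 4"
  proof -
    have "t * H \<le> \<delta> / (4 * H) * H" using H by (intro mult_right_mono) (auto simp: t_def)
    then show "0 < t" "t \<le> 1" "t * H \<le> \<delta> / 4" using H \<delta> by (auto simp: t_def)
  qed
  have "\<exists>v\<in>F ` P. v < Inf (F ` P) + t * \<delta> / 4"
    using t \<delta> ne bdd by (subst cInf_less_iff[symmetric]) auto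
  then obtain p where p: "p \<in> P" and near: "F p < Inf (F ` P) + t * \<delta> / 4" by blast
  have Bp: "\<bar>B p l\<bar> \<le> T l" for l
    unfolding B_def T_def
  proof (intro sum_abs[THEN order_trans] sum_mono)
    fix j assume j: "j \<in> J"
    have "\<bar>p j\<bar> \<le> 1" using p1[OF p j] p j by (auto simp: P_def)
    then show "\<bar>p j * \<beta> j l\<bar> \<le> \<bar>\<beta> j l\<bar>" by (simp add: abs_mult mult_left_le_one_le)
  qed
  define w where "w = (\<lambda>l. 2 * K * B p l)"
  have "\<alpha> j - (\<Sum>l\<in>L. w l * \<beta> j l) \<le> E + \<delta>" if j: "j \<in> J" for j
  proof -
    define q where "q = (\<lambda>i. (1 - t) * p i + t * (if i = j then 1 else 0))"
    have q: "q \<in> P"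
      using p t j fin by (auto simp: P_def q_def sum.distrib simp flip: sum_distrib_left)
    have lin: "(\<Sum>i\<in>J. q i * f i) = (\<Sum>i\<in>J. p i * f i) + t * (f j - (\<Sum>i\<in>J. p i * f i))" for f :: "'j \<Rightarrow> real"
    proof -
      have "(\<Sum>i\<in>J. q i * f i) = (\<Sum>i\<in>J. (1 - t) * (p i * f i) + t * (if i = j then f i else 0))"
        by (intro sum.cong) (auto simp: q_def algebra_simps)
      also have "\<dots> = (1 - t) * (\<Sum>i\<in>J. p i * f i) + t * f j"
        using fin j by (simp add: sum.distrib flip: sum_distrib_left)
      finally show ?thesis by (simp add: algebra_simps)
    qed
    have Bq: "B q l = B p l + t * (\<beta> j l - B p l)" for l unfolding B_def by (rule lin)
    have Aq: "A q = A p + t * (\<alpha> j - A p)" unfolding A_def by (rule lin)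
    define X where "X = (\<Sum>l\<in>L. (B p l)\<^sup>2)"
    define Y where "Y = (\<Sum>l\<in>L. B p l * \<beta> j l)"
    define Z where "Z = (\<Sum>l\<in>L. (\<beta> j l - B p l)\<^sup>2)"
    have "(\<Sum>l\<in>L. (B q l)\<^sup>2) = (\<Sum>l\<in>L. (B p l)\<^sup>2 + 2 * t * (B p l * \<beta> j l) - 2 * t * (B p l)\<^sup>2 + t\<^sup>2 * (\<beta> j l - B p l)\<^sup>2)"
      unfolding Bq by (intro sum.cong refl) (simp add: power2_eq_square algebra_simps)
    also have "\<dots> = X + 2 * t * Y - 2 * t * X + t\<^sup>2 * Z"
      by (simp add: X_def Y_def Z_def sum.distrib sum_subtractf sum_distrib_left)
    finally have "F q = K * (X + 2 * t * Y - 2 * t * X + t\<^sup>2 * Z) - (A p + t * (\<alpha> j - A p))"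
      by (simp add: F_def Aq)
    moreover have "F p = K * X - A p" by (simp add: F_def X_def)
    ultimately have Fq: "F q = F p + t * (2 * K * Y - 2 * K * X - (\<alpha> j - A p) + t * (K * Z))"
      by (simp add: power2_eq_square algebra_simps)
    have "Inf (F ` P) \<le> F q" using bdd q by (intro cInf_lower) auto
    with near have "0 \<le> t * (2 * K * Y - 2 * K * X - (\<alpha> j - A p) + t * (K * Z) + \<delta> / 4)"
      unfolding Fq by (simp add: algebra_simps)
    then have "0 \<le> 2 * K * Y - 2 * K * X - (\<alpha> j - A p) + t * (K * Z) + \<delta> / 4"
      using t by (simp add: zero_le_mult_iff)
    moreover have "t * (K * Z) \<le> \<delta> / 4"
    proof -
      have "Z \<le> (\<Sum>l\<in>L. (2 * T l)\<^sup>2)"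
        unfolding Z_def
      proof (intro sum_mono)
        fix l assume "l \<in> L"
        have "\<bar>\<beta> j l\<bar> \<le> T l" unfolding T_def using fin j by (intro member_le_sum) auto
        then have "\<bar>\<beta> j l - B p l\<bar> \<le> 2 * T l" using Bp[of l] by linarith
        then show "(\<beta> j l - B p l)\<^sup>2 \<le> (2 * T l)\<^sup>2" by (metis abs_ge_zero power2_abs power_mono)
      qed
      then have "K * Z \<le> H" using K by (simp add: H_def add_increasing2)
      then have "t * (K * Z) \<le> t * H" using t by (intro mult_left_mono) auto
      then show ?thesis using t by linarith
    qed
    moreover have "A p \<le> E + \<delta> / 2 + 2 * K * X"
    proof -
      let ?b = "L2_set (B p) L"
      have b2: "?b\<^sup>2 = X" by (simp add: L2_set_def X_def sum_nonneg)
      have "0 \<le> (D * ?b - \<delta>)\<^sup>2 / (2 * \<delta>)" using \<delta> by simp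
      also have "\<dots> = D\<^sup>2 * ?b\<^sup>2 / (2 * \<delta>) - D * ?b + \<delta> / 2"
        using \<delta> by (simp add: power2_eq_square field_simps)
      finally have "D * ?b \<le> \<delta> / 2 + D\<^sup>2 * X / (2 * \<delta>)" by (simp add: b2)
      also have "D\<^sup>2 * X / (2 * \<delta>) \<le> 2 * K * X"
      proof -
        have "D\<^sup>2 * X / (2 * \<delta>) = 2 * (D\<^sup>2 / (4 * \<delta>)) * X" by simp
        also have "\<dots> \<le> 2 * K * X"
          unfolding K_def X_def by (intro mult_right_mono) (auto simp: sum_nonneg)
        finally show ?thesis .
      qed
      finally have "D * ?b \<le> \<delta> / 2 + 2 * K * X" by simp
      moreover have "A p \<le> E + D * ?b" using bound[of p] p by (auto simp: A_def B_def P_def)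
      ultimately show ?thesis by simp
    qed
    moreover have "(\<Sum>l\<in>L. w l * \<beta> j l) = 2 * K * Y"
      by (simp add: w_def Y_def sum_distrib_left mult_ac)
    \<comment> \<open>The total error \<open>\<delta>\<close> consists of a quarter for
      near-minimality, a quarter for the second-order term and a half for Young's
      inequality.\<close>
    ultimately show ?thesis by linarith
  qed
  then show ?thesis by blast
qed

lemma sum_mult_le_L2_set: "(\<Sum>i\<in>I. f i * g i) \<le> L2_set f I * L2_set g I" for f g :: "'i \<Rightarrow> real"
proof -
  have "(\<Sum>i\<in>I. f i * g i) \<le> (\<Sum>i\<in>I. \<bar>f i\<bar> * \<bar>g i\<bar>)"
    by (intro sum_mono) (metis abs_ge_self abs_mult)
  then show ?thesis using L2_set_mult_ineq[of f g I] by linarith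
qed

text \<open>The rows of \<open>G\<close> are fixed before \<open>c\<close>, so they span one
  approximating subspace for the whole ball, and the error is measured by the functionals
  \<open>a j\<close>. The estimate is one-sided; two-sided control results when the family also
  contains the negatives.\<close>

lemma euclidean_ball_width:
  fixes a :: "'j \<Rightarrow> 'i \<Rightarrow> real" and m :: nat
  assumes fin: "finite I" "finite J" and J: "2 \<le> card J" and R: "0 < R" and m: "1 \<le> m"
    and a: "\<And>j. j \<in> J \<Longrightarrow> (\<Sum>i\<in>I. (a j i)\<^sup>2) \<le> R\<^sup>2"
  shows "\<exists>G :: nat \<Rightarrow> 'i \<Rightarrow> real. \<forall>c. (\<Sum>i\<in>I. (c i)\<^sup>2) \<le> 1 \<longrightarrow>
    (\<exists>w. \<forall>j\<in>J. (\<Sum>i\<in>I. (c i - (\<Sum>l<m. w l * G l i)) * a j i) \<le> 41 * R * sqrt (ln (card J) / m))"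
proof -
  define M where "M = ln (real (card J))"
  define \<epsilon> where "\<epsilon> = sqrt (M / m)"
  have M: "M > 0" using J by (simp add: M_def)
  have \<epsilon>: "\<epsilon> > 0" using M m by (simp add: \<epsilon>_def)
  have cR: "(\<Sum>i\<in>I. c i * a j i) \<le> R" if "(\<Sum>i\<in>I. (c i)\<^sup>2) \<le> 1" "j \<in> J" for c j
  proof -
    have "L2_set c I \<le> 1" using that by (simp add: L2_set_def)
    moreover have "L2_set (a j) I \<le> R" using a[OF that(2)] R by (simp add: L2_set_def real_le_lsqrt sum_nonneg)
    ultimately have "L2_set c I * L2_set (a j) I \<le> 1 * R" by (intro mult_mono) auto
    then show ?thesis using sum_mult_le_L2_set[where f=c and g="a j" and I=I] by simp
  qed
  show ?thesis
  proof (cases "m < 16 * M")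
    \<comment> \<open>Few rows: here \<open>\<epsilon>\<close> is at least 1/4, so
      \<open>41 * R * \<epsilon>\<close> exceeds the trivial bound \<open>R\<close> and
      approximation by zero is enough.\<close>
    case True
    have "(1/4)\<^sup>2 \<le> M / m" using True m by (simp add: power2_eq_square field_simps)
    then have "1/4 \<le> \<epsilon>" unfolding \<epsilon>_def by (intro real_le_rsqrt)
    then have "R * 1 \<le> R * (41 * \<epsilon>)" using R by (intro mult_left_mono) auto
    then have "R \<le> 41 * R * \<epsilon>" by simp
    then show ?thesis
      using cR by (intro exI[of _ "\<lambda>_ _. 0"] allI impI exI[of _ "\<lambda>_. 0"] ballI) (force simp: \<epsilon>_def M_def)
  next
    case False
    define x where "x = m / (8 * M)"
    have x: "x \<ge> 2" using False M by (simp add: x_def field_simps)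
    \<comment> \<open>The subtracted 1 leaves room for one more factor \<open>card J\<close>: from
      \<open>(r + 1) * M \<le> m / 8\<close> the union bound over \<open>card J ^ r\<close> sums is
      at most \<open>exp (- M)\<close>, hence at most 1/2. The case assumption guarantees
      \<open>r \<ge> 1\<close>.\<close>
    define r where "r = nat \<lfloor>x\<rfloor> - 1"
    have fl: "\<lfloor>x\<rfloor> \<ge> 2" using x by (simp add: le_floor_iff)
    have r1: "1 \<le> r" "real r = of_int \<lfloor>x\<rfloor> - 1" using fl unfolding r_def by linarith+
    have r2: "real r + 1 \<le> x" using r1 by linarith
    have r3: "x \<le> 3 * r" using r1 by linarith
    have rM: "(real r + 1) * M \<le> m / 8" using r2 M by (simp add: x_def field_simps)
    define S where "S = (\<lambda>z :: nat \<Rightarrow> 'j. \<lambda>i. \<Sum>t<r. a (z t) i)"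
    define Y where "Y = S ` PiE {..<r} (\<lambda>_. J)"
    have finY: "finite Y" unfolding Y_def using fin by (intro finite_imageI finite_PiE) auto
    have "card Y \<le> card (PiE {..<r} (\<lambda>_. J))" unfolding Y_def using fin by (intro card_image_le finite_PiE) auto
    then have "real (card Y) \<le> real (card J) ^ r" by (simp add: card_PiE flip: of_nat_power)
    also have "\<dots> = exp (r * M)" using J by (simp add: M_def exp_of_nat_mult)
    finally have cY: "real (card Y) \<le> exp (r * M)" .
    have "card (a ` J) \<le> card J" using fin by (intro card_image_le)
    then have cA: "real (card (a ` J)) \<le> exp M" using J by (simp add: M_def)
    have eM: "exp (- M) \<le> 1/2" using J by (simp add: M_def exp_minus field_simps)
    have "real (card Y) * exp (- (m / 8)) \<le> exp (r * M) * exp (- (m / 8))"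
      using cY by (intro mult_right_mono) auto
    also have "\<dots> \<le> exp (- M)" using rM by (simp add: mult_exp_exp algebra_simps)
    finally have 1: "real (card Y) * exp (- (m / 8)) \<le> 1/2" using eM by simp
    have "real (card (a ` J)) * exp (- (m / 2)) \<le> exp M * exp (- (m / 2))"
      using cA by (intro mult_right_mono) auto
    also have "\<dots> < exp (- M)" using False M by (simp add: mult_exp_exp)
    finally have 2: "real (card (a ` J)) * exp (- (m / 2)) < 1/2" using eM by simp
    from 1 2 have count: "real (card Y) * exp (- (m / 8)) + real (card (a ` J)) * exp (- (m / 2)) < 1"
      by linarith
    obtain G :: "nat \<Rightarrow> 'i \<Rightarrow> real" where
      lower: "\<And>y. y \<in> Y \<Longrightarrow> m / 4 * (\<Sum>i\<in>I. (y i)\<^sup>2) \<le> (\<Sum>l<m. (\<Sum>i\<in>I. G l i * y i)\<^sup>2)" and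
      upper: "\<And>y :: 'i \<Rightarrow> real. y \<in> a ` J \<Longrightarrow> (\<Sum>l<m. (\<Sum>i\<in>I. G l i * y i)\<^sup>2) \<le> 4 * real m * (\<Sum>i\<in>I. (y i)\<^sup>2)"
      by (rule sign_matrix_exists[OF fin(1) finY finite_imageI[OF fin(2)] count], rule that)
    have lower': "m / 4 * (\<Sum>i\<in>I. (\<Sum>t<r. a (z t) i)\<^sup>2) \<le> (\<Sum>l<m. (\<Sum>i\<in>I. G l i * (\<Sum>t<r. a (z t) i))\<^sup>2)"
      if "\<And>t. z t \<in> J" for z
    proof -
      have "S z = S (restrict z {..<r})" by (simp add: S_def)
      moreover have "restrict z {..<r} \<in> PiE {..<r} (\<lambda>_. J)" using that by auto
      ultimately have "S z \<in> Y" unfolding Y_def by blast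
      from lower[OF this] show ?thesis by (simp add: S_def)
    qed
    \<comment> \<open>Rounding down costs at most a factor 3 in \<open>r\<close>, whence
      \<open>m \<le> 24 * r * M\<close>; replacing 24 by the square 25 turns the constant 8 into
      40.\<close>
    have rle: "8 * R / sqrt r \<le> 40 * R * \<epsilon>"
    proof -
      have rpos: "real r > 0" using r1(1) by simp
      have "m \<le> 3 * r * (8 * M)" using r3 M unfolding x_def by (simp add: divide_le_eq)
      moreover have "0 \<le> r * M" using M by simp
      ultimately have "m \<le> 25 * (r * M)" by linarith
      then have "1 / r \<le> 25 * (M / m)" using rpos m by (simp add: field_simps)
      then have "sqrt (1 / r) \<le> sqrt (25 * (M / m))" by simp
      also have "\<dots> = 5 * \<epsilon>" unfolding \<epsilon>_def real_sqrt_mult by simp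
      finally have "8 * R * sqrt (1 / r) \<le> 8 * R * (5 * \<epsilon>)" using R by (intro mult_left_mono) auto
      then show ?thesis by (simp add: real_sqrt_divide)
    qed
    have "\<exists>w. \<forall>j\<in>J. (\<Sum>i\<in>I. (c i - (\<Sum>l<m. w l * G l i)) * a j i) \<le> 41 * R * \<epsilon>"
      if c: "(\<Sum>i\<in>I. (c i)\<^sup>2) \<le> 1" for c
    proof -
      \<comment> \<open>Duality with \<open>\<alpha> j\<close> the inner product of \<open>c\<close>
        with \<open>a j\<close> and \<open>\<beta> j\<close> the image of \<open>a j\<close> under
        \<open>G\<close>. Cauchy-Schwarz reduces its hypothesis to the norm of a convex combination.
        The slack \<open>R * \<epsilon>\<close> raises 40 to 41.\<close>
      have "\<exists>w. \<forall>j\<in>J. (\<Sum>i\<in>I. c i * a j i) - (\<Sum>l\<in>{..<m}. w l * (\<Sum>i\<in>I. G l i * a j i)) \<le> 40 * R * \<epsilon> + R * \<epsilon>"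
      proof (rule quadratic_duality[where D = "2 / sqrt m"])
        show "J \<noteq> {}" using J by auto
        show "0 < R * \<epsilon>" using R \<epsilon> by simp
        fix p :: "'j \<Rightarrow> real" assume p: "\<And>j. j \<in> J \<Longrightarrow> 0 \<le> p j" "sum p J = 1"
        define x where "x = (\<lambda>i. \<Sum>j\<in>J. p j * a j i)"
        have "(\<Sum>j\<in>J. p j * (\<Sum>i\<in>I. c i * a j i)) = (\<Sum>i\<in>I. c i * x i)"
          by (simp add: x_def sum_distrib_left mult_ac sum.swap[of _ J])
        also have "\<dots> \<le> L2_set c I * L2_set x I" by (rule sum_mult_le_L2_set)
        also have "\<dots> \<le> 1 * L2_set x I" using c by (intro mult_right_mono) (auto simp: L2_set_def sum_nonneg)
        also have "\<dots> \<le> 8 * R / sqrt r + 2 / sqrt m * L2_set (\<lambda>l. \<Sum>i\<in>I. G l i * x i) {..<m}"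
          unfolding mult_1 x_def
          by (rule convex_combination_norm_le) (use fin r1 m R a p upper lower' in auto)
        also have "(\<lambda>l. \<Sum>i\<in>I. G l i * x i) = (\<lambda>l. \<Sum>j\<in>J. p j * (\<Sum>i\<in>I. G l i * a j i))"
          by (simp add: x_def sum_distrib_left mult_ac sum.swap[of _ J])
        finally show "(\<Sum>j\<in>J. p j * (\<Sum>i\<in>I. c i * a j i))
           \<le> 40 * R * \<epsilon> + 2 / sqrt m * L2_set (\<lambda>l. \<Sum>j\<in>J. p j * (\<Sum>i\<in>I. G l i * a j i)) {..<m}"
          using rle by linarith
      qed (use fin in auto)
      moreover have "(\<Sum>i\<in>I. c i * a j i) - (\<Sum>l\<in>{..<m}. w l * (\<Sum>i\<in>I. G l i * a j i))
          = (\<Sum>i\<in>I. (c i - (\<Sum>l<m. w l * G l i)) * a j i)" for w j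
      proof -
        have "(\<Sum>l\<in>{..<m}. w l * (\<Sum>i\<in>I. G l i * a j i)) = (\<Sum>i\<in>I. (\<Sum>l<m. w l * G l i) * a j i)"
          by (simp add: sum_distrib_left sum_distrib_right mult.assoc sum.swap[of _ I])
        then show ?thesis by (simp add: left_diff_distrib sum_subtractf)
      qed
      moreover have "40 * R * \<epsilon> + R * \<epsilon> = 41 * R * \<epsilon>" by simp
      ultimately show ?thesis by (simp only:)
    qed
    then show ?thesis unfolding \<epsilon>_def M_def by blast
  qed
qed

section \<open>Fourier analysis on the torus\<close>

definition fourier_char :: "int ^ 'd \<Rightarrow> real ^ 'd \<Rightarrow> complex" where
  "fourier_char k x = exp (\<i> * complex_of_real (\<Sum>j\<in>UNIV. of_int (k $ j) * x $ j))"

lemma fourier_char_0 [simp]: "fourier_char 0 x = 1"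
  by (simp add: fourier_char_def)

lemma fourier_char_add: "fourier_char (k + l) x = fourier_char k x * fourier_char l x"
  by (simp add: fourier_char_def distrib_right sum.distrib distrib_left exp_add)

lemma fourier_char_minus: "fourier_char (- k) x = cnj (fourier_char k x)"
  by (simp add: fourier_char_def exp_cnj sum_negf)

lemma norm_fourier_char [simp]: "norm (fourier_char k x) = 1"
  by (simp add: fourier_char_def)

lemma fourier_char_diff_right: "fourier_char k (x - y) = fourier_char k x * cnj (fourier_char k y)"
  by (simp add: fourier_char_def right_diff_distrib sum_subtractf exp_diff exp_cnj)
     (simp add: exp_minus field_simps)

lemma fourier_char_cnj_mult [simp]: "fourier_char k x * cnj (fourier_char k x) = 1"
  by (simp add: complex_norm_square[symmetric])

lemma continuous_fourier_char [continuous_intros]: "continuous_on S (fourier_char k)"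
  unfolding fourier_char_def by (intro continuous_intros)

lemma borel_measurable_fourier_char [measurable]: "fourier_char k \<in> borel_measurable borel"
  by (intro borel_measurable_continuous_onI continuous_intros)

lemma exp_2pi_int: "exp (\<i> * complex_of_real (of_int n * (2 * pi))) = 1"
  by (simp only: exp_eq_1) (auto intro!: exI[of _ n])

lemma torus_periodic_fourier_char: "torus_periodic (fourier_char k)"
  unfolding torus_periodic_def
proof (intro allI)
  fix x :: "real ^ 'a" and i :: 'a
  have "(\<Sum>j\<in>UNIV. of_int (k $ j) * (x + axis i (2 * pi)) $ j)
      = (\<Sum>j\<in>UNIV. of_int (k $ j) * x $ j + (if j = i then of_int (k $ i) * (2 * pi) else 0))"
    by (intro sum.cong) (auto simp: axis_def distrib_left)
  also have "\<dots> = (\<Sum>j\<in>UNIV. of_int (k $ j) * x $ j) + of_int (k $ i) * (2 * pi)"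
    by (simp add: sum.distrib)
  finally have "(\<Sum>j\<in>UNIV. of_int (k $ j) * (x + axis i (2 * pi)) $ j)
      = (\<Sum>j\<in>UNIV. of_int (k $ j) * x $ j) + of_int (k $ i) * (2 * pi)" .
  then show "fourier_char k (x + axis i (2 * pi)) = fourier_char k x"
    by (simp only: fourier_char_def of_real_add distrib_left exp_add exp_2pi_int mult_1_right)
qed

abbreviation period_box :: "(real ^ 'd) set" where
  "period_box \<equiv> cbox 0 (\<chi> j. 2 * pi)"

lemma emeasure_period_box:
  "emeasure lebesgue (period_box :: (real ^ 'd) set) = ennreal ((2 * pi) ^ CARD('d))"
proof -
  have "emeasure lborel (period_box :: (real ^ 'd) set) = ennreal (\<Prod>b\<in>Basis. ((\<chi> j. 2 * pi) - 0 :: real ^ 'd) \<bullet> b)"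
    by (rule emeasure_lborel_cbox) (auto simp: Basis_vec_def inner_axis)
  also have "(\<Prod>b\<in>Basis. ((\<chi> j. 2 * pi) - 0 :: real ^ 'd) \<bullet> b) = (\<Prod>b\<in>(Basis :: (real ^ 'd) set). 2 * pi)"
    by (intro prod.cong) (auto simp: Basis_vec_def inner_axis)
  finally show ?thesis by simp
qed

lemma prob_space_torus: "prob_space (torus_measure :: (real ^ 'd) measure)"
  unfolding torus_measure_def
  by (intro prob_space_uniform_measure) (simp_all add: emeasure_period_box)

lemma space_torus [simp]: "space torus_measure = UNIV"
  by (simp add: torus_measure_def)

lemma borel_measurable_torus:
  assumes "f \<in> borel_measurable borel"
  shows "f \<in> borel_measurable torus_measure"
proof -
  have "f \<in> borel_measurable lebesgue" using assms by (simp add: measurable_completion)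
  then show ?thesis
    unfolding torus_measure_def by (subst measurable_cong_sets[OF sets_uniform_measure refl])
qed

lemma integrable_torus_bounded:
  fixes f :: "real ^ 'd \<Rightarrow> 'b :: {banach, second_countable_topology}"
  assumes "f \<in> borel_measurable borel" "\<And>x. norm (f x) \<le> B"
  shows "integrable torus_measure f"
proof -
  interpret prob_space "torus_measure :: (real ^ 'd) measure" by (rule prob_space_torus)
  show ?thesis using assms by (intro integrable_const_bound[of _ B]) (auto intro: borel_measurable_torus)
qed

lemma AE_torus: "AE x in torus_measure. x \<in> period_box"
  unfolding torus_measure_def by (rule AE_uniform_measureI) auto

text \<open>Leaving the Lebesgue completion for \<open>lborel\<close> makes the product structure
  and the fundamental theorem of calculus available for the orthogonality relations.\<close>

lemma integral_torus:
  fixes f :: "real ^ 'd \<Rightarrow> 'b :: {banach, second_countable_topology}"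
  assumes f: "f \<in> borel_measurable borel"
  shows "(\<integral>x. f x \<partial>torus_measure) = (\<integral>x. indicator period_box x *\<^sub>R f x \<partial>lborel) /\<^sub>R (2 * pi) ^ CARD('d)"
proof -
  let ?V = "(2 * pi) ^ CARD('d)"
  have eq: "torus_measure = density lebesgue (\<lambda>x :: real ^ 'd. ennreal (indicator period_box x / ?V))"
  proof -
    have "1 / ennreal ?V = ennreal (1 / ?V)" using divide_ennreal[of 1 ?V] by simp
    then have "(\<lambda>x :: real ^ 'd. indicator period_box x / ennreal ?V) = (\<lambda>x. ennreal (indicator period_box x / ?V))"
      by (intro ext) (simp split: split_indicator)
    then show ?thesis unfolding torus_measure_def uniform_measure_def emeasure_period_box by simp
  qed
  have "(\<integral>x. f x \<partial>torus_measure) = (\<integral>x. (indicator period_box x / ?V) *\<^sub>R f x \<partial>lebesgue)"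
    unfolding eq using f by (intro integral_density) (auto simp: measurable_completion)
  also have "\<dots> = (\<integral>x. (indicator period_box x / ?V) *\<^sub>R f x \<partial>lborel)"
    using f by (intro integral_completion) auto
  also have "\<dots> = (\<integral>x. (1 / ?V) *\<^sub>R (indicator period_box x *\<^sub>R f x) \<partial>lborel)"
    by (intro Bochner_Integration.integral_cong) auto
  also have "\<dots> = (1 / ?V) *\<^sub>R (\<integral>x. indicator period_box x *\<^sub>R f x \<partial>lborel)"
    by (rule integral_scaleR_right)
  finally show ?thesis by (simp add: divide_inverse)
qed

lemma integral_exp_period:
  fixes n :: int
  assumes "n \<noteq> 0"
  shows "(\<integral>t. indicator {0..2 * pi} t *\<^sub>R exp (\<i> * complex_of_real (of_int n * t)) \<partial>lborel) = 0"
proof -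
  let ?F = "\<lambda>t. exp (\<i> * complex_of_real (of_int n * t)) / (\<i> * of_int n)"
  have "(\<integral>t. indicator {0..2 * pi} t *\<^sub>R exp (\<i> * complex_of_real (of_int n * t)) \<partial>lborel) = ?F (2 * pi) - ?F 0"
  proof (rule integral_FTC_atLeastAtMost)
    fix t :: real
    show "(?F has_vector_derivative exp (\<i> * complex_of_real (of_int n * t))) (at t within {0..2 * pi})"
      using assms
      by (auto intro!: derivative_eq_intros has_vector_derivative_real_field simp: field_simps)
  qed (auto intro!: continuous_intros)
  also have "\<dots> = 0" by (simp only: exp_2pi_int) simp
  finally show ?thesis .
qed

lemma integral_lborel_prod:
  fixes f :: "'a :: euclidean_space \<Rightarrow> real \<Rightarrow> complex"
  assumes int: "\<And>b. b \<in> Basis \<Longrightarrow> integrable lborel (f b)"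
  shows "(\<integral>x. (\<Prod>b\<in>Basis. f b (x \<bullet> b)) \<partial>lborel) = (\<Prod>b\<in>Basis. (\<integral>t. f b t \<partial>lborel))"
proof -
  interpret product_sigma_finite "\<lambda>_ :: 'a. lborel :: real measure" ..
  have [measurable]: "f b \<in> borel_measurable borel" if "b \<in> Basis" for b
    using int[OF that] by auto
  have "(\<integral>x. (\<Prod>b\<in>Basis. f b (x \<bullet> b)) \<partial>lborel)
      = (\<integral>g. (\<Prod>b\<in>Basis. f b ((\<Sum>c\<in>Basis. g c *\<^sub>R c) \<bullet> b)) \<partial>(\<Pi>\<^sub>M b\<in>Basis. lborel))"
    by (subst lborel_eq, subst integral_distr) auto
  also have "\<dots> = (\<integral>g. (\<Prod>b\<in>Basis. f b (g b)) \<partial>(\<Pi>\<^sub>M b\<in>Basis. lborel))"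
    by (intro Bochner_Integration.integral_cong prod.cong) auto
  finally show ?thesis using int by (simp add: product_integral_prod)
qed

text \<open>Box and character both factorise over the coordinates, and a nonzero frequency has a
  nonzero coordinate, whose one-dimensional integral over a full period vanishes.\<close>

lemma integral_fourier_char:
  fixes k :: "int ^ 'd"
  shows "(\<integral>x. fourier_char k x \<partial>torus_measure) = (if k = 0 then 1 else 0)"
proof (cases "k = 0")
  case True
  interpret prob_space "torus_measure :: (real ^ 'd) measure" by (rule prob_space_torus)
  from True show ?thesis using prob_space by simp
next
  case False
  then obtain j where j: "k $ j \<noteq> 0" by (auto simp: vec_eq_iff)
  define \<kappa> :: "real ^ 'd" where "\<kappa> = (\<chi> j. of_int (k $ j))"
  define f where "f = (\<lambda>b t. indicator {0..2 * pi} t *\<^sub>R exp (\<i> * complex_of_real ((\<kappa> \<bullet> b) * t)))"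
  have char: "fourier_char k x = (\<Prod>b\<in>Basis. exp (\<i> * complex_of_real ((\<kappa> \<bullet> b) * (x \<bullet> b))))" for x
  proof -
    have "(\<Sum>j\<in>UNIV. of_int (k $ j) * x $ j) = \<kappa> \<bullet> x" by (simp add: inner_vec_def \<kappa>_def)
    also have "\<dots> = (\<Sum>b\<in>Basis. (\<kappa> \<bullet> b) * (x \<bullet> b))" by (rule euclidean_inner)
    finally show ?thesis by (simp add: fourier_char_def exp_sum sum_distrib_left)
  qed
  have box: "indicator period_box x = (\<Prod>b\<in>Basis. indicator {0..2 * pi} (x \<bullet> b) :: real)" for x :: "real ^ 'd"
  proof -
    have "((\<chi> j. 2 * pi) :: real ^ 'd) \<bullet> b = 2 * pi" if "b \<in> Basis" for b
      using that by (auto simp: Basis_vec_def inner_axis)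
    then have "x \<in> period_box \<longleftrightarrow> (\<forall>b\<in>Basis. x \<bullet> b \<in> {0..2 * pi})"
      by (auto simp: mem_box)
    then show ?thesis
      by (cases "x \<in> period_box")
         (auto simp: indicator_def intro!: prod.neutral[symmetric] prod_zero[symmetric])
  qed
  have "indicator period_box x *\<^sub>R fourier_char k x = (\<Prod>b\<in>Basis. f b (x \<bullet> b))" for x
    by (simp add: f_def scaleR_conv_of_real prod.distrib char box)
  then have "(\<integral>x. indicator period_box x *\<^sub>R fourier_char k x \<partial>lborel) = (\<integral>x. (\<Prod>b\<in>Basis. f b (x \<bullet> b)) \<partial>lborel)"
    by simp
  also have "\<dots> = (\<Prod>b\<in>Basis. (\<integral>t. f b t \<partial>lborel))"
    unfolding f_def by (intro integral_lborel_prod borel_integrable_compact) (auto intro!: continuous_intros)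
  also have "\<dots> = 0"
  proof (rule prod_zero)
    have "\<kappa> \<bullet> axis j 1 = of_int (k $ j)" by (simp add: \<kappa>_def inner_axis)
    then have "(\<integral>t. f (axis j 1) t \<partial>lborel) = 0"
      using integral_exp_period[OF j] by (simp add: f_def)
    then show "\<exists>b\<in>Basis. (\<integral>t. f b t \<partial>lborel) = 0"
      by (intro bexI[of _ "axis j 1"]) (auto simp: Basis_vec_def)
  qed simp
  finally show ?thesis using False by (simp add: integral_torus)
qed

section \<open>Fourier coefficients and Bessel's inequality\<close>

definition fourier_coeff :: "(real ^ 'd \<Rightarrow> complex) \<Rightarrow> int ^ 'd \<Rightarrow> complex" where
  "fourier_coeff f k = (\<integral>x. f x * cnj (fourier_char k x) \<partial>torus_measure)"

lemma borel_measurable_cnj [measurable]: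
  "f \<in> borel_measurable M \<Longrightarrow> (\<lambda>x. cnj (f x)) \<in> borel_measurable M"
  by (rule measurable_compose[OF _ borel_measurable_continuous_onI]) (auto intro: continuous_intros)

lemma integrable_mult_fourier_char:
  fixes f :: "real ^ 'd \<Rightarrow> complex"
  assumes [measurable]: "f \<in> borel_measurable borel" and "\<And>x. norm (f x) \<le> B"
  shows "integrable torus_measure (\<lambda>x. f x * fourier_char k x)"
    "integrable torus_measure (\<lambda>x. f x * cnj (fourier_char k x))"
  using assms by (auto intro!: integrable_torus_bounded[of _ B] simp: norm_mult)

lemma norm_trig_sum_le: "norm (\<Sum>k\<in>Q. c k * fourier_char k x) \<le> (\<Sum>k\<in>Q. norm (c k))"
  by (rule order_trans[OF norm_sum]) (simp add: norm_mult)

lemma fourier_coeff_trig_sum: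
  fixes Q :: "(int ^ 'd) set"
  assumes "finite Q"
  shows "fourier_coeff (\<lambda>x. \<Sum>k\<in>Q. c k * fourier_char k x) l = (if l \<in> Q then c l else 0)"
proof -
  have char: "fourier_char k x * cnj (fourier_char l x) = fourier_char (k - l) x" for k x
    using fourier_char_add[of k "- l" x] by (simp add: fourier_char_minus)
  have "fourier_coeff (\<lambda>x. \<Sum>k\<in>Q. c k * fourier_char k x) l
      = (\<integral>x. (\<Sum>k\<in>Q. c k * fourier_char (k - l) x) \<partial>torus_measure)"
    unfolding fourier_coeff_def by (simp add: sum_distrib_right mult.assoc char)
  also have "\<dots> = (\<Sum>k\<in>Q. \<integral>x. c k * fourier_char (k - l) x \<partial>torus_measure)"
    by (intro Bochner_Integration.integral_sum integrable_mult_fourier_char(1)[of _ "norm (c _)"]) auto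
  also have "\<dots> = (\<Sum>k\<in>Q. if k = l then c k else 0)"
    by (intro sum.cong) (auto simp: integral_fourier_char)
  finally show ?thesis using assms by simp
qed

lemma integral_mult_cnj_trig_sum:
  assumes "finite Q" and f: "f \<in> borel_measurable borel" "\<And>x. norm (f x) \<le> B"
  shows "(\<integral>x. f x * cnj (\<Sum>k\<in>Q. c k * fourier_char k x) \<partial>torus_measure)
    = (\<Sum>k\<in>Q. cnj (c k) * fourier_coeff f k)"
proof -
  have "(\<integral>x. f x * cnj (\<Sum>k\<in>Q. c k * fourier_char k x) \<partial>torus_measure)
     = (\<integral>x. (\<Sum>k\<in>Q. cnj (c k) * (f x * cnj (fourier_char k x))) \<partial>torus_measure)"
    by (simp add: sum_distrib_left mult_ac)
  also have "\<dots> = (\<Sum>k\<in>Q. \<integral>x. cnj (c k) * (f x * cnj (fourier_char k x)) \<partial>torus_measure)"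
    by (intro Bochner_Integration.integral_sum integrable_mult_right integrable_mult_fourier_char(2)[OF f])
  finally show ?thesis by (simp add: fourier_coeff_def)
qed

text \<open>Bounded Borel functions are the right generality: the application is to a truncated
  function, which has no finite spectrum.\<close>

lemma bessel_inequality:
  fixes Q :: "(int ^ 'd) set"
  assumes Q: "finite Q" and f: "f \<in> borel_measurable borel" "\<And>x. norm (f x) \<le> B"
  shows "(\<Sum>k\<in>Q. (norm (fourier_coeff f k))\<^sup>2) \<le> (\<integral>x. (norm (f x))\<^sup>2 \<partial>torus_measure)"
proof -
  let ?M = "torus_measure :: (real ^ 'd) measure"
  define P where "P = (\<lambda>x. \<Sum>k\<in>Q. fourier_coeff f k * fourier_char k x)"
  define s where "s = (\<Sum>k\<in>Q. (norm (fourier_coeff f k))\<^sup>2)"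
  define C where "C = (\<Sum>k\<in>Q. norm (fourier_coeff f k))"
  note [measurable] = f(1)
  have Pm [measurable]: "P \<in> borel_measurable borel" unfolding P_def by measurable
  have PC: "norm (P x) \<le> C" for x unfolding P_def C_def by (rule norm_trig_sum_le)
  have B: "B \<ge> 0" using f(2)[of 0] norm_ge_zero order_trans by blast
  have C: "C \<ge> 0" by (simp add: C_def sum_nonneg)
  have s_eq: "(\<Sum>k\<in>Q. cnj (fourier_coeff f k) * fourier_coeff f k) = of_real s"
    unfolding s_def of_real_sum by (intro sum.cong refl) (simp add: complex_norm_square mult.commute flip: of_real_power)
  have fP: "(\<integral>x. f x * cnj (P x) \<partial>?M) = of_real s"
    using integral_mult_cnj_trig_sum[OF Q f] s_eq by (simp add: P_def)
  have "fourier_coeff P k = fourier_coeff f k" if "k \<in> Q" for k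
    unfolding P_def using fourier_coeff_trig_sum[OF Q] that by simp
  moreover have "(\<Sum>k\<in>Q. fourier_coeff f k * fourier_char k x) = P x" for x by (simp add: P_def)
  ultimately have PP: "(\<integral>x. P x * cnj (P x) \<partial>?M) = of_real s"
    using integral_mult_cnj_trig_sum[OF Q Pm PC, of "fourier_coeff f"] s_eq by (simp del: cnj_sum)
  have i1: "integrable ?M (\<lambda>x. f x * cnj (P x))"
    by (rule integrable_torus_bounded[of _ "B * C"]) (use f PC B in \<open>auto simp: norm_mult intro!: mult_mono\<close>)
  have i2: "integrable ?M (\<lambda>x. P x * cnj (P x))"
    by (rule integrable_torus_bounded[of _ "C * C"]) (use PC C in \<open>auto simp: norm_mult intro!: mult_mono\<close>)
  have i3: "integrable ?M (\<lambda>x. (norm (f x))\<^sup>2)"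
    by (rule integrable_torus_bounded[of _ "B\<^sup>2"]) (use f in \<open>auto intro!: power_mono\<close>)
  have "0 \<le> (\<integral>x. (norm (f x - P x))\<^sup>2 \<partial>?M)" by simp
  also have "\<dots> = (\<integral>x. (norm (f x))\<^sup>2 - 2 * Re (f x * cnj (P x)) + Re (P x * cnj (P x)) \<partial>?M)"
    by (intro Bochner_Integration.integral_cong refl)
       (simp add: cmod_power2, simp add: power2_eq_square algebra_simps)
  also have "\<dots> = (\<integral>x. (norm (f x))\<^sup>2 \<partial>?M) - 2 * (\<integral>x. Re (f x * cnj (P x)) \<partial>?M) + (\<integral>x. Re (P x * cnj (P x)) \<partial>?M)"
    using i1 i2 i3 by (simp del: complex_cnj_mult times_complex.sel)
  also have "(\<integral>x. Re (f x * cnj (P x)) \<partial>?M) = s"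
    using i1 fP by (simp del: times_complex.sel)
  also have "(\<integral>x. Re (P x * cnj (P x)) \<partial>?M) = s"
    using i2 PP by (simp del: times_complex.sel)
  finally show ?thesis by (simp add: s_def)
qed

section \<open>Discretisation and widths of quadratic balls of polynomials\<close>

lemma norm_fourier_char_diff_le:
  fixes k :: "int ^ 'd"
  assumes N: "\<And>j. \<bar>k $ j\<bar> \<le> N" and h: "\<And>j. \<bar>x $ j - y $ j\<bar> \<le> h"
  shows "norm (fourier_char k x - fourier_char k y) \<le> real CARD('d) * of_int N * h"
proof -
  have N0: "N \<ge> 0" using N[of undefined] by linarith
  define \<theta> where "\<theta> = (\<Sum>j\<in>UNIV. of_int (k $ j) * (x - y) $ j)"
  have "exp (\<i> * \<theta>) = fourier_char k x * cnj (fourier_char k y)"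
    unfolding fourier_char_diff_right[symmetric] by (simp only: \<theta>_def fourier_char_def)
  then have "fourier_char k y * (exp (\<i> * \<theta>) - 1)
      = fourier_char k x * (fourier_char k y * cnj (fourier_char k y)) - fourier_char k y"
    by (simp only: right_diff_distrib mult_ac mult_1_left mult_1_right)
  then have "fourier_char k x - fourier_char k y = fourier_char k y * (exp (\<i> * \<theta>) - 1)"
    by simp
  then have "norm (fourier_char k x - fourier_char k y) = norm (exp (\<i> * \<theta>) - 1)"
    by (simp add: norm_mult)
  also have "\<dots> \<le> \<bar>\<theta>\<bar>" using abs_sin_x_le_abs_x[of "\<theta> / 2"] by (simp add: dist_exp_i_1)
  also have "\<dots> \<le> (\<Sum>j\<in>(UNIV::'d set). N * h)"
    unfolding \<theta>_def
  proof (intro sum_abs[THEN order_trans] sum_mono)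
    fix j :: 'd
    have "\<bar>real_of_int (k $ j)\<bar> \<le> real_of_int N" using N[of j] by linarith
    then show "\<bar>real_of_int (k $ j) * (x - y) $ j\<bar> \<le> N * h"
      using h[of j] N0 by (auto simp: abs_mult intro!: mult_mono)
  qed
  also have "\<dots> = real CARD('d) * of_int N * h" by simp
  finally show ?thesis .
qed

text \<open>All coefficients are bounded by the maximum \<open>S\<close> of the polynomial, so on a
  grid this fine it changes by at most \<open>S / 2\<close> between a point and its node; then
  \<open>S \<le> B + S / 2\<close>. The oversampling by \<open>card Q\<close> is harmless because
  the number of nodes will enter only through its logarithm.\<close>

lemma trig_sum_discretization:
  fixes Q :: "(int ^ 'd) set" and L :: nat
  assumes Q: "finite Q" and N: "\<And>k j. k \<in> Q \<Longrightarrow> \<bar>k $ j\<bar> \<le> N" "0 \<le> N"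
    and L: "1 \<le> L" "4 * pi * CARD('d) * N * card Q \<le> L"
  obtains \<Xi> :: "(real ^ 'd) set" where "finite \<Xi>" "\<Xi> \<noteq> {}" "card \<Xi> \<le> (L + 1) ^ CARD('d)"
    and "\<And>c B x. (\<And>\<xi>. \<xi> \<in> \<Xi> \<Longrightarrow> norm (\<Sum>k\<in>Q. c k * fourier_char k \<xi>) \<le> B) \<Longrightarrow> x \<in> period_box \<Longrightarrow>
      norm (\<Sum>k\<in>Q. c k * fourier_char k x) \<le> 2 * B"
proof -
  interpret prob_space "torus_measure :: (real ^ 'd) measure" by (rule prob_space_torus)
  \<comment> \<open>Both ends of the period are kept, so the index runs up to and including
    \<open>L\<close>: rounding down a coordinate equal to \<open>2 * pi\<close> gives exactly
    \<open>L\<close>.\<close>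
  define node where "node = (\<lambda>i :: 'd \<Rightarrow> nat. (\<chi> j. 2 * pi * i j / L) :: real ^ 'd)"
  define \<Xi> where "\<Xi> = node ` PiE UNIV (\<lambda>_. {..L})"
  have finP: "finite (PiE (UNIV::'d set) (\<lambda>_. {..L}))" by (intro finite_PiE) auto
  have "card \<Xi> \<le> card (PiE (UNIV::'d set) (\<lambda>_. {..L}))" unfolding \<Xi>_def by (rule card_image_le[OF finP])
  then have card: "card \<Xi> \<le> (L + 1) ^ CARD('d)" by (simp add: card_PiE)
  have fin: "finite \<Xi>" unfolding \<Xi>_def using finP by simp
  have near: "\<exists>\<xi>\<in>\<Xi>. \<forall>j. \<bar>x $ j - \<xi> $ j\<bar> \<le> 2 * pi / L" if x: "x \<in> period_box" for x
  proof -
    define i where "i = (\<lambda>j. nat \<lfloor>x $ j * L / (2 * pi)\<rfloor>)"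
    have xj: "0 \<le> x $ j" "x $ j \<le> 2 * pi" for j using x by (auto simp: mem_box_cart)
    have fl: "real (i j) \<le> x $ j * L / (2 * pi)" "x $ j * L / (2 * pi) < real (i j) + 1" for j
    proof -
      have "0 \<le> x $ j * L / (2 * pi)" using xj[of j] by simp
      then show "real (i j) \<le> x $ j * L / (2 * pi)" "x $ j * L / (2 * pi) < real (i j) + 1"
        unfolding i_def by linarith+
    qed
    have "x $ j * L / (2 * pi) \<le> L" for j
      using mult_right_mono[OF xj(2)[of j], of "real L"] by (simp add: divide_le_eq mult_ac)
    then have "real (i j) \<le> L" for j using fl(1)[of j] order_trans by blast
    then have "node i \<in> \<Xi>" unfolding \<Xi>_def by auto
    moreover have "\<bar>x $ j - node i $ j\<bar> \<le> 2 * pi / L" for j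
    proof -
      have "2 * pi * i j / L \<le> x $ j" using fl(1)[of j] L by (simp add: field_simps)
      moreover have "x $ j \<le> 2 * pi * i j / L + 2 * pi / L" using fl(2)[of j] L by (simp add: field_simps)
      ultimately show ?thesis by (simp add: node_def)
    qed
    ultimately show ?thesis by blast
  qed
  have box0: "(0 :: real ^ 'd) \<in> period_box" by (simp add: mem_box_cart)
  then have ne: "\<Xi> \<noteq> {}" using near by blast
  show thesis
  proof (rule that[OF fin ne card])
    fix c :: "int ^ 'd \<Rightarrow> complex" and B and x :: "real ^ 'd"
    assume B: "\<And>\<xi>. \<xi> \<in> \<Xi> \<Longrightarrow> norm (\<Sum>k\<in>Q. c k * fourier_char k \<xi>) \<le> B" and x: "x \<in> period_box"
    define f where "f = (\<lambda>x. \<Sum>k\<in>Q. c k * fourier_char k x)"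
    have fm [measurable]: "f \<in> borel_measurable borel" unfolding f_def by measurable
    have fb: "norm (f x) \<le> (\<Sum>k\<in>Q. norm (c k))" for x unfolding f_def by (rule norm_trig_sum_le)
    define S where "S = (SUP x\<in>period_box. norm (f x))"
    have bdd: "bdd_above ((\<lambda>x. norm (f x)) ` period_box)" using fb by (auto intro!: bdd_aboveI2)
    have S: "norm (f x) \<le> S" if "x \<in> period_box" for x
      unfolding S_def using bdd that by (intro cSUP_upper)
    have S0: "S \<ge> 0" using S[OF box0] norm_ge_zero order_trans by blast
    have cS: "norm (c k) \<le> S" if k: "k \<in> Q" for k
    proof -
      have "c k = fourier_coeff f k" unfolding f_def using fourier_coeff_trig_sum[OF Q] k by simp
      then have "norm (c k) \<le> (\<integral>x. norm (f x * cnj (fourier_char k x)) \<partial>torus_measure)"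
        unfolding fourier_coeff_def by (simp only: integral_norm_bound)
      also have "\<dots> \<le> S"
        using AE_torus S integrable_norm[OF integrable_mult_fourier_char(2)[OF fm fb, of k]]
        by (intro integral_le_const) (auto simp: norm_mult)
      finally show ?thesis .
    qed
    have "norm (f x) \<le> B + S / 2" if x: "x \<in> period_box" for x
    proof -
      obtain \<xi> where \<xi>: "\<xi> \<in> \<Xi>" "\<And>j. \<bar>x $ j - \<xi> $ j\<bar> \<le> 2 * pi / L" using near[OF x] by blast
      have "norm (f x - f \<xi>) = norm (\<Sum>k\<in>Q. c k * (fourier_char k x - fourier_char k \<xi>))"
        by (simp add: f_def right_diff_distrib sum_subtractf)
      also have "\<dots> \<le> (\<Sum>k\<in>Q. S * (real CARD('d) * of_int N * (2 * pi / L)))"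
      proof (intro norm_sum[THEN order_trans] sum_mono)
        fix k assume k: "k \<in> Q"
        show "norm (c k * (fourier_char k x - fourier_char k \<xi>)) \<le> S * (real CARD('d) * of_int N * (2 * pi / L))"
          unfolding norm_mult
          by (intro mult_mono cS k norm_fourier_char_diff_le N \<xi>(2) S0) auto
      qed
      also have "\<dots> = S * (4 * pi * CARD('d) * N * card Q / L) / 2" by simp
      also have "\<dots> \<le> S * 1 / 2"
        using L S0 by (intro divide_right_mono mult_left_mono) auto
      finally have "norm (f x - f \<xi>) \<le> S / 2" by simp
      moreover have "norm (f \<xi>) \<le> B" using B[OF \<xi>(1)] by (simp add: f_def)
      ultimately show ?thesis using norm_triangle_sub[of "f x" "f \<xi>"] by linarith
    qed
    then have "S \<le> B + S / 2" unfolding S_def using box0 by (intro cSUP_least) auto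
    then show "norm (\<Sum>k\<in>Q. c k * fourier_char k x) \<le> 2 * B"
      using S[OF x] by (simp add: f_def)
  qed
qed

text \<open>This recovers a modulus from one-sided real inequalities. The four rotations contain the
  negatives of the real and imaginary parts, and these parts bound the modulus by their sum.\<close>

lemma norm_le_Re_rotations:
  fixes z :: complex
  assumes "\<And>t. t < 4 \<Longrightarrow> Re (\<i> ^ t * z) \<le> b"
  shows "norm z \<le> 2 * b"
proof -
  have "Re z \<le> b" "- Im z \<le> b" "- Re z \<le> b" "Im z \<le> b"
    using assms[of 0] assms[of 1] assms[of 2] assms[of 3] by (simp_all add: power3_eq_cube)
  then show ?thesis using cmod_le[of z] by linarith
qed

text \<open>Coefficients are read as real vectors of length \<open>2 * card Q\<close>, and the
  functionals are the four rotated real parts of the value at each node. Each has squared norm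
  \<open>card Q\<close> because characters have modulus 1. The system \<open>g\<close> precedes
  \<open>c\<close> and \<open>\<rho>\<close>, so one subspace serves balls of every radius, by
  homogeneity.\<close>

lemma l2_trig_ball_width:
  fixes Q :: "(int ^ 'd) set" and L m :: nat
  assumes Q: "finite Q" "Q \<noteq> {}" and N: "\<And>k j. k \<in> Q \<Longrightarrow> \<bar>k $ j\<bar> \<le> N" "0 \<le> N"
    and L: "1 \<le> L" "4 * pi * CARD('d) * N * card Q \<le> L" and m: "1 \<le> m"
  shows "\<exists>g :: nat \<Rightarrow> int ^ 'd \<Rightarrow> complex. \<forall>c \<rho>. 0 < \<rho> \<longrightarrow> (\<Sum>k\<in>Q. (norm (c k))\<^sup>2) \<le> \<rho>\<^sup>2 \<longrightarrow>
    (\<exists>w :: nat \<Rightarrow> complex. \<forall>x\<in>period_box.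
      norm ((\<Sum>k\<in>Q. c k * fourier_char k x) - (\<Sum>l<m. w l * (\<Sum>k\<in>Q. g l k * fourier_char k x)))
        \<le> 164 * sqrt (card Q * ln (4 * (L + 1) ^ CARD('d)) / m) * \<rho>)"
proof -
  obtain \<Xi> :: "(real ^ 'd) set" where \<Xi>: "finite \<Xi>" "\<Xi> \<noteq> {}" "card \<Xi> \<le> (L + 1) ^ CARD('d)"
    and disc: "\<And>c B x. (\<And>\<xi>. \<xi> \<in> \<Xi> \<Longrightarrow> norm (\<Sum>k\<in>Q. c k * fourier_char k \<xi>) \<le> B) \<Longrightarrow> x \<in> period_box \<Longrightarrow>
      norm (\<Sum>k\<in>Q. c k * fourier_char k x) \<le> 2 * B"
    using trig_sum_discretization[OF Q(1) N L] by blast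
  define I where "I = Q \<times> (UNIV :: bool set)"
  define J where "J = \<Xi> \<times> {..<4::nat}"
  \<comment> \<open>The minus sign in the imaginary slot turns the Euclidean inner product with
    \<open>c\<close> into the real part of a complex product.\<close>
  define a where "a = (\<lambda>(\<xi> :: real ^ 'd, t :: nat) (k, b). if b then Re (\<i> ^ t * fourier_char k \<xi>) else - Im (\<i> ^ t * fourier_char k \<xi>))"
  define R where "R = sqrt (card Q)"
  define \<beta> where "\<beta> = 41 * R * sqrt (ln (card J) / m)"
  have sum_I: "(\<Sum>i\<in>I. f i) = (\<Sum>k\<in>Q. f (k, True) + f (k, False))" for f :: "_ \<Rightarrow> real"
    unfolding I_def by (simp add: sum.cartesian_product' UNIV_bool add.commute)
  have fin: "finite I" "finite J" using Q \<Xi> by (simp_all add: I_def J_def)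
  have cardJ: "card J = 4 * card \<Xi>" by (simp add: J_def card_cartesian_product)
  have card\<Xi>: "card \<Xi> \<ge> 1" using \<Xi> by (simp add: Suc_le_eq card_gt_0_iff)
  have R: "R > 0" using Q by (simp add: R_def card_gt_0_iff)
  have a: "(\<Sum>i\<in>I. (a j i)\<^sup>2) \<le> R\<^sup>2" if "j \<in> J" for j
  proof -
    obtain \<xi> t where j: "j = (\<xi>, t)" by force
    have "(\<Sum>i\<in>I. (a j i)\<^sup>2) = (\<Sum>k\<in>Q. (norm (\<i> ^ t * fourier_char k \<xi>))\<^sup>2)"
      unfolding sum_I by (simp add: j a_def cmod_power2 del: times_complex.sel)
    also have "\<dots> = R\<^sup>2" by (simp add: norm_mult norm_power R_def)
    finally show ?thesis by simp
  qed
  have "\<exists>G :: nat \<Rightarrow> (int ^ 'd) \<times> bool \<Rightarrow> real. \<forall>c. (\<Sum>i\<in>I. (c i)\<^sup>2) \<le> 1 \<longrightarrow>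
      (\<exists>w. \<forall>j\<in>J. (\<Sum>i\<in>I. (c i - (\<Sum>l<m. w l * G l i)) * a j i) \<le> \<beta>)"
    unfolding \<beta>_def using cardJ card\<Xi> by (intro euclidean_ball_width fin R m a) auto
  then obtain G :: "nat \<Rightarrow> (int ^ 'd) \<times> bool \<Rightarrow> real" where
    G: "\<And>c. (\<Sum>i\<in>I. (c i)\<^sup>2) \<le> 1 \<Longrightarrow> \<exists>w. \<forall>j\<in>J. (\<Sum>i\<in>I. (c i - (\<Sum>l<m. w l * G l i)) * a j i) \<le> \<beta>"
    by blast
  define g where "g = (\<lambda>l k. Complex (G l (k, True)) (G l (k, False)))"
  have ball: "\<exists>w :: nat \<Rightarrow> complex. \<forall>x\<in>period_box.
      norm ((\<Sum>k\<in>Q. c k * fourier_char k x) - (\<Sum>l<m. w l * (\<Sum>k\<in>Q. g l k * fourier_char k x))) \<le> 4 * \<beta>"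
    if c: "(\<Sum>k\<in>Q. (norm (c k))\<^sup>2) \<le> 1" for c
  proof -
    define c' where "c' = (\<lambda>(k :: int ^ 'd, b). if b then Re (c k) else Im (c k))"
    have "(\<Sum>i\<in>I. (c' i)\<^sup>2) = (\<Sum>k\<in>Q. (norm (c k))\<^sup>2)"
      unfolding sum_I by (simp add: c'_def cmod_power2)
    then obtain w where w: "\<And>j. j \<in> J \<Longrightarrow> (\<Sum>i\<in>I. (c' i - (\<Sum>l<m. w l * G l i)) * a j i) \<le> \<beta>"
      using G[of c'] c by auto
    define e where "e = (\<lambda>k. c k - (\<Sum>l<m. of_real (w l) * g l k))"
    have diff: "(\<Sum>k\<in>Q. c k * fourier_char k x) - (\<Sum>l<m. of_real (w l) * (\<Sum>k\<in>Q. g l k * fourier_char k x))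
        = (\<Sum>k\<in>Q. e k * fourier_char k x)" for x
    proof -
      have "(\<Sum>l<m. of_real (w l) * (\<Sum>k\<in>Q. g l k * fourier_char k x))
          = (\<Sum>k\<in>Q. (\<Sum>l<m. of_real (w l) * g l k) * fourier_char k x)"
        by (simp add: sum_distrib_left sum_distrib_right mult.assoc sum.swap[of _ Q])
      then show ?thesis by (simp add: e_def left_diff_distrib sum_subtractf)
    qed
    have node: "norm (\<Sum>k\<in>Q. e k * fourier_char k \<xi>) \<le> 2 * \<beta>" if \<xi>: "\<xi> \<in> \<Xi>" for \<xi>
    proof (rule norm_le_Re_rotations)
      fix t :: nat assume "t < 4"
      then have j: "(\<xi>, t) \<in> J" using \<xi> by (simp add: J_def)
      have e: "Re (e k) = c' (k, True) - (\<Sum>l<m. w l * G l (k, True))"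
        "Im (e k) = c' (k, False) - (\<Sum>l<m. w l * G l (k, False))" for k
        by (simp_all add: e_def c'_def g_def)
      have "Re (\<i> ^ t * (\<Sum>k\<in>Q. e k * fourier_char k \<xi>)) = (\<Sum>k\<in>Q. Re (e k * (\<i> ^ t * fourier_char k \<xi>)))"
        unfolding Re_sum[symmetric] by (simp add: sum_distrib_left mult_ac)
      also have "\<dots> = (\<Sum>i\<in>I. (c' i - (\<Sum>l<m. w l * G l i)) * a (\<xi>, t) i)"
        unfolding sum_I times_complex.sel(1)[of "e _"] e by (simp add: a_def del: times_complex.sel)
      also have "\<dots> \<le> \<beta>" by (rule w[OF j])
      finally show "Re (\<i> ^ t * (\<Sum>k\<in>Q. e k * fourier_char k \<xi>)) \<le> \<beta>" .
    qed
    have "norm ((\<Sum>k\<in>Q. c k * fourier_char k x) - (\<Sum>l<m. of_real (w l) * (\<Sum>k\<in>Q. g l k * fourier_char k x))) \<le> 4 * \<beta>"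
      if "x \<in> period_box" for x
      unfolding diff using disc[OF node that] by simp
    then show ?thesis by (intro exI[of _ "\<lambda>l. of_real (w l)"]) blast
  qed
  \<comment> \<open>164 is four times 41: a factor 2 from passing to the modulus and a factor 2 from
    passing off the grid. The 4 in the logarithm counts the rotations.\<close>
  have "4 * \<beta> \<le> 164 * sqrt (card Q * ln (4 * (L + 1) ^ CARD('d)) / m)"
  proof -
    have "card J \<le> 4 * (L + 1) ^ CARD('d)" using \<Xi>(3) by (simp add: cardJ)
    then have "real (card J) \<le> real (4 * (L + 1) ^ CARD('d))" by (rule of_nat_mono)
    then have "real (card J) \<le> 4 * (real L + 1) ^ CARD('d)" by (simp add: add.commute)
    then have "ln (card J) \<le> ln (4 * (real L + 1) ^ CARD('d))"
      using cardJ card\<Xi> by (intro ln_mono) auto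
    then have "sqrt (ln (card J) / m) \<le> sqrt (ln (4 * (real L + 1) ^ CARD('d)) / m)"
      by (simp add: divide_right_mono)
    then have "R * sqrt (ln (card J) / m) \<le> R * sqrt (ln (4 * (real L + 1) ^ CARD('d)) / m)"
      using R by (intro mult_left_mono) auto
    also have "\<dots> = sqrt (card Q * ln (4 * (real L + 1) ^ CARD('d)) / m)"
      unfolding R_def real_sqrt_mult[symmetric] by simp
    finally show ?thesis by (simp add: \<beta>_def add.commute)
  qed
  then have \<beta>: "4 * \<beta> * \<rho> \<le> 164 * sqrt (card Q * ln (4 * (L + 1) ^ CARD('d)) / m) * \<rho>" if "0 < \<rho>" for \<rho>
    using that by (intro mult_right_mono) auto
  show ?thesis
  proof (intro exI[of _ g] allI impI)
    fix c :: "int ^ 'd \<Rightarrow> complex" and \<rho> :: real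
    assume \<rho>: "0 < \<rho>" and c: "(\<Sum>k\<in>Q. (norm (c k))\<^sup>2) \<le> \<rho>\<^sup>2"
    have "(\<Sum>k\<in>Q. (norm (c k / of_real \<rho>))\<^sup>2) = (\<Sum>k\<in>Q. (norm (c k))\<^sup>2) / \<rho>\<^sup>2"
      by (simp add: norm_divide power_divide sum_divide_distrib)
    also have "\<dots> \<le> 1" using c \<rho> by (simp add: divide_le_eq)
    finally obtain w :: "nat \<Rightarrow> complex" where w: "\<And>x. x \<in> period_box \<Longrightarrow>
      norm ((\<Sum>k\<in>Q. c k / of_real \<rho> * fourier_char k x) - (\<Sum>l<m. w l * (\<Sum>k\<in>Q. g l k * fourier_char k x))) \<le> 4 * \<beta>"
      using ball[of "\<lambda>k. c k / of_real \<rho>"] by blast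
    have "norm ((\<Sum>k\<in>Q. c k * fourier_char k x) - (\<Sum>l<m. (of_real \<rho> * w l) * (\<Sum>k\<in>Q. g l k * fourier_char k x)))
       \<le> 4 * \<beta> * \<rho>" if x: "x \<in> period_box" for x
    proof -
      have "(\<Sum>k\<in>Q. c k * fourier_char k x) - (\<Sum>l<m. (of_real \<rho> * w l) * (\<Sum>k\<in>Q. g l k * fourier_char k x))
         = of_real \<rho> * ((\<Sum>k\<in>Q. c k / of_real \<rho> * fourier_char k x) - (\<Sum>l<m. w l * (\<Sum>k\<in>Q. g l k * fourier_char k x)))"
        using \<rho> by (simp add: right_diff_distrib sum_distrib_left mult.assoc)
      then show ?thesis using w[OF x] \<rho> by (simp add: norm_mult mult_left_mono mult.commute)
    qed
    then show "\<exists>w :: nat \<Rightarrow> complex. \<forall>x\<in>period_box.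
      norm ((\<Sum>k\<in>Q. c k * fourier_char k x) - (\<Sum>l<m. w l * (\<Sum>k\<in>Q. g l k * fourier_char k x)))
        \<le> 164 * sqrt (card Q * ln (4 * (L + 1) ^ CARD('d)) / m) * \<rho>"
      using \<beta>[OF \<rho>] order_trans by (intro exI[of _ "\<lambda>l. of_real \<rho> * w l"]) blast
  qed
qed

section \<open>A de la Vallee Poussin multiplier for the hyperbolic cross\<close>

text \<open>For \<open>N = 0\<close> division by zero gives the constant 1, not a sequence of finite
  support, which is why \<open>0 < N\<close> accompanies the support and positivity
  statements.\<close>

definition fejer :: "nat \<Rightarrow> int \<Rightarrow> real" where
  "fejer N m = max 0 (1 - \<bar>m\<bar> / N)"

lemma fejer_0 [simp]: "fejer N 0 = 1"
  by (simp add: fejer_def)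

lemma fejer_eq_0: "0 < N \<Longrightarrow> int N \<le> \<bar>m\<bar> \<Longrightarrow> fejer N m = 0"
  by (simp add: fejer_def field_simps flip: of_int_abs)

text \<open>Raising \<open>N\<close> by one raises every weight by one, the frequencies
  \<open>N\<close> and \<open>- N\<close> starting from weight 0, and so adds a Dirichlet sum. The
  square gains 1 and two conjugate cross sums, which form the same Dirichlet sum after reversing the
  index. The induction treats all \<open>t\<close> alike, including multiples of the period.\<close>

lemma fejer_kernel:
  fixes t :: real
  defines "E \<equiv> \<lambda>m :: int. exp (\<i> * complex_of_real (of_int m * t))"
  shows "(\<Sum>m\<in>{- int N<..<int N}. of_real (real N - \<bar>of_int m\<bar>) * E m) = of_real ((norm (\<Sum>l<N. E (int l)))\<^sup>2)"
proof (induction N)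
  case 0
  then show ?case by simp
next
  case (Suc N)
  have E: "E (m + l) = E m * E l" "cnj (E m) = E (- m)" "E 0 = 1" for m l
    by (simp_all add: E_def exp_cnj distrib_right distrib_left exp_add)
  have dirichlet: "(\<Sum>m\<in>{- int M..int M}. E m) = 1 + (\<Sum>l<M. E (int l + 1) + E (- (int l + 1)))" for M
  proof (induction M)
    case 0
    then show ?case by (simp add: E)
  next
    case (Suc M)
    have "{- int (Suc M)..int (Suc M)} = insert (int M + 1) (insert (- (int M + 1)) {- int M..int M})" by auto
    then show ?case using Suc by simp
  qed
  have "(\<Sum>m\<in>{- int (Suc N)<..<int (Suc N)}. of_real (real (Suc N) - \<bar>of_int m\<bar>) * E m)
      = (\<Sum>m\<in>{- int N..int N}. of_real (real N - \<bar>of_int m\<bar>) * E m + E m)"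
    by (intro sum.cong) (auto simp: algebra_simps)
  also have "\<dots> = (\<Sum>m\<in>{- int N..int N}. of_real (real N - \<bar>of_int m\<bar>) * E m) + (\<Sum>m\<in>{- int N..int N}. E m)"
    by (rule sum.distrib)
  finally have split: "(\<Sum>m\<in>{- int (Suc N)<..<int (Suc N)}. of_real (real (Suc N) - \<bar>of_int m\<bar>) * E m)
      = (\<Sum>m\<in>{- int N..int N}. of_real (real N - \<bar>of_int m\<bar>) * E m) + (\<Sum>m\<in>{- int N..int N}. E m)" .
  have "(\<Sum>m\<in>{- int N..int N}. of_real (real N - \<bar>of_int m\<bar>) * E m)
      = (\<Sum>m\<in>{- int N<..<int N}. of_real (real N - \<bar>of_int m\<bar>) * E m)"
    by (intro sum.mono_neutral_right) (auto simp: abs_if)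
  also have "\<dots> = of_real ((norm (\<Sum>l<N. E (int l)))\<^sup>2)" by (rule Suc.IH)
  finally have weighted: "(\<Sum>m\<in>{- int N..int N}. of_real (real N - \<bar>of_int m\<bar>) * E m)
      = of_real ((norm (\<Sum>l<N. E (int l)))\<^sup>2)" .
  have unweighted: "(\<Sum>m\<in>{- int N..int N}. E m) = 1 + (\<Sum>l<N. E (int N - int l) + E (int l - int N))"
  proof -
    have "(\<Sum>l<N. E (int l + 1) + E (- (int l + 1)))
       = (\<Sum>l<N. E (int (N - Suc l) + 1) + E (- (int (N - Suc l) + 1)))"
      by (rule sum.nat_diff_reindex[symmetric])
    also have "\<dots> = (\<Sum>l<N. E (int N - int l) + E (int l - int N))"
      by (intro sum.cong refl) (simp add: of_nat_diff algebra_simps)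
    finally show ?thesis by (simp add: dirichlet)
  qed
  have "of_real ((norm (\<Sum>l<N. E (int l)))\<^sup>2) + (1 + (\<Sum>l<N. E (int N - int l) + E (int l - int N)))
     = of_real ((norm (\<Sum>l<Suc N. E (int l)))\<^sup>2)"
  proof -
    let ?D = "\<Sum>l<N. E (int l)"
    have 1: "E (int N) * cnj (E (int N)) = 1" by (simp add: E(2,3) flip: E(1))
    have 2: "E (int N) * cnj ?D = (\<Sum>l<N. E (int N - int l))"
      by (simp add: E(2) sum_distrib_left flip: E(1))
    have 3: "?D * cnj (E (int N)) = (\<Sum>l<N. E (int l - int N))"
      by (simp add: E(2) sum_distrib_right flip: E(1))
    have "of_real ((norm (\<Sum>l<Suc N. E (int l)))\<^sup>2) = (?D + E (int N)) * cnj (?D + E (int N))"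
      unfolding complex_norm_square sum.lessThan_Suc by (rule refl)
    also have "\<dots> = ?D * cnj ?D + (E (int N) * cnj (E (int N)) + (E (int N) * cnj ?D + ?D * cnj (E (int N))))"
      by (simp only: complex_cnj_add distrib_left distrib_right add_ac)
    also have "\<dots> = of_real ((norm ?D)\<^sup>2) + (1 + (\<Sum>l<N. E (int N - int l) + E (int l - int N)))"
      unfolding 1 2 3 complex_norm_square by (simp only: sum.distrib)
    finally show ?thesis by simp
  qed
  then show ?case unfolding split weighted unweighted .
qed

lemma fejer_kernel_nonneg:
  fixes t :: real
  assumes "0 < N"
  shows "\<exists>r\<ge>0. (\<Sum>m\<in>{- int N<..<int N}. of_real (fejer N m) * exp (\<i> * complex_of_real (of_int m * t))) = of_real r"
proof -
  let ?E = "\<lambda>m :: int. exp (\<i> * complex_of_real (of_int m * t))"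
  have "(\<Sum>m\<in>{- int N<..<int N}. of_real (fejer N m) * ?E m)
      = (\<Sum>m\<in>{- int N<..<int N}. of_real (real N - \<bar>of_int m\<bar>) * ?E m) / N"
    unfolding sum_divide_distrib
  proof (intro sum.cong refl)
    fix m assume "m \<in> {- int N<..<int N}"
    then have "\<bar>real_of_int m\<bar> \<le> N" by (auto simp: abs_le_iff)
    then have "fejer N m = (N - \<bar>of_int m\<bar>) / N" using assms by (simp add: fejer_def field_simps)
    then show "of_real (fejer N m) * ?E m = of_real (real N - \<bar>of_int m\<bar>) * ?E m / N" by simp
  qed
  also have "\<dots> = of_real ((norm (\<Sum>l<N. ?E (int l)))\<^sup>2 / N)"
    unfolding fejer_kernel of_real_divide of_real_of_nat_eq ..
  finally show ?thesis by (intro exI[of _ "(norm (\<Sum>l<N. ?E (int l)))\<^sup>2 / N"]) simp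
qed

lemma vec_box_PiE:
  fixes S :: "'d::finite \<Rightarrow> 'a set"
  shows "bij_betw vec_nth {k :: 'a ^ 'd. \<forall>j. k $ j \<in> S j} (PiE UNIV S)"
  by (rule bij_betwI[of _ _ _ vec_lambda]) (auto simp: vec_lambda_inverse)

lemma finite_vec_box:
  fixes S :: "'d::finite \<Rightarrow> 'a set"
  shows "(\<And>j. finite (S j)) \<Longrightarrow> finite {k :: 'a ^ 'd. \<forall>j. k $ j \<in> S j}"
  using bij_betw_finite[OF vec_box_PiE[of S]] by (simp add: finite_PiE)

lemma card_vec_box:
  fixes S :: "'d::finite \<Rightarrow> 'a set"
  shows "card {k :: 'a ^ 'd. \<forall>j. k $ j \<in> S j} = (\<Prod>j\<in>UNIV. card (S j))"
  using bij_betw_same_card[OF vec_box_PiE[of S]] by (simp add: card_PiE)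

lemma sum_vec_box_prod:
  fixes h :: "'d::finite \<Rightarrow> 'a \<Rightarrow> 'c :: comm_semiring_1"
  assumes "\<And>j. finite (S j)"
  shows "(\<Sum>k\<in>{k :: 'a ^ 'd. \<forall>j. k $ j \<in> S j}. \<Prod>j\<in>UNIV. h j (k $ j)) = (\<Prod>j\<in>UNIV. \<Sum>m\<in>S j. h j m)"
  using assms by (simp add: prod_sum_PiE sum.reindex_bij_betw[OF vec_box_PiE, of "\<lambda>g. \<Prod>j\<in>UNIV. h j (g j)"])

text \<open>The symbol is restricted to an explicit finite set \<open>Q\<close>, so that operators
  with different symbols live on a common set and add linearly in \<open>\<phi>\<close>.\<close>

definition multiplier :: "(int ^ 'd) set \<Rightarrow> (int ^ 'd \<Rightarrow> real) \<Rightarrow> (real ^ 'd \<Rightarrow> complex) \<Rightarrow> real ^ 'd \<Rightarrow> complex" where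
  "multiplier Q \<phi> f x = (\<Sum>k\<in>Q. of_real (\<phi> k) * fourier_coeff f k * fourier_char k x)"

lemma multiplier_sum: "multiplier Q (\<lambda>k. \<Sum>i\<in>I. a i * \<phi> i k) f x = (\<Sum>i\<in>I. of_real (a i) * multiplier Q (\<phi> i) f x)"
  unfolding multiplier_def of_real_sum sum_distrib_left sum_distrib_right
  by (subst sum.swap) (simp add: mult_ac)

text \<open>The operator is convolution with a product of one-dimensional Fejer kernels. That kernel
  is nonnegative with mean 1, hence has \<open>L\<^sub>1\<close> norm 1 and does not increase a
  uniform bound.\<close>

lemma norm_multiplier_fejer_le:
  fixes f :: "real ^ 'd \<Rightarrow> complex" and N :: "'d \<Rightarrow> nat"
  assumes N: "\<And>j. 0 < N j" and Q: "finite Q" "{k. \<forall>j. \<bar>k $ j\<bar> < int (N j)} \<subseteq> Q"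
    and f: "f \<in> borel_measurable borel" "\<And>x. norm (f x) \<le> A"
  shows "norm (multiplier Q (\<lambda>k. \<Prod>j\<in>UNIV. fejer (N j) (k $ j)) f x) \<le> A"
proof -
  let ?M = "torus_measure :: (real ^ 'd) measure"
  interpret prob_space ?M by (rule prob_space_torus)
  define \<Phi> where "\<Phi> = (\<lambda>k :: int ^ 'd. \<Prod>j\<in>UNIV. fejer (N j) (k $ j))"
  define K where "K = (\<lambda>y. \<Sum>k\<in>Q. of_real (\<Phi> k) * fourier_char k y)"
  define S where "S = (\<lambda>j. {- int (N j)<..<int (N j)})"
  note [measurable] = f(1)
  have A: "A \<ge> 0" using f(2)[of 0] norm_ge_zero order_trans by blast
  have boxS: "{k. \<forall>j. \<bar>k $ j\<bar> < int (N j)} = {k. \<forall>j. k $ j \<in> S j}" by (auto simp: S_def abs_less_iff minus_less_iff)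
  have K_nonneg: "\<exists>r\<ge>0. K y = of_real r" for y
  proof -
    \<comment> \<open>The symbol vanishes on \<open>Q\<close> outside the box, and only over a box
      does the sum factorise over the coordinates.\<close>
    have "K y = (\<Sum>k\<in>{k. \<forall>j. k $ j \<in> S j}. of_real (\<Phi> k) * fourier_char k y)"
      unfolding K_def
    proof (rule sum.mono_neutral_right[OF Q(1)])
      show "\<forall>k\<in>Q - {k. \<forall>j. k $ j \<in> S j}. of_real (\<Phi> k) * fourier_char k y = 0"
      proof
        fix k assume "k \<in> Q - {k. \<forall>j. k $ j \<in> S j}"
        then obtain j where "k $ j \<notin> S j" by blast
        then have "int (N j) \<le> \<bar>k $ j\<bar>" by (auto simp: S_def abs_if)
        then have "fejer (N j) (k $ j) = 0" using N by (intro fejer_eq_0)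
        then have "\<Phi> k = 0" unfolding \<Phi>_def by (intro prod_zero) auto
        then show "of_real (\<Phi> k) * fourier_char k y = 0" by simp
      qed
    qed (use Q(2) boxS in auto)
    also have "\<dots> = (\<Sum>k\<in>{k. \<forall>j. k $ j \<in> S j}.
        \<Prod>j\<in>UNIV. of_real (fejer (N j) (k $ j)) * exp (\<i> * complex_of_real (of_int (k $ j) * y $ j)))"
      by (simp add: \<Phi>_def fourier_char_def prod.distrib sum_distrib_left exp_sum)
    also have "\<dots> = (\<Prod>j\<in>UNIV. \<Sum>m\<in>S j. of_real (fejer (N j) m) * exp (\<i> * complex_of_real (of_int m * y $ j)))"
      by (rule sum_vec_box_prod) (simp add: S_def)
    finally have K: "K y = \<dots>" .
    have "\<forall>j. \<exists>r\<ge>0. (\<Sum>m\<in>S j. of_real (fejer (N j) m) * exp (\<i> * complex_of_real (of_int m * y $ j))) = of_real r"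
      unfolding S_def using fejer_kernel_nonneg N by blast
    then obtain r where r: "\<And>j. r j \<ge> 0"
      "\<And>j. (\<Sum>m\<in>S j. of_real (fejer (N j) m) * exp (\<i> * complex_of_real (of_int m * y $ j))) = of_real (r j)"
      by metis
    have "K y = of_real (\<Prod>j\<in>UNIV. r j)" unfolding K r(2) by simp
    then show ?thesis using r(1) by (intro exI[of _ "\<Prod>j\<in>UNIV. r j"]) (simp add: prod_nonneg)
  qed
  have K_norm: "of_real (norm (K y)) = K y" for y using K_nonneg[of y] by auto
  define C where "C = (\<Sum>k\<in>Q. norm (of_real (\<Phi> k) :: complex))"
  have Kx: "K (x - y) = (\<Sum>k\<in>Q. of_real (\<Phi> k) * fourier_char k x * cnj (fourier_char k y))" for y
    by (simp add: K_def fourier_char_diff_right mult.assoc)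
  have Km [measurable]: "(\<lambda>y. K (x - y)) \<in> borel_measurable borel"
    unfolding Kx by measurable
  have KC: "norm (K y) \<le> C" for y unfolding K_def C_def by (rule norm_trig_sum_le)
  have C: "C \<ge> 0" by (simp add: C_def sum_nonneg)
  have int: "integrable ?M (\<lambda>y. K (x - y))" by (rule integrable_torus_bounded[OF Km KC])
  have one: "(\<integral>y. cnj (fourier_char k y) \<partial>?M) = (if k = 0 then 1 else 0)" for k :: "int ^ 'd"
    using integral_fourier_char[of "- k"] by (simp add: fourier_char_minus)
  have "(\<integral>y. K (x - y) \<partial>?M) = (\<Sum>k\<in>Q. \<integral>y. of_real (\<Phi> k) * fourier_char k x * cnj (fourier_char k y) \<partial>?M)"
    unfolding Kx
    by (intro Bochner_Integration.integral_sum integrable_mult_right integrable_mult_fourier_char(2)[of "\<lambda>_. 1" 1, unfolded mult_1_left]) auto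
  also have "\<dots> = (\<Sum>k\<in>Q. if k = 0 then 1 else 0)"
    unfolding integral_mult_right_zero one by (intro sum.cong) (auto simp: \<Phi>_def)
  also have "\<dots> = 1" using Q N by auto
  finally have total: "(\<integral>y. K (x - y) \<partial>?M) = 1" .
  have "of_real (\<integral>y. norm (K (x - y)) \<partial>?M) = (\<integral>y. of_real (norm (K (x - y))) \<partial>?M :: complex)" by simp
  then have total': "(\<integral>y. norm (K (x - y)) \<partial>?M) = 1"
    unfolding K_norm total by (metis of_real_1 of_real_eq_iff)
  have "multiplier Q \<Phi> f x = (\<Sum>k\<in>Q. \<integral>y. of_real (\<Phi> k) * fourier_char k x * (f y * cnj (fourier_char k y)) \<partial>?M)"
    unfolding multiplier_def fourier_coeff_def integral_mult_right_zero by (simp add: mult_ac)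
  also have "\<dots> = (\<integral>y. (\<Sum>k\<in>Q. of_real (\<Phi> k) * fourier_char k x * (f y * cnj (fourier_char k y))) \<partial>?M)"
    by (intro Bochner_Integration.integral_sum[symmetric] integrable_mult_right integrable_mult_fourier_char(2)[OF f])
  also have "\<dots> = (\<integral>y. f y * K (x - y) \<partial>?M)"
    by (simp add: Kx sum_distrib_left mult_ac)
  finally have "norm (multiplier Q \<Phi> f x) \<le> (\<integral>y. norm (f y * K (x - y)) \<partial>?M)"
    by (simp only: integral_norm_bound)
  also have "\<dots> \<le> (\<integral>y. A * norm (K (x - y)) \<partial>?M)"
  proof (rule integral_mono)
    show "integrable ?M (\<lambda>y. norm (f y * K (x - y)))"
      by (rule integrable_torus_bounded[of _ "A * C"]) (use f KC A in \<open>auto simp: norm_mult intro!: mult_mono\<close>)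
    show "integrable ?M (\<lambda>y. A * norm (K (x - y)))" using int by simp
    show "norm (f y * K (x - y)) \<le> A * norm (K (x - y))" for y
      using f(2)[of y] by (simp add: norm_mult mult_right_mono)
  qed
  also have "\<dots> = A" by (simp add: total')
  finally show ?thesis by (simp add: \<Phi>_def)
qed

text \<open>Two Fejer sequences make a de la Vallee Poussin sequence, and three make a difference of
  consecutive ones. Fixing the number at three, padded with coefficient 0, gives products over the
  coordinates a common index set for expansion. \<open>M\<close> records the support.\<close>

definition fejer_comb :: "real \<Rightarrow> nat \<Rightarrow> (int \<Rightarrow> real) \<Rightarrow> bool" where
  "fejer_comb b M \<phi> \<longleftrightarrow> (\<exists>\<alpha> N. \<phi> = (\<lambda>m. \<Sum>i<3::nat. \<alpha> i * fejer (N i) m) \<and>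
    (\<Sum>i<3. \<bar>\<alpha> i\<bar>) \<le> b \<and> (\<forall>i<3. 0 < N i \<and> N i \<le> M))"

lemma fejer_comb_eq_0: "fejer_comb b M \<phi> \<Longrightarrow> int M \<le> \<bar>m\<bar> \<Longrightarrow> \<phi> m = 0"
  unfolding fejer_comb_def by (fastforce intro!: sum.neutral fejer_eq_0)

text \<open>The product expands into \<open>3 ^ d\<close> tensor products of Fejer symbols, each a
  contraction, and the absolute values of their coefficients sum to a product of the one-dimensional
  sums.\<close>

lemma norm_multiplier_fejer_comb_le:
  fixes f :: "real ^ 'd \<Rightarrow> complex" and \<phi> :: "'d \<Rightarrow> int \<Rightarrow> real"
  assumes \<phi>: "\<And>j. fejer_comb b (M j) (\<phi> j)" and Q: "finite Q" "{k. \<forall>j. \<bar>k $ j\<bar> < int (M j)} \<subseteq> Q"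
    and f: "f \<in> borel_measurable borel" "\<And>x. norm (f x) \<le> A"
  shows "norm (multiplier Q (\<lambda>k. \<Prod>j\<in>UNIV. \<phi> j (k $ j)) f x) \<le> b ^ CARD('d) * A"
proof -
  have A: "A \<ge> 0" using f(2)[of 0] norm_ge_zero order_trans by blast
  have "\<forall>j. \<exists>\<alpha> N. \<phi> j = (\<lambda>m. \<Sum>i<3::nat. \<alpha> i * fejer (N i) m) \<and> (\<Sum>i<3. \<bar>\<alpha> i\<bar>) \<le> b \<and> (\<forall>i<3. 0 < N i \<and> N i \<le> M j)"
    using \<phi> by (simp add: fejer_comb_def)
  from choice[OF this] obtain \<alpha> :: "'d \<Rightarrow> nat \<Rightarrow> real" where
    "\<forall>j. \<exists>N. \<phi> j = (\<lambda>m. \<Sum>i<3. \<alpha> j i * fejer (N i) m) \<and> (\<Sum>i<3. \<bar>\<alpha> j i\<bar>) \<le> b \<and> (\<forall>i<3. 0 < N i \<and> N i \<le> M j)"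
    by blast
  from choice[OF this] obtain N :: "'d \<Rightarrow> nat \<Rightarrow> nat"
    where eq: "\<And>j. \<phi> j = (\<lambda>m. \<Sum>i<3. \<alpha> j i * fejer (N j i) m)"
      and b: "\<And>j. (\<Sum>i<3. \<bar>\<alpha> j i\<bar>) \<le> b" and N: "\<And>j i. i < 3 \<Longrightarrow> 0 < N j i" "\<And>j i. i < 3 \<Longrightarrow> N j i \<le> M j"
    by blast
  let ?I = "PiE (UNIV :: 'd set) (\<lambda>_. {..<3::nat})"
  have "(\<lambda>k :: int ^ 'd. \<Prod>j\<in>UNIV. \<phi> j (k $ j))
      = (\<lambda>k. \<Sum>\<iota>\<in>?I. (\<Prod>j\<in>UNIV. \<alpha> j (\<iota> j)) * (\<Prod>j\<in>UNIV. fejer (N j (\<iota> j)) (k $ j)))"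
    by (simp add: eq prod_sum_PiE prod.distrib)
  then have "norm (multiplier Q (\<lambda>k. \<Prod>j\<in>UNIV. \<phi> j (k $ j)) f x)
      = norm (\<Sum>\<iota>\<in>?I. of_real (\<Prod>j\<in>UNIV. \<alpha> j (\<iota> j)) * multiplier Q (\<lambda>k. \<Prod>j\<in>UNIV. fejer (N j (\<iota> j)) (k $ j)) f x)"
    by (simp only: multiplier_sum)
  also have "\<dots> \<le> (\<Sum>\<iota>\<in>?I. (\<Prod>j\<in>UNIV. \<bar>\<alpha> j (\<iota> j)\<bar>) * A)"
  proof (intro norm_sum[THEN order_trans] sum_mono)
    fix \<iota> assume \<iota>: "\<iota> \<in> ?I"
    have less: "\<iota> j < 3" for j using PiE_mem[OF \<iota>, of j] by simp
    have sub: "{k. \<forall>j. \<bar>k $ j\<bar> < int (N j (\<iota> j))} \<subseteq> Q"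
      using N(2)[OF less] by (intro order_trans[OF _ Q(2)] Collect_mono) (auto intro: order_less_le_trans)
    have "norm (multiplier Q (\<lambda>k. \<Prod>j\<in>UNIV. fejer (N j (\<iota> j)) (k $ j)) f x) \<le> A"
      using less N sub by (intro norm_multiplier_fejer_le Q f) auto
    then show "norm (of_real (\<Prod>j\<in>UNIV. \<alpha> j (\<iota> j)) * multiplier Q (\<lambda>k. \<Prod>j\<in>UNIV. fejer (N j (\<iota> j)) (k $ j)) f x)
        \<le> (\<Prod>j\<in>UNIV. \<bar>\<alpha> j (\<iota> j)\<bar>) * A"
      by (simp only: norm_mult norm_of_real abs_prod) (intro mult_left_mono prod_nonneg, auto)
  qed
  also have "\<dots> = (\<Prod>j\<in>UNIV. \<Sum>i<3. \<bar>\<alpha> j i\<bar>) * A"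
    by (simp add: prod_sum_PiE sum_distrib_right)
  also have "\<dots> \<le> (\<Prod>j\<in>(UNIV :: 'd set). b) * A"
    using b A by (intro mult_right_mono prod_mono) (auto simp: sum_nonneg)
  finally show ?thesis by simp
qed

section \<open>De la Vallee Poussin sequences and dyadic blocks\<close>

definition vallee_poussin :: "nat \<Rightarrow> int \<Rightarrow> real" where
  "vallee_poussin s m = 2 * fejer (2 ^ (s + 1)) m - fejer (2 ^ s) m"

lemma vallee_poussin_eq: "vallee_poussin s m = min 1 (max 0 (2 - \<bar>m\<bar> / 2 ^ s))"
proof -
  define u where "u = \<bar>real_of_int m\<bar> / 2 ^ s"
  have "u \<ge> 0" by (simp add: u_def)
  moreover have "fejer (2 ^ (s + 1)) m = max 0 (1 - u / 2)" "fejer (2 ^ s) m = max 0 (1 - u)"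
    by (simp_all add: fejer_def u_def)
  moreover have "min 1 (max 0 (2 - \<bar>m\<bar> / 2 ^ s)) = min 1 (max 0 (2 - u))" by (simp add: u_def)
  ultimately show ?thesis
    by (simp add: vallee_poussin_def min_def max_def)
qed

lemma vallee_poussin_bounds: "0 \<le> vallee_poussin s m" "vallee_poussin s m \<le> 1"
  by (auto simp: vallee_poussin_eq)

lemma vallee_poussin_eq_1:
  assumes "\<bar>m\<bar> \<le> 2 ^ s"
  shows "vallee_poussin s m = 1"
proof -
  have "\<bar>real_of_int m\<bar> \<le> 2 ^ s" using assms by (metis of_int_abs of_int_le_iff of_int_numeral of_int_power)
  then have "1 \<le> 2 - \<bar>real_of_int m\<bar> / 2 ^ s" by (simp add: divide_le_eq)
  then show ?thesis unfolding vallee_poussin_eq of_int_abs by (intro min_absorb1 max.coboundedI2)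
qed

lemma vallee_poussin_mono: "s \<le> s' \<Longrightarrow> vallee_poussin s m \<le> vallee_poussin s' m"
  unfolding vallee_poussin_eq of_int_abs
  by (intro min.mono max.mono diff_left_mono divide_left_mono order_refl) (auto intro: power_increasing)

definition vallee_poussin_block :: "nat \<Rightarrow> int \<Rightarrow> real" where
  "vallee_poussin_block s m =
    (if s = 0 then vallee_poussin 0 m else vallee_poussin s m - vallee_poussin (s - 1) m)"

lemma vallee_poussin_block_nonneg: "0 \<le> vallee_poussin_block s m"
  by (simp add: vallee_poussin_block_def vallee_poussin_bounds vallee_poussin_mono)

text \<open>A smooth block of level \<open>s\<close> is a difference of two trapezoids that both
  equal 1 up to \<open>2 ^ (s - 1)\<close>, so it does not see frequencies of lower level.\<close>

lemma vallee_poussin_block_eq_0: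
  assumes "\<bar>m\<bar> < 2 ^ t" "t < s"
  shows "vallee_poussin_block s m = 0"
proof -
  have "(2::int) ^ t \<le> 2 ^ (s - 1)" "(2::int) ^ t \<le> 2 ^ s" using assms by (auto intro!: power_increasing)
  then have "vallee_poussin (s - 1) m = 1" "vallee_poussin s m = 1"
    using assms by (intro vallee_poussin_eq_1; linarith)+
  then show ?thesis using assms by (simp add: vallee_poussin_block_def)
qed

lemma sum_vallee_poussin_block: "(\<Sum>s\<le>n. vallee_poussin_block s m) = vallee_poussin n m"
  by (induction n) (simp_all add: vallee_poussin_block_def)

lemma fejer_comb_vallee_poussin: "fejer_comb 6 (2 ^ (s + 1)) (vallee_poussin s)"
  unfolding fejer_comb_def
  by (intro exI[of _ "(!) [2, -1, 0]"] exI[of _ "(!) [2 ^ (s + 1), 2 ^ s, 2 ^ s]"])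
     (auto simp: fun_eq_iff vallee_poussin_def numeral_3_eq_3 less_Suc_eq)

lemma fejer_comb_vallee_poussin_block: "fejer_comb 6 (2 ^ (s + 1)) (vallee_poussin_block s)"
proof (cases s)
  case 0
  then have "vallee_poussin_block s = vallee_poussin s" by (auto simp: vallee_poussin_block_def)
  then show ?thesis using fejer_comb_vallee_poussin[of s] by simp
next
  case (Suc r)
  then show ?thesis unfolding fejer_comb_def
    by (intro exI[of _ "(!) [2, -3, 1]"] exI[of _ "(!) [2 ^ (r + 2), 2 ^ (r + 1), 2 ^ r]"])
       (auto simp: fun_eq_iff vallee_poussin_block_def vallee_poussin_def numeral_3_eq_3 less_Suc_eq)
qed

section \<open>The multiplier of the hyperbolic cross and its spectrum\<close>

text \<open>The multiplier telescopes in every coordinate except \<open>i\<close>, whose level is filled up so that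
  the levels sum to \<open>n\<close>. Hence it has only about \<open>n ^ (d - 1)\<close> terms, while the full sum over
  all blocks with \<open>\<parallel>s\<parallel>\<^sub>1 \<le> n\<close> has about \<open>n ^ d\<close>.\<close>

definition levels :: "'d::finite \<Rightarrow> nat \<Rightarrow> ('d \<Rightarrow> nat) set" where
  "levels i n = {s \<in> PiE (UNIV - {i}) (\<lambda>_. {..n}). (\<Sum>j\<in>UNIV - {i}. s j) \<le> n}"

definition fill_level :: "'d::finite \<Rightarrow> nat \<Rightarrow> ('d \<Rightarrow> nat) \<Rightarrow> 'd \<Rightarrow> nat" where
  "fill_level i n s j = (if j = i then n - (\<Sum>j\<in>UNIV - {i}. s j) else s j)"

definition cross_factor :: "'d::finite \<Rightarrow> nat \<Rightarrow> ('d \<Rightarrow> nat) \<Rightarrow> 'd \<Rightarrow> int \<Rightarrow> real" where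
  "cross_factor i n s j =
    (if j = i then vallee_poussin (fill_level i n s i) else vallee_poussin_block (s j))"

definition cross_multiplier :: "'d::finite \<Rightarrow> nat \<Rightarrow> int ^ 'd \<Rightarrow> real" where
  "cross_multiplier i n k = (\<Sum>s\<in>levels i n. \<Prod>j\<in>UNIV. cross_factor i n s j (k $ j))"

definition level_box :: "'d::finite \<Rightarrow> nat \<Rightarrow> ('d \<Rightarrow> nat) \<Rightarrow> (int ^ 'd) set" where
  "level_box i n s = {k. \<forall>j. \<bar>k $ j\<bar> < 2 ^ (fill_level i n s j + 1)}"

definition enlarged_cross :: "'d::finite \<Rightarrow> nat \<Rightarrow> (int ^ 'd) set" where
  "enlarged_cross i n = (\<Union>s\<in>levels i n. level_box i n s)"

lemma finite_levels: "finite (levels i n)"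
  unfolding levels_def by (rule finite_subset[of _ "PiE (UNIV - {i}) (\<lambda>_. {..n})"]) (auto intro: finite_PiE)

lemma card_levels: "card (levels (i :: 'd::finite) n) \<le> (n + 1) ^ (CARD('d) - 1)"
proof -
  have "card (levels i n) \<le> card (PiE (UNIV - {i}) (\<lambda>_. {..n}))"
    unfolding levels_def by (intro card_mono finite_PiE) auto
  then show ?thesis by (simp add: card_PiE)
qed

lemma sum_fill_level:
  assumes "s \<in> levels i n"
  shows "(\<Sum>j\<in>UNIV. fill_level i n s j) = n"
proof -
  have "(\<Sum>j\<in>UNIV. fill_level i n s j) = fill_level i n s i + (\<Sum>j\<in>UNIV - {i}. fill_level i n s j)"
    by (rule sum.remove) auto
  also have "(\<Sum>j\<in>UNIV - {i}. fill_level i n s j) = (\<Sum>j\<in>UNIV - {i}. s j)"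
    by (intro sum.cong) (auto simp: fill_level_def)
  finally show ?thesis using assms by (simp add: levels_def fill_level_def)
qed

lemma fejer_comb_cross_factor: "fejer_comb 6 (2 ^ (fill_level i n s j + 1)) (cross_factor i n s j)"
  using fejer_comb_vallee_poussin fejer_comb_vallee_poussin_block by (simp add: cross_factor_def fill_level_def)

lemma level_box_alt: "level_box i n s = {k. \<forall>j. k $ j \<in> {- (2 ^ (fill_level i n s j + 1))<..<2 ^ (fill_level i n s j + 1)}}"
  by (auto simp: level_box_def abs_less_iff minus_less_iff)

lemma finite_level_box: "finite (level_box i n s)"
  unfolding level_box_alt by (rule finite_vec_box) simp

text \<open>Because the filled levels sum to exactly \<open>n\<close>, every box has the same order
  of size, whatever \<open>s\<close> is.\<close>

lemma card_level_box:
  assumes "s \<in> levels (i :: 'd::finite) n"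
  shows "card (level_box i n s) \<le> 4 ^ CARD('d) * 2 ^ n"
proof -
  have "card (level_box i n s) \<le> (\<Prod>j\<in>UNIV. 4 * 2 ^ fill_level i n s j)"
    unfolding level_box_alt card_vec_box
  proof (intro prod_mono conjI)
    fix j
    have "nat (2 ^ (fill_level i n s j + 1) - (- (2 ^ (fill_level i n s j + 1)) + 1)) \<le> nat (int (4 * 2 ^ fill_level i n s j))"
      by (intro nat_mono) simp
    then show "card {- ((2::int) ^ (fill_level i n s j + 1))<..<2 ^ (fill_level i n s j + 1)} \<le> 4 * 2 ^ fill_level i n s j"
      unfolding card_greaterThanLessThan_int nat_int .
  qed simp
  also have "\<dots> = 4 ^ CARD('d) * 2 ^ (\<Sum>j\<in>UNIV. fill_level i n s j)"
    by (simp add: prod.distrib power_sum)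
  finally show ?thesis by (simp add: sum_fill_level[OF assms])
qed

lemma finite_enlarged_cross: "finite (enlarged_cross i n)"
  unfolding enlarged_cross_def using finite_levels finite_level_box by blast

lemma card_enlarged_cross:
  "card (enlarged_cross (i :: 'd::finite) n) \<le> (n + 1) ^ (CARD('d) - 1) * (4 ^ CARD('d) * 2 ^ n)"
proof -
  have "card (enlarged_cross i n) \<le> (\<Sum>s\<in>levels i n. card (level_box i n s))"
    unfolding enlarged_cross_def by (rule card_UN_le[OF finite_levels])
  also have "\<dots> \<le> (\<Sum>s\<in>levels i n. 4 ^ CARD('d) * 2 ^ n)" by (intro sum_mono card_level_box)
  also have "\<dots> \<le> (n + 1) ^ (CARD('d) - 1) * (4 ^ CARD('d) * 2 ^ n)"
    using card_levels by (simp add: mult_right_mono)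
  finally show ?thesis .
qed

lemma enlarged_cross_bound:
  assumes "k \<in> enlarged_cross i n"
  shows "\<bar>k $ j\<bar> \<le> 2 ^ (n + 1)"
proof -
  obtain s where s: "s \<in> levels i n" "k \<in> level_box i n s" using assms by (auto simp: enlarged_cross_def)
  have "fill_level i n s j \<le> (\<Sum>j\<in>UNIV. fill_level i n s j)" by (rule member_le_sum) auto
  then have "fill_level i n s j \<le> n" by (simp add: sum_fill_level[OF s(1)])
  then have "(2::int) ^ (fill_level i n s j + 1) \<le> 2 ^ (n + 1)" by (intro power_increasing) auto
  moreover have "\<bar>k $ j\<bar> < 2 ^ (fill_level i n s j + 1)" using s(2) by (simp add: level_box_def)
  ultimately show ?thesis by linarith
qed

lemma cross_multiplier_support:
  assumes "cross_multiplier i n k \<noteq> 0"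
  shows "k \<in> enlarged_cross i n"
proof -
  obtain s where s: "s \<in> levels i n" "(\<Prod>j\<in>UNIV. cross_factor i n s j (k $ j)) \<noteq> 0"
    using assms unfolding cross_multiplier_def by (meson sum.neutral)
  have "\<bar>k $ j\<bar> < 2 ^ (fill_level i n s j + 1)" for j
  proof (rule ccontr)
    assume "\<not> ?thesis"
    then have "cross_factor i n s j (k $ j) = 0"
      using fejer_comb_eq_0[OF fejer_comb_cross_factor[of i n s j], of "k $ j"] by (simp add: not_less)
    then show False using s(2) by (metis UNIV_I finite prod_zero)
  qed
  then show ?thesis using s(1) by (auto simp: enlarged_cross_def level_box_def)
qed

lemma cross_factor_nonneg: "0 \<le> cross_factor i n s j m"
  by (simp add: cross_factor_def vallee_poussin_bounds vallee_poussin_block_nonneg)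

lemma prod_cross_factor:
  "(\<Prod>j\<in>UNIV. cross_factor i n s j (k $ j))
    = vallee_poussin (fill_level i n s i) (k $ i) * (\<Prod>j\<in>UNIV - {i}. vallee_poussin_block (s j) (k $ j))"
proof -
  have "(\<Prod>j\<in>UNIV. cross_factor i n s j (k $ j))
      = cross_factor i n s i (k $ i) * (\<Prod>j\<in>UNIV - {i}. cross_factor i n s j (k $ j))"
    by (rule prod.remove) auto
  also have "(\<Prod>j\<in>UNIV - {i}. cross_factor i n s j (k $ j)) = (\<Prod>j\<in>UNIV - {i}. vallee_poussin_block (s j) (k $ j))"
    by (intro prod.cong) (auto simp: cross_factor_def)
  finally show ?thesis by (simp add: cross_factor_def)
qed

lemma sum_prod_blocks:
  "(\<Sum>s\<in>PiE (UNIV - {i}) (\<lambda>_. {..n}). \<Prod>j\<in>UNIV - {i}. vallee_poussin_block (s j) (k $ j))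
    = (\<Prod>j\<in>UNIV - {i}. vallee_poussin n (k $ j))"
  by (subst prod_sum_PiE[symmetric]) (simp_all add: sum_vallee_poussin_block)

text \<open>All terms are nonnegative, so for the upper bound the trapezoid in coordinate
  \<open>i\<close> may be replaced by 1 and the sum enlarged to all level vectors; it then
  telescopes into a product of trapezoids.\<close>

lemma cross_multiplier_bounds: "0 \<le> cross_multiplier i n k" "cross_multiplier i n k \<le> 1"
proof -
  show "0 \<le> cross_multiplier i n k"
    unfolding cross_multiplier_def by (intro sum_nonneg prod_nonneg) (simp add: cross_factor_nonneg)
  have "cross_multiplier i n k \<le> (\<Sum>s\<in>levels i n. \<Prod>j\<in>UNIV - {i}. vallee_poussin_block (s j) (k $ j))"
    unfolding cross_multiplier_def prod_cross_factor
    by (intro sum_mono mult_left_le_one_le prod_nonneg) (simp_all add: vallee_poussin_bounds vallee_poussin_block_nonneg)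
  also have "\<dots> \<le> (\<Sum>s\<in>PiE (UNIV - {i}) (\<lambda>_. {..n}). \<Prod>j\<in>UNIV - {i}. vallee_poussin_block (s j) (k $ j))"
    by (intro sum_mono2 finite_PiE prod_nonneg) (auto simp: levels_def vallee_poussin_block_nonneg)
  also have "\<dots> \<le> 1"
    unfolding sum_prod_blocks by (intro prod_le_1) (simp add: vallee_poussin_bounds)
  finally show "cross_multiplier i n k \<le> 1" .
qed

text \<open>Let \<open>t\<close> be the level vector of \<open>k\<close>. Terms with
  \<open>t $ j < s j\<close> for some \<open>j \<noteq> i\<close> vanish. In the others the filled
  level is at least \<open>t $ i\<close>, so the trapezoid in coordinate \<open>i\<close> equals 1.
  The missing level vectors also contribute zero, and the completed sum telescopes to a product of
  ones.\<close>

lemma cross_multiplier_eq_1: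
  fixes k :: "int ^ 'd"
  assumes "k \<in> hyperbolic_cross n"
  shows "cross_multiplier i n k = 1"
proof -
  obtain t :: "nat ^ 'd" where t: "(\<Sum>j\<in>UNIV. t $ j) \<le> n" "\<And>j. \<bar>k $ j\<bar> < 2 ^ (t $ j)"
    using assms by (auto simp: hyperbolic_cross_def dyadic_block_def)
  have tsum: "t $ i + (\<Sum>j\<in>UNIV - {i}. t $ j) \<le> n"
    using t(1) by (subst (asm) sum.remove[of _ i]) auto
  have zero: "(\<Prod>j\<in>UNIV - {i}. vallee_poussin_block (s j) (k $ j)) = 0"
    if "j \<noteq> i" "t $ j < s j" for s j
    using that vallee_poussin_block_eq_0[OF t(2) that(2)] by (intro prod_zero) auto
  have "cross_multiplier i n k = (\<Sum>s\<in>levels i n. \<Prod>j\<in>UNIV - {i}. vallee_poussin_block (s j) (k $ j))"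
    unfolding cross_multiplier_def prod_cross_factor
  proof (intro sum.cong refl)
    fix s assume s: "s \<in> levels i n"
    show "vallee_poussin (fill_level i n s i) (k $ i) * (\<Prod>j\<in>UNIV - {i}. vallee_poussin_block (s j) (k $ j))
        = (\<Prod>j\<in>UNIV - {i}. vallee_poussin_block (s j) (k $ j))"
    proof (cases "\<exists>j. j \<noteq> i \<and> t $ j < s j")
      case True
      then show ?thesis using zero by auto
    next
      case False
      then have "(\<Sum>j\<in>UNIV - {i}. s j) \<le> (\<Sum>j\<in>UNIV - {i}. t $ j)" by (intro sum_mono) (auto simp: not_less)
      then have "t $ i \<le> fill_level i n s i" using tsum by (simp add: fill_level_def)
      then have "(2::int) ^ (t $ i) \<le> 2 ^ fill_level i n s i" by (intro power_increasing) auto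
      then have "vallee_poussin (fill_level i n s i) (k $ i) = 1"
        using t(2)[of i] by (intro vallee_poussin_eq_1) linarith
      then show ?thesis by simp
    qed
  qed
  also have "\<dots> = (\<Sum>s\<in>PiE (UNIV - {i}) (\<lambda>_. {..n}). \<Prod>j\<in>UNIV - {i}. vallee_poussin_block (s j) (k $ j))"
  proof (rule sum.mono_neutral_left)
    show "finite (PiE (UNIV - {i}) (\<lambda>_. {..n}))" by (intro finite_PiE) auto
    show "levels i n \<subseteq> PiE (UNIV - {i}) (\<lambda>_. {..n})" by (auto simp: levels_def)
  next
    show "\<forall>s\<in>PiE (UNIV - {i}) (\<lambda>_. {..n}) - levels i n.
        (\<Prod>j\<in>UNIV - {i}. vallee_poussin_block (s j) (k $ j)) = 0"
    proof
      fix s assume s: "s \<in> PiE (UNIV - {i}) (\<lambda>_. {..n}) - levels i n"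
      then have "\<not> (\<Sum>j\<in>UNIV - {i}. s j) \<le> n" unfolding levels_def by blast
      then have large: "n < (\<Sum>j\<in>UNIV - {i}. s j)" by simp
      have "\<exists>j. j \<noteq> i \<and> t $ j < s j"
      proof (rule ccontr)
        assume "\<not> ?thesis"
        then have "(\<Sum>j\<in>UNIV - {i}. s j) \<le> (\<Sum>j\<in>UNIV - {i}. t $ j)" by (intro sum_mono) (auto simp: not_less)
        then show False using large tsum by linarith
      qed
      then show "(\<Prod>j\<in>UNIV - {i}. vallee_poussin_block (s j) (k $ j)) = 0" using zero by auto
    qed
  qed
  also have "\<dots> = 1"
    unfolding sum_prod_blocks
  proof (intro prod.neutral ballI vallee_poussin_eq_1)
    fix j
    have "t $ j \<le> (\<Sum>j\<in>UNIV. t $ j)" by (rule member_le_sum) auto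
    then have "(2::int) ^ (t $ j) \<le> 2 ^ n" using t(1) by (intro power_increasing) auto
    then show "\<bar>k $ j\<bar> \<le> 2 ^ n" using t(2)[of j] by linarith
  qed
  finally show ?thesis .
qed

lemma hyperbolic_cross_subset: "hyperbolic_cross n \<subseteq> enlarged_cross (i :: 'd::finite) n"
proof
  fix k :: "int ^ 'd" assume "k \<in> hyperbolic_cross n"
  then have "cross_multiplier i n k = 1" by (rule cross_multiplier_eq_1)
  then show "k \<in> enlarged_cross i n" by (intro cross_multiplier_support) simp
qed

lemma norm_cross_multiplier_le:
  fixes f :: "real ^ 'd \<Rightarrow> complex"
  assumes f: "f \<in> borel_measurable borel" "\<And>x. norm (f x) \<le> A"
  shows "norm (multiplier (enlarged_cross i n) (cross_multiplier i n) f x)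
    \<le> (real n + 1) ^ (CARD('d) - 1) * (6 ^ CARD('d) * A)"
proof -
  let ?T = "\<lambda>s. multiplier (enlarged_cross i n) (\<lambda>k. \<Prod>j\<in>UNIV. cross_factor i n s j (k $ j)) f x"
  have A: "A \<ge> 0" using f(2)[of 0] norm_ge_zero order_trans by blast
  have "multiplier (enlarged_cross i n) (cross_multiplier i n) f x = (\<Sum>s\<in>levels i n. ?T s)"
    using multiplier_sum[of "enlarged_cross i n" "\<lambda>_. 1" "\<lambda>s k. \<Prod>j\<in>UNIV. cross_factor i n s j (k $ j)" "levels i n" f x]
    by (simp add: cross_multiplier_def[abs_def])
  also have "norm \<dots> \<le> (\<Sum>s\<in>levels i n. 6 ^ CARD('d) * A)"
  proof (intro norm_sum[THEN order_trans] sum_mono)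
    fix s assume "s \<in> levels i n"
    then have "{k. \<forall>j. \<bar>k $ j\<bar> < int (2 ^ (fill_level i n s j + 1))} \<subseteq> enlarged_cross i n"
      by (auto simp: enlarged_cross_def level_box_def)
    then show "norm (?T s) \<le> 6 ^ CARD('d) * A"
      by (intro norm_multiplier_fejer_comb_le[OF fejer_comb_cross_factor] finite_enlarged_cross f)
  qed
  also have "\<dots> = real (card (levels i n)) * (6 ^ CARD('d) * A)" by simp
  also have "\<dots> \<le> (real n + 1) ^ (CARD('d) - 1) * (6 ^ CARD('d) * A)"
  proof (intro mult_right_mono)
    have "real (card (levels i n)) \<le> real ((n + 1) ^ (CARD('d) - 1))" by (rule of_nat_mono[OF card_levels])
    then show "real (card (levels i n)) \<le> (real n + 1) ^ (CARD('d) - 1)" by (simp add: add.commute)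
  qed (use A in simp)
  finally show ?thesis .
qed

section \<open>Kolmogorov widths\<close>

text \<open>The number of frequencies is at most of order \<open>2 ^ n * n ^ (d - 1)\<close> and the
  logarithm of the grid size at most of order \<open>n\<close>; their product is the quantity under
  the root. \<open>C\<close> depends only on the dimension.\<close>

lemma enlarged_cross_ball_width:
  fixes i :: "'d::finite"
  shows "\<exists>C>0. \<forall>n\<ge>1. \<forall>m. \<exists>g :: nat \<Rightarrow> int ^ 'd \<Rightarrow> complex. \<forall>c \<rho>. 0 < \<rho> \<longrightarrow>
    (\<Sum>k\<in>enlarged_cross i n. (norm (c k))\<^sup>2) \<le> \<rho>\<^sup>2 \<longrightarrow>
    (\<exists>w :: nat \<Rightarrow> complex. \<forall>x\<in>period_box.
      norm ((\<Sum>k\<in>enlarged_cross i n. c k * fourier_char k x)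
          - (\<Sum>l<m. w l * (\<Sum>k\<in>enlarged_cross i n. g l k * fourier_char k x)))
        \<le> C * sqrt (2 ^ n * real n ^ CARD('d) / real (max m 1)) * \<rho>)"
proof -
  define d where "d = CARD('d)"
  have d: "1 \<le> d" by (simp add: d_def Suc_le_eq)
  \<comment> \<open>Anticipates the \<open>L\<close> chosen below: in
    \<open>4 * (2 * L) ^ d\<close>, which dominates \<open>4 * (L + 1) ^ d\<close>, \<open>M\<close>
    collects the factors free of \<open>n\<close>. Then \<open>a * n\<close> bounds the
    logarithm.\<close>
  define M where "M = 4 * (52 * real d * 4 ^ d) ^ d"
  define a where "a = ln M + real ((d + 1) * d)"
  have "1 \<le> 52 * real d * 4 ^ d" using d by (intro mult_ge1_I) auto
  then have M: "4 \<le> M" by (simp add: M_def)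
  have "1 \<le> ln (4::real)" by (rule order_trans[OF _ ln_mono[of "exp 1"]]) (use exp_le in auto)
  also have "\<dots> \<le> ln M" using M by simp
  finally have "1 \<le> ln M" .
  moreover have "0 \<le> real ((d + 1) * d)" by (rule of_nat_0_le_iff)
  ultimately have a: "1 \<le> a" unfolding a_def by linarith
  define C where "C = 164 * sqrt (8 ^ d * a)"
  have C: "C > 0" using a by (simp add: C_def)
  have "\<exists>g :: nat \<Rightarrow> int ^ 'd \<Rightarrow> complex. \<forall>c \<rho>. 0 < \<rho> \<longrightarrow>
      (\<Sum>k\<in>enlarged_cross i n. (norm (c k))\<^sup>2) \<le> \<rho>\<^sup>2 \<longrightarrow>
      (\<exists>w :: nat \<Rightarrow> complex. \<forall>x\<in>period_box.
        norm ((\<Sum>k\<in>enlarged_cross i n. c k * fourier_char k x)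
            - (\<Sum>l<m. w l * (\<Sum>k\<in>enlarged_cross i n. g l k * fourier_char k x)))
          \<le> C * sqrt (2 ^ n * real n ^ d / real (max m 1)) * \<rho>)" if n: "1 \<le> n" for n m
  proof -
    define Q where "Q = enlarged_cross i n"
    define K where "K = card Q"
    have Q: "finite Q" unfolding Q_def by (rule finite_enlarged_cross)
    have "(0 :: int ^ 'd) \<in> dyadic_block 0" by (simp add: dyadic_block_def)
    then have "(0 :: int ^ 'd) \<in> hyperbolic_cross n"
      unfolding hyperbolic_cross_def by (intro UN_I[of "0 :: nat ^ 'd"]) auto
    then have ne: "Q \<noteq> {}" using hyperbolic_cross_subset unfolding Q_def by blast
    have K: "K \<le> (n + 1) ^ (d - 1) * (4 ^ d * 2 ^ n)"
      unfolding K_def Q_def d_def by (rule card_enlarged_cross)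
    have Kn: "K \<le> 8 ^ d * 2 ^ n * n ^ (d - 1)"
    proof -
      have "(n + 1) ^ (d - 1) \<le> (2 * n) ^ (d - 1)" using n by (intro power_mono) auto
      also have "\<dots> \<le> 2 ^ d * n ^ (d - 1)" by (simp add: power_mult_distrib power_increasing)
      finally have "K \<le> (2 ^ d * n ^ (d - 1)) * (4 ^ d * 2 ^ n)" using K by (meson mult_le_mono1 order_trans)
      also have "\<dots> = (2 * 4) ^ d * 2 ^ n * n ^ (d - 1)" unfolding power_mult_distrib by (simp only: mult_ac)
      finally show ?thesis by simp
    qed
    \<comment> \<open>This cruder bound only fixes the grid size \<open>L\<close>, where a power of
      two suffices; the factor \<open>n ^ (d - 1)\<close> of \<open>Kn\<close> is what counts in the
      final estimate.\<close>
    have K2: "K \<le> 4 ^ d * 2 ^ (n * d)"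
    proof -
      have "n + 1 \<le> 2 ^ n" using Suc_leI[OF less_exp[of n]] by (simp only: Suc_eq_plus1)
      then have "(n + 1) ^ (d - 1) \<le> (2 ^ n) ^ (d - 1)" by (intro power_mono) auto
      then have "K \<le> (2 ^ n) ^ (d - 1) * (4 ^ d * 2 ^ n)" using K by (meson mult_le_mono1 order_trans)
      also have "\<dots> = 4 ^ d * ((2 ^ n) * (2 ^ n) ^ (d - 1))" by (simp only: mult_ac)
      also have "(2 ^ n) * (2 ^ n) ^ (d - 1) = ((2::nat) ^ n) ^ d" using d by (simp flip: power_Suc)
      finally show ?thesis by (simp add: power_mult)
    qed
    \<comment> \<open>The constant 26 is 13 for \<open>4 * pi\<close>, doubled because the
      frequencies reach up to \<open>2 ^ (n + 1)\<close>.\<close>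
    define L where "L = 26 * d * 4 ^ d * 2 ^ (n * (d + 1))"
    have L1: "1 \<le> L" using d by (simp add: L_def Suc_le_eq)
    have L2: "4 * pi * d * real_of_int (2 ^ (n + 1)) * K \<le> L"
    proof -
      have "4 * pi * d * real_of_int (2 ^ (n + 1)) * K = 4 * pi * (d * (2 ^ (n + 1) * real K))" by simp
      also have "\<dots> \<le> 13 * (real d * (2 ^ (n + 1) * (4 ^ d * 2 ^ (n * d))))"
      proof (intro mult_mono mult_left_mono)
        show "4 * pi \<le> 13" using pi_less_4 pi_approx by simp
        show "real K \<le> 4 ^ d * 2 ^ (n * d)" using of_nat_mono[OF K2, where ?'a = real] by simp
      qed auto
      also have "\<dots> = L" by (simp add: L_def power_add algebra_simps)
      finally show ?thesis .
    qed
    have lnL: "ln (4 * (L + 1) ^ d) \<le> a * n"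
    proof -
      have "(1 + real L) ^ d \<le> (2 * real L) ^ d" using L1 by (intro power_mono) auto
      then have "real (4 * (L + 1) ^ d) \<le> 4 * (2 * real L) ^ d" by simp
      also have "2 * real L = (52 * real d * 4 ^ d) * 2 ^ (n * (d + 1))" by (simp add: L_def)
      also have "4 * ((52 * real d * 4 ^ d) * 2 ^ (n * (d + 1))) ^ d = M * 2 ^ (n * ((d + 1) * d))"
        unfolding power_mult_distrib[of _ "2 ^ (n * (d + 1))"] power_mult[symmetric] mult.assoc[of n]
        by (simp only: M_def mult.assoc)
      finally have "ln (4 * (L + 1) ^ d) \<le> ln (M * 2 ^ (n * ((d + 1) * d)))"
        by (intro ln_mono) auto
      also have "\<dots> = ln M + n * real ((d + 1) * d) * ln 2"
        using M by (simp add: ln_mult ln_realpow)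
      also have "\<dots> \<le> n * ln M + n * real ((d + 1) * d) * 1"
        using n M ln_2_less_1 by (intro add_mono mult_left_mono) auto
      finally show ?thesis by (simp add: a_def algebra_simps)
    qed
    have target: "164 * sqrt (K * X / q) \<le> C * sqrt (2 ^ n * real n ^ d / q)" if "X \<le> a * n" "0 < q" "0 \<le> X" for X q :: real
    proof -
      have "K * X / q \<le> (8 ^ d * 2 ^ n * real n ^ (d - 1)) * (a * n) / q"
        using that of_nat_mono[OF Kn, where ?'a = real] by (intro divide_right_mono mult_mono) auto
      also have "\<dots> = (8 ^ d * a) * (2 ^ n * (n * real n ^ (d - 1)) / q)" by simp
      also have "n * real n ^ (d - 1) = real n ^ d" using d by (simp flip: power_Suc)
      finally have "sqrt (K * X / q) \<le> sqrt (8 ^ d * a) * sqrt (2 ^ n * real n ^ d / q)"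
        unfolding real_sqrt_mult[symmetric] by simp
      then show ?thesis by (simp add: C_def)
    qed
    show ?thesis
    proof (cases "m = 0")
      case False
      then have m: "1 \<le> m" "max m 1 = m" by auto
      have "0 < 4 * (L + 1) ^ CARD('d)" by simp
      then have "1 \<le> real (4 * (L + 1) ^ CARD('d))" by linarith
      then have "ln (4 * (L + 1) ^ CARD('d)) \<ge> 0" by (rule ln_ge_zero)
      then have le: "164 * sqrt (card Q * ln (4 * (L + 1) ^ CARD('d)) / m) \<le> C * sqrt (2 ^ n * real n ^ d / m)"
        using target[of "ln (4 * (L + 1) ^ d)" m] lnL m by (simp add: K_def d_def)
      have "\<bar>k $ j\<bar> \<le> 2 ^ (n + 1)" if "k \<in> Q" for k j using enlarged_cross_bound that unfolding Q_def by blast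
      from l2_trig_ball_width[OF Q ne this _ L1 L2[unfolded d_def K_def] m(1)]
      obtain g where g: "\<And>c \<rho>. 0 < \<rho> \<Longrightarrow> (\<Sum>k\<in>Q. (norm (c k))\<^sup>2) \<le> \<rho>\<^sup>2 \<Longrightarrow>
        \<exists>w :: nat \<Rightarrow> complex. \<forall>x\<in>period_box.
          norm ((\<Sum>k\<in>Q. c k * fourier_char k x) - (\<Sum>l<m. w l * (\<Sum>k\<in>Q. g l k * fourier_char k x)))
            \<le> 164 * sqrt (card Q * ln (4 * (L + 1) ^ CARD('d)) / m) * \<rho>"
        by auto
      show ?thesis
      proof (intro exI[of _ g] allI impI)
        fix c :: "int ^ 'd \<Rightarrow> complex" and \<rho> :: real
        assume \<rho>: "0 < \<rho>" and "(\<Sum>k\<in>enlarged_cross i n. (norm (c k))\<^sup>2) \<le> \<rho>\<^sup>2"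
        with g[of \<rho> c] obtain w where w: "\<And>x. x \<in> period_box \<Longrightarrow>
          norm ((\<Sum>k\<in>Q. c k * fourier_char k x) - (\<Sum>l<m. w l * (\<Sum>k\<in>Q. g l k * fourier_char k x)))
            \<le> 164 * sqrt (card Q * ln (4 * (L + 1) ^ CARD('d)) / m) * \<rho>"
          unfolding Q_def by blast
        have "164 * sqrt (card Q * ln (4 * (L + 1) ^ CARD('d)) / m) * \<rho> \<le> C * sqrt (2 ^ n * real n ^ d / m) * \<rho>"
          using le \<rho> by (intro mult_right_mono) auto
        with w show "\<exists>w :: nat \<Rightarrow> complex. \<forall>x\<in>period_box.
          norm ((\<Sum>k\<in>enlarged_cross i n. c k * fourier_char k x)
            - (\<Sum>l<m. w l * (\<Sum>k\<in>enlarged_cross i n. g l k * fourier_char k x)))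
          \<le> C * sqrt (2 ^ n * real n ^ d / real (max m 1)) * \<rho>"
          unfolding Q_def[symmetric] m(2) by (intro exI[of _ w]) (blast intro: order_trans)
      qed
    next
      \<comment> \<open>Without approximating functions Cauchy-Schwarz gives
        \<open>sqrt K * \<rho>\<close>, which fits the same bound because
        \<open>1 \<le> a * n\<close>.\<close>
      case True
      have bound: "norm (\<Sum>k\<in>Q. c k * fourier_char k x) \<le> C * sqrt (2 ^ n * real n ^ d) * \<rho>"
        if \<rho>: "0 < \<rho>" and c: "(\<Sum>k\<in>Q. (norm (c k))\<^sup>2) \<le> \<rho>\<^sup>2" for c \<rho> x
      proof -
        have "norm (\<Sum>k\<in>Q. c k * fourier_char k x) \<le> (\<Sum>k\<in>Q. norm (c k) * 1)"
          using norm_trig_sum_le by simp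
        also have "\<dots> \<le> L2_set (\<lambda>k. norm (c k)) Q * L2_set (\<lambda>_. 1) Q" by (rule sum_mult_le_L2_set)
        also have "\<dots> \<le> \<rho> * sqrt K"
          using c \<rho> by (intro mult_mono) (auto simp: L2_set_def K_def real_le_lsqrt sum_nonneg)
        also have "\<dots> = 1 * sqrt (real K * 1 / 1) * \<rho>" by simp
        also have "\<dots> \<le> 164 * sqrt (real K * 1 / 1) * \<rho>" using \<rho> by (intro mult_right_mono) auto
        also have "\<dots> \<le> C * sqrt (2 ^ n * real n ^ d / 1) * \<rho>"
          using \<rho> a n mult_mono[of 1 a 1 "real n"] by (intro mult_right_mono target) auto
        finally show ?thesis by simp
      qed
      then show ?thesis unfolding Q_def using True by auto
    qed
  qed
  then show ?thesis using C unfolding d_def by blast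
qed

section \<open>Upper estimates for widths in the uniform norm\<close>

lemma Linf_norm_le:
  assumes "f \<in> borel_measurable borel" "\<And>x. x \<in> period_box \<Longrightarrow> norm (f x) \<le> B"
  shows "Linf_norm f \<le> ennreal B"
  unfolding Linf_norm_def
proof (rule esssup_I)
  show "(\<lambda>x. ennreal (norm (f x))) \<in> borel_measurable torus_measure"
    using assms(1) by (intro borel_measurable_torus) measurable
  show "AE x in torus_measure. ennreal (norm (f x)) \<le> ennreal B"
    by (rule eventually_mono[OF AE_torus]) (auto intro: ennreal_leI assms(2))
qed

lemma trig_sum_in_Linf:
  fixes Q :: "(int ^ 'd) set"
  shows "(\<lambda>x. \<Sum>k\<in>Q. c k * fourier_char k x) \<in> Linf"
proof -
  have m: "(\<lambda>x. \<Sum>k\<in>Q. c k * fourier_char k x) \<in> borel_measurable borel" by measurable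
  have "fourier_char k (x + axis j (2 * pi)) = fourier_char k x" for k :: "int ^ 'd" and x j
    using torus_periodic_fourier_char unfolding torus_periodic_def by blast
  then have "torus_periodic (\<lambda>x. \<Sum>k\<in>Q. c k * fourier_char k x)"
    by (simp add: torus_periodic_def)
  moreover have "Linf_norm (\<lambda>x. \<Sum>k\<in>Q. c k * fourier_char k x) \<le> ennreal (\<Sum>k\<in>Q. norm (c k))"
    by (intro Linf_norm_le m norm_trig_sum_le)
  then have "Linf_norm (\<lambda>x. \<Sum>k\<in>Q. c k * fourier_char k x) < \<infinity>"
    by (rule order_le_less_trans) simp
  ultimately show ?thesis unfolding Linf_def using borel_measurable_torus[OF m] by blast
qed

text \<open>Covers both branches of the definition: for \<open>m = 0\<close> the approximating sum
  is empty, otherwise the index is shifted by one.\<close>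

lemma kolmogorov_width_le:
  assumes u: "\<And>l. l < m \<Longrightarrow> u l \<in> X"
    and approx: "\<And>f. f \<in> F \<Longrightarrow> \<exists>w :: nat \<Rightarrow> complex. N (\<lambda>x. f x - (\<Sum>l<m. w l * u l x)) \<le> B"
  shows "kolmogorov_width m F X N \<le> B"
proof (cases "m = 0")
  case True
  then show ?thesis using approx by (auto simp: kolmogorov_width_def intro!: SUP_least)
next
  case False
  let ?u = "\<lambda>i. u (i - 1)"
  have "(SUP f\<in>F. INF c. N (\<lambda>x. f x - (\<Sum>i=1..m. c i * ?u i x))) \<le> B"
  proof (rule SUP_least)
    fix f assume "f \<in> F"
    then obtain w where w: "N (\<lambda>x. f x - (\<Sum>l<m. w l * u l x)) \<le> B" using approx by blast
    have "(\<Sum>i=1..m. w (i - 1) * ?u i x) = (\<Sum>l<m. w l * u l x)" for x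
      by (simp add: sum.atLeast1_atMost_eq)
    with w show "(INF c. N (\<lambda>x. f x - (\<Sum>i=1..m. c i * ?u i x))) \<le> B"
      by (intro INF_lower2[of "\<lambda>i. w (i - 1)"]) simp_all
  qed
  moreover have "?u \<in> {u. \<forall>i\<in>{1..m}. u i \<in> X}" using u by auto
  ultimately show ?thesis
    using False by (auto simp: kolmogorov_width_def intro: INF_lower2)
qed

lemma kolmogorov_width_mono: "F \<subseteq> G \<Longrightarrow> kolmogorov_width m F X N \<le> kolmogorov_width m G X N"
  unfolding kolmogorov_width_def by (auto intro!: SUP_subset_mono INF_mono)

lemma trig_poly_ball_mono:
  assumes "Q \<subseteq> Q'" "finite Q'"
  shows "trig_poly_ball Q p \<subseteq> trig_poly_ball Q' p"
proof -
  have "trig_poly Q \<subseteq> trig_poly Q'"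
  proof
    fix f assume "f \<in> trig_poly Q"
    then obtain c where f: "f = (\<lambda>x. \<Sum>k\<in>Q. c k * fourier_char k x)"
      unfolding trig_poly_def fourier_char_def by blast
    have "(\<Sum>k\<in>Q. c k * fourier_char k x) = (\<Sum>k\<in>Q'. (if k \<in> Q then c k else 0) * fourier_char k x)" for x
      using assms by (intro sum.mono_neutral_cong_left) auto
    then show "f \<in> trig_poly Q'" unfolding trig_poly_def fourier_char_def[symmetric] f
      by (intro CollectI exI[of _ "\<lambda>k. if k \<in> Q then c k else 0"]) auto
  qed
  then show ?thesis by (auto simp: trig_poly_ball_def)
qed

section \<open>Truncation and the passage to general exponents\<close>

lemma norm_square_le_powr:
  fixes y A p :: real
  assumes "0 < A" "A < y" "2 \<le> p"
  shows "y\<^sup>2 \<le> A powr (2 - p) * y powr p"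
proof -
  have "y\<^sup>2 = y powr (2 - p) * y powr p" using assms by (simp flip: powr_add)
  also have "\<dots> \<le> A powr (2 - p) * y powr p"
    using assms by (intro mult_right_mono powr_mono2') auto
  finally show ?thesis .
qed

text \<open>The numbers \<open>c k\<close> are the coefficients of \<open>V h\<close>, so the
  remainder is \<open>V g\<close>. Bessel's inequality bounds the former through the square integral
  of \<open>h\<close>, the uniform estimate for \<open>V\<close> the latter.\<close>

lemma cross_ball_decomposition:
  fixes f :: "real ^ 'd \<Rightarrow> complex"
  assumes p: "2 \<le> p" and f: "f \<in> trig_poly_ball (hyperbolic_cross n) p" and A: "0 < A"
  shows "\<exists>c. (\<Sum>k\<in>enlarged_cross i n. (norm (c k))\<^sup>2) \<le> (A powr (1 - p / 2))\<^sup>2 \<and>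
    (\<forall>x. norm (f x - (\<Sum>k\<in>enlarged_cross i n. c k * fourier_char k x))
      \<le> (real n + 1) ^ (CARD('d) - 1) * (6 ^ CARD('d) * A))"
proof -
  let ?M = "torus_measure :: (real ^ 'd) measure"
  interpret prob_space ?M by (rule prob_space_torus)
  let ?Q = "enlarged_cross i n" and ?H = "hyperbolic_cross n :: (int ^ 'd) set"
  let ?V = "cross_multiplier i n"
  have Q: "finite ?Q" by (rule finite_enlarged_cross)
  have HQ: "?H \<subseteq> ?Q" by (rule hyperbolic_cross_subset)
  have H: "finite ?H" by (rule finite_subset[OF HQ Q])
  obtain c where fc: "f = (\<lambda>x. \<Sum>k\<in>?H. c k * fourier_char k x)"
    using f unfolding trig_poly_ball_def trig_poly_def fourier_char_def by blast
  have fm [measurable]: "f \<in> borel_measurable borel" unfolding fc by measurable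
  define B where "B = (\<Sum>k\<in>?H. norm (c k))"
  have fB: "norm (f x) \<le> B" for x unfolding fc B_def by (rule norm_trig_sum_le)
  have B: "B \<ge> 0" by (simp add: B_def sum_nonneg)
  define g where "g = (\<lambda>x. if norm (f x) \<le> A then f x else 0)"
  define h where "h = (\<lambda>x. if norm (f x) \<le> A then 0 else f x)"
  have gm [measurable]: "g \<in> borel_measurable borel" unfolding g_def by measurable
  have hm [measurable]: "h \<in> borel_measurable borel" unfolding h_def by measurable
  have gA: "norm (g x) \<le> A" for x using A by (simp add: g_def)
  have hB: "norm (h x) \<le> B" for x using fB[of x] B by (simp add: h_def)
  have fgh: "f x = g x + h x" for x by (simp add: g_def h_def)
  have coeff: "fourier_coeff f k = fourier_coeff g k + fourier_coeff h k" for k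
    unfolding fourier_coeff_def fgh distrib_right
    by (intro Bochner_Integration.integral_add integrable_mult_fourier_char(2)[OF gm gA] integrable_mult_fourier_char(2)[OF hm hB])
  have "f x = multiplier ?Q ?V f x" for x
  proof -
    have "multiplier ?Q ?V f x = (\<Sum>k\<in>?H. of_real (?V k) * fourier_coeff f k * fourier_char k x)"
      unfolding multiplier_def
    proof (rule sum.mono_neutral_right[OF Q HQ], rule ballI)
      fix k assume "k \<in> ?Q - ?H"
      then have "fourier_coeff f k = 0" unfolding fc using fourier_coeff_trig_sum[OF H] by simp
      then show "of_real (?V k) * fourier_coeff f k * fourier_char k x = 0" by simp
    qed
    also have "\<dots> = (\<Sum>k\<in>?H. c k * fourier_char k x)"
    proof (rule sum.cong[OF refl])
      fix k assume k: "k \<in> ?H"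
      have "fourier_coeff f k = c k" unfolding fc using fourier_coeff_trig_sum[OF H] k by simp
      then show "of_real (?V k) * fourier_coeff f k * fourier_char k x = c k * fourier_char k x"
        by (simp add: cross_multiplier_eq_1[OF k])
    qed
    finally show ?thesis by (simp add: fc)
  qed
  also have "multiplier ?Q ?V f x = multiplier ?Q ?V g x + multiplier ?Q ?V h x" for x
    unfolding multiplier_def coeff by (simp add: distrib_left distrib_right sum.distrib)
  finally have split: "f x - multiplier ?Q ?V h x = multiplier ?Q ?V g x" for x by (simp add: algebra_simps)
  \<comment> \<open>The norm is a \<open>p\<close>-th root, and a root at most 1 forces the integral
    itself to be at most 1.\<close>
  have int_le: "(\<integral>x. norm (f x) powr p \<partial>?M) \<le> 1"
  proof (rule ccontr)
    assume "\<not> ?thesis"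
    then have "1 < (\<integral>x. norm (f x) powr p \<partial>?M) powr (1 / p)" using p by (intro gr_one_powr) auto
    then show False using f by (simp add: trig_poly_ball_def Lp_norm_def)
  qed
  have "(\<Sum>k\<in>?Q. (norm (of_real (?V k) * fourier_coeff h k))\<^sup>2) \<le> (\<Sum>k\<in>?Q. (norm (fourier_coeff h k))\<^sup>2)"
    using cross_multiplier_bounds[of i n]
    by (intro sum_mono power_mono) (auto simp: norm_mult intro!: mult_left_le_one_le)
  also have "\<dots> \<le> (\<integral>x. (norm (h x))\<^sup>2 \<partial>?M)" by (rule bessel_inequality[OF Q hm hB])
  also have "\<dots> \<le> (\<integral>x. A powr (2 - p) * norm (f x) powr p \<partial>?M)"
  proof (rule integral_mono)
    show "integrable ?M (\<lambda>x. (norm (h x))\<^sup>2)"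
      by (rule integrable_torus_bounded[of _ "B\<^sup>2"]) (use hB in \<open>auto intro!: power_mono\<close>)
    have "integrable ?M (\<lambda>x. norm (f x) powr p)"
      by (rule integrable_torus_bounded[of _ "B powr p"]) (use fB p in \<open>auto intro!: powr_mono2\<close>)
    then show "integrable ?M (\<lambda>x. A powr (2 - p) * norm (f x) powr p)" by simp
    show "(norm (h x))\<^sup>2 \<le> A powr (2 - p) * norm (f x) powr p" for x
      using norm_square_le_powr[OF A _ p, of "norm (f x)"] by (simp add: h_def)
  qed
  also have "\<dots> = A powr (2 - p) * (\<integral>x. norm (f x) powr p \<partial>?M)" by simp
  also have "\<dots> \<le> A powr (2 - p)" using int_le by (intro mult_right_le_one_le) auto
  also have "\<dots> = (A powr (1 - p / 2))\<^sup>2" using A by (simp add: power2_eq_square flip: powr_add)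
  finally have "(\<Sum>k\<in>?Q. (norm (of_real (?V k) * fourier_coeff h k))\<^sup>2) \<le> (A powr (1 - p / 2))\<^sup>2" .
  moreover have "norm (f x - (\<Sum>k\<in>?Q. of_real (?V k) * fourier_coeff h k * fourier_char k x))
      \<le> (real n + 1) ^ (CARD('d) - 1) * (6 ^ CARD('d) * A)" for x
    using split[of x] norm_cross_multiplier_le[OF gm gA] by (simp add: multiplier_def)
  ultimately show ?thesis by (intro exI[of _ "\<lambda>k. of_real (?V k) * fourier_coeff h k"]) blast
qed

text \<open>The truncation level \<open>A\<close> balances the two error terms of the main theorem.\<close>

lemma truncation_level_balance:
  fixes a \<nu> p \<delta> :: real
  assumes "0 < a" "0 < \<nu>" "0 < p"
  defines "A \<equiv> (a * \<nu> powr (2 - \<delta>)) powr (1 / p)"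
  shows "\<nu> powr (\<delta> - 1) * A = a powr (1 / p) * \<nu> powr ((\<delta> - 1) * (1 - 1 / p) + 1 / p)"
    and "sqrt (a * \<nu> powr \<delta>) * A powr (1 - p / 2) = a powr (1 / p) * \<nu> powr ((\<delta> - 1) * (1 - 1 / p) + 1 / p)"
proof -
  \<comment> \<open>\<open>A\<close> solves \<open>\<nu> powr (\<delta> - 1) * A = sqrt (a * \<nu>
    powr \<delta>) * A powr (1 - p / 2)\<close>, that is,
    \<open>A powr p = a * \<nu> powr (2 - \<delta>)\<close>.\<close>
  have A: "A = a powr (1 / p) * \<nu> powr ((2 - \<delta>) / p)"
    using assms by (simp add: A_def powr_mult powr_powr)
  have e: "\<delta> - 1 + (2 - \<delta>) / p = (\<delta> - 1) * (1 - 1 / p) + 1 / p"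
    using assms by (simp add: field_simps)
  show "\<nu> powr (\<delta> - 1) * A = a powr (1 / p) * \<nu> powr ((\<delta> - 1) * (1 - 1 / p) + 1 / p)"
    unfolding A e[symmetric] powr_add by simp
  have "sqrt (a * \<nu> powr \<delta>) = a powr (1 / 2) * \<nu> powr (\<delta> / 2)"
    using assms by (simp add: powr_half_sqrt[symmetric] powr_mult powr_powr)
  moreover have "A powr (1 - p / 2) = a powr (1 / p * (1 - p / 2)) * \<nu> powr ((2 - \<delta>) / p * (1 - p / 2))"
    unfolding A using assms by (simp add: powr_mult powr_powr)
  ultimately have "sqrt (a * \<nu> powr \<delta>) * A powr (1 - p / 2)
      = a powr (1 / 2 + 1 / p * (1 - p / 2)) * \<nu> powr (\<delta> / 2 + (2 - \<delta>) / p * (1 - p / 2))"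
    unfolding powr_add by simp
  also have "1 / 2 + 1 / p * (1 - p / 2) = 1 / p" using assms by (simp add: field_simps)
  also have "\<delta> / 2 + (2 - \<delta>) / p * (1 - p / 2) = \<delta> - 1 + (2 - \<delta>) / p" using assms by (simp add: field_simps)
  finally show "sqrt (a * \<nu> powr \<delta>) * A powr (1 - p / 2) = a powr (1 / p) * \<nu> powr ((\<delta> - 1) * (1 - 1 / p) + 1 / p)"
    by (simp only: e)
qed

theorem lemma2p1:
  fixes p :: real
  assumes "2 \<le> p"
  shows "\<exists>C::real. C > 0 \<and> (\<forall>n::nat. n \<ge> 1 \<longrightarrow> (\<forall>m::nat.
    kolmogorov_width m (trig_poly_ball (hyperbolic_layer n :: (int ^ 'd) set) p) Linf Linf_norm
      \<le> ennreal (C * (2 ^ n / real (max m 1)) powr (1 / p)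
                   * real n powr ((real CARD('d) - 1) * (1 - 1 / p) + 1 / p)) \<and>
    kolmogorov_width m (trig_poly_ball (hyperbolic_cross n :: (int ^ 'd) set) p) Linf Linf_norm
      \<le> ennreal (C * (2 ^ n / real (max m 1)) powr (1 / p)
                   * real n powr ((real CARD('d) - 1) * (1 - 1 / p) + 1 / p))))"
proof -
  \<comment> \<open>Any coordinate may be the one whose level is filled up.\<close>
  define i :: 'd where "i = undefined"
  define d where "d = CARD('d)"
  have d: "1 \<le> d" by (simp add: d_def Suc_le_eq)
  obtain C0 where C0: "0 < C0" and width: "\<And>n m. 1 \<le> n \<Longrightarrow> \<exists>g :: nat \<Rightarrow> int ^ 'd \<Rightarrow> complex. \<forall>c \<rho>. 0 < \<rho> \<longrightarrow>
    (\<Sum>k\<in>enlarged_cross i n. (norm (c k))\<^sup>2) \<le> \<rho>\<^sup>2 \<longrightarrow>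
    (\<exists>w :: nat \<Rightarrow> complex. \<forall>x\<in>period_box.
      norm ((\<Sum>k\<in>enlarged_cross i n. c k * fourier_char k x)
          - (\<Sum>l<m. w l * (\<Sum>k\<in>enlarged_cross i n. g l k * fourier_char k x)))
        \<le> C0 * sqrt (2 ^ n * real n ^ CARD('d) / real (max m 1)) * \<rho>)"
    using enlarged_cross_ball_width[of i] by blast
  \<comment> \<open>In the truncation part, 12 is 6 from the Fejer combinations times 2 from
    \<open>n + 1 \<le> 2 * n\<close>; \<open>C0\<close> belongs to the quadratic ball.\<close>
  define C where "C = 12 ^ d + C0"
  have "kolmogorov_width m (trig_poly_ball (hyperbolic_cross n :: (int ^ 'd) set) p) Linf Linf_norm
      \<le> ennreal (C * (2 ^ n / real (max m 1)) powr (1 / p)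
                   * real n powr ((real CARD('d) - 1) * (1 - 1 / p) + 1 / p))"
    if n: "1 \<le> n" for n m
  proof -
    define Q where "Q = enlarged_cross i n"
    define a where "a = 2 ^ n / real (max m 1)"
    define A where "A = (a * real n powr (2 - real d)) powr (1 / p)"
    define E where "E = a powr (1 / p) * real n powr ((real d - 1) * (1 - 1 / p) + 1 / p)"
    have pos: "0 < a" "0 < real n" "0 < p" using n assms by (auto simp: a_def)
    then have A: "0 < A" by (simp add: A_def)
    note balance = truncation_level_balance[OF pos, of "real d", folded A_def E_def]
    have trunc: "(real n + 1) ^ (d - 1) * (6 ^ d * A) \<le> 12 ^ d * E"
    proof -
      have "(real n + 1) ^ (d - 1) \<le> (2 * real n) ^ (d - 1)" using n by (intro power_mono) auto
      also have "\<dots> \<le> 2 ^ d * real n ^ (d - 1)"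
        by (simp add: power_mult_distrib power_increasing mult_right_mono)
      finally have "(real n + 1) ^ (d - 1) * (6 ^ d * A) \<le> 2 ^ d * real n ^ (d - 1) * (6 ^ d * A)"
        using A by (intro mult_right_mono) auto
      also have "\<dots> = (2 * 6) ^ d * (real n ^ (d - 1) * A)"
        unfolding power_mult_distrib by (simp only: mult_ac)
      also have "real n ^ (d - 1) = real n powr (real d - 1)"
        using pos d by (simp add: of_nat_diff flip: powr_realpow)
      finally show ?thesis by (simp add: balance)
    qed
    have ball: "sqrt (2 ^ n * real n ^ d / real (max m 1)) * A powr (1 - p / 2) = E"
      using balance(2) pos by (simp add: a_def powr_realpow)
    obtain g :: "nat \<Rightarrow> int ^ 'd \<Rightarrow> complex" where g: "\<And>c \<rho>. 0 < \<rho> \<Longrightarrow>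
      (\<Sum>k\<in>Q. (norm (c k))\<^sup>2) \<le> \<rho>\<^sup>2 \<Longrightarrow>
      \<exists>w :: nat \<Rightarrow> complex. \<forall>x\<in>period_box.
        norm ((\<Sum>k\<in>Q. c k * fourier_char k x) - (\<Sum>l<m. w l * (\<Sum>k\<in>Q. g l k * fourier_char k x)))
          \<le> C0 * sqrt (2 ^ n * real n ^ CARD('d) / real (max m 1)) * \<rho>"
      using width[OF n, of m] unfolding Q_def by blast
    have "kolmogorov_width m (trig_poly_ball (hyperbolic_cross n :: (int ^ 'd) set) p) Linf Linf_norm
        \<le> ennreal (C * E)"
    proof (rule kolmogorov_width_le[where u = "\<lambda>l x. \<Sum>k\<in>Q. g l k * fourier_char k x"])
      fix f assume f: "f \<in> trig_poly_ball (hyperbolic_cross n :: (int ^ 'd) set) p"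
      then obtain b where "f = (\<lambda>x. \<Sum>k\<in>hyperbolic_cross n. b k * fourier_char k x)"
        unfolding trig_poly_ball_def trig_poly_def fourier_char_def by blast
      then have [measurable]: "f \<in> borel_measurable borel" by simp
      obtain c where c: "(\<Sum>k\<in>Q. (norm (c k))\<^sup>2) \<le> (A powr (1 - p / 2))\<^sup>2"
        and fc: "\<And>x. norm (f x - (\<Sum>k\<in>Q. c k * fourier_char k x)) \<le> (real n + 1) ^ (d - 1) * (6 ^ d * A)"
        using cross_ball_decomposition[OF assms f A, of i] unfolding Q_def d_def by blast
      obtain w where w: "\<And>x. x \<in> period_box \<Longrightarrow>
        norm ((\<Sum>k\<in>Q. c k * fourier_char k x) - (\<Sum>l<m. w l * (\<Sum>k\<in>Q. g l k * fourier_char k x)))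
          \<le> C0 * sqrt (2 ^ n * real n ^ d / real (max m 1)) * A powr (1 - p / 2)"
        using g[OF _ c] A unfolding d_def by auto
      have "norm (f x - (\<Sum>l<m. w l * (\<Sum>k\<in>Q. g l k * fourier_char k x))) \<le> C * E"
        if x: "x \<in> period_box" for x
      proof -
        have "norm (f x - (\<Sum>l<m. w l * (\<Sum>k\<in>Q. g l k * fourier_char k x)))
          \<le> norm (f x - (\<Sum>k\<in>Q. c k * fourier_char k x))
            + norm ((\<Sum>k\<in>Q. c k * fourier_char k x) - (\<Sum>l<m. w l * (\<Sum>k\<in>Q. g l k * fourier_char k x)))"
          unfolding dist_norm[symmetric] by (rule dist_triangle)
        also have "\<dots> \<le> 12 ^ d * E + C0 * E"
          using fc[of x] w[OF x] trunc ball by (simp add: mult.assoc)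
        finally show ?thesis by (simp add: C_def distrib_right)
      qed
      then show "\<exists>w :: nat \<Rightarrow> complex. Linf_norm (\<lambda>x. f x - (\<Sum>l<m. w l * (\<Sum>k\<in>Q. g l k * fourier_char k x))) \<le> ennreal (C * E)"
        by (intro exI[of _ w] Linf_norm_le) auto
    qed (rule trig_sum_in_Linf)
    then show ?thesis by (simp add: E_def a_def d_def mult.assoc)
  qed
  moreover have "kolmogorov_width m (trig_poly_ball (hyperbolic_layer n :: (int ^ 'd) set) p) Linf Linf_norm
      \<le> kolmogorov_width m (trig_poly_ball (hyperbolic_cross n :: (int ^ 'd) set) p) Linf Linf_norm" for n m
  proof (intro kolmogorov_width_mono trig_poly_ball_mono)
    show "finite (hyperbolic_cross n :: (int ^ 'd) set)"
      by (rule finite_subset[OF hyperbolic_cross_subset finite_enlarged_cross[of i]])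
  qed (simp add: hyperbolic_layer_def)
  moreover have "0 < C" using C0 by (simp add: C_def add_pos_pos)
  ultimately show ?thesis by (meson order_trans)
qed

end
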